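(* Let $N\ge 2$ be an integer. Then the set $\mathcal S\mathrm{Curr}_r(F_N)$ of all rational subset currents on $F_N$ is a dense subset of the space $\mathcal S\mathrm{Curr}(F_N)$ of all subset currents on $F_N$.
   Context: $F_N$ is the free group of rank $N$ and $\partial F_N$ is its (Gromov) boundary. $\mathfrak C_N$ is the space of all closed subsets $S\subseteq\partial F_N$ containing at least two points, topologized by the Hausdorff distance with respect to a visual metric on $\partial F_N$. The topology does not depend on the choice of visual metric, and $\mathfrak C_N$ is a locally compact totally disconnected Hausdorff space. $F_N$ acts on $\mathfrak C_N$ by homeomorphisms via translations. A subset current on $F_N$ is a positive (i.e. nonnegative, possibly zero) Borel measure $\mu$ on $\mathfrak C_N$ that is $F_N$-invariant and locally finite (finite on compact subsets of $\mathfrak C_N$). $\mathcal S\mathrm{Curr}(F_N)$ is the set of all subset currents, equipped with the weak-* topology of pointwise convergence of integrals of continuous compactly supported functions on $\mathfrak C_N$. For a nontrivial finitely generated subgroup $H\le F_N$, $\Lambda(H)\subseteq\partial F_N$ denotes its limit set, which is an element of $\mathfrak C_N$. $\mathrm{Comm}_{F_N}(H)$ is the commensurator of $H$ in $F_N$, i.e. the set of all $g\in F_N$ such that $H\cap gHg^{-1}$ has finite index in both $H$ and $gHg^{-1}$. The index $m=[\mathrm{Comm}_{F_N}(H):H]$ is finite, and $\mathrm{Comm}_{F_N}(H)$ is equal to its own commensurator. The counting subset current $\eta_H\in\mathcal S\mathrm{Curr}(F_N)$ is defined as follows. If $H=\mathrm{Comm}_{F_N}(H)$, then $\eta_H:=\sum_{H_1\in[H]}\delta_{\Lambda(H_1)}$,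 where $[H]$ is the conjugacy class of $H$ in $F_N$ (the set of subgroups conjugate to $H$) and $\delta$ denotes a Dirac mass. In general, $\eta_H:=m\,\eta_{\mathrm{Comm}_{F_N}(H)}$ with $m=[\mathrm{Comm}_{F_N}(H):H]$. A subset current $\mu$ is rational if $\mu=c\,\eta_H$ for some real $c\ge 0$ and some nontrivial finitely generated subgroup $H\le F_N$. $\mathcal S\mathrm{Curr}_r(F_N)$ is the set of all rational subset currents. *)

theory Defs
  imports
    "HOL-Library.Stream"
    "HOL-Algebra.Generated_Groups"
    "HOL-Probability.Giry_Monad"
begin

section \<open>The free group on a basis \<open>'n\<close>\<close>

text \<open>The pair \<open>(x, True)\<close> stands for the basis element \<open>x\<close>, and \<open>(x, False)\<close> for its inverse.
  The free group consists of the freely reduced words; its rank is \<open>CARD('n)\<close>.\<close>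

type_synonym 'n letter = "'n \<times> bool"

definition inv_letter :: "'n letter \<Rightarrow> 'n letter" where
  "inv_letter a = (fst a, \<not> snd a)"

lemma inv_letter_inv_letter [simp]: "inv_letter (inv_letter a) = a"
  by (simp add: inv_letter_def)

lemma inv_letter_neq [simp]: "inv_letter a \<noteq> a" "a \<noteq> inv_letter a"
  by (auto simp: inv_letter_def prod_eq_iff)

definition freely_reduced :: "'n letter list \<Rightarrow> bool" where
  "freely_reduced w \<longleftrightarrow> successively (\<lambda>a b. b \<noteq> inv_letter a) w"

definition word_cons :: "'n letter \<Rightarrow> 'n letter list \<Rightarrow> 'n letter list" where
  "word_cons a w = (case w of [] \<Rightarrow> [a] | b # v \<Rightarrow> if b = inv_letter a then v else a # w)"

definition free_group :: "'n letter list monoid" where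
  "free_group = \<lparr>carrier = {w. freely_reduced w}, monoid.mult = foldr word_cons, one = []\<rparr>"

lemma reduced_Nil [simp]: "freely_reduced []"
  by (simp add: freely_reduced_def)

lemma reduced_Cons: "freely_reduced (a # w) \<longleftrightarrow> (w \<noteq> [] \<longrightarrow> hd w \<noteq> inv_letter a) \<and> freely_reduced w"
  by (cases w) (auto simp: freely_reduced_def)

lemma reduced_word_cons: "freely_reduced w \<Longrightarrow> freely_reduced (word_cons a w)"
  by (cases w) (auto simp: word_cons_def reduced_Cons)

lemma word_cons_reduced: "freely_reduced (a # w) \<Longrightarrow> word_cons a w = a # w"
  by (cases w) (auto simp: word_cons_def reduced_Cons)

lemma word_cons_inv_letter:
  "freely_reduced w \<Longrightarrow> word_cons (inv_letter a) (word_cons a w) = w"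
  by (cases w) (auto simp: word_cons_def reduced_Cons split: list.splits)

lemma word_cons_inv_letter':
  "freely_reduced w \<Longrightarrow> word_cons a (word_cons (inv_letter a) w) = w"
  using word_cons_inv_letter[of w "inv_letter a"] by simp

lemma reduced_foldr: "freely_reduced v \<Longrightarrow> freely_reduced (foldr word_cons u v)"
  by (induction u) (auto intro: reduced_word_cons)

lemma foldr_word_cons_Nil: "freely_reduced u \<Longrightarrow> foldr word_cons u [] = u"
  by (induction u) (auto simp: word_cons_reduced, auto simp: reduced_Cons word_cons_reduced)

lemma foldr_word_cons_assoc_step:
  assumes "freely_reduced v" "freely_reduced w"
  shows "foldr word_cons (word_cons a v) w = word_cons a (foldr word_cons v w)"
proof (cases v)
  case Nil
  then show ?thesis by (simp add: word_cons_def[of a "[]"])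
next
  case v: (Cons b u)
  have "freely_reduced (foldr word_cons u w)"
    using assms by (simp add: reduced_foldr)
  then show ?thesis
    by (simp add: v word_cons_def[of a "b # u"] word_cons_inv_letter')
qed

lemma foldr_word_cons_assoc:
  assumes "freely_reduced v" "freely_reduced w"
  shows "foldr word_cons (foldr word_cons u v) w = foldr word_cons u (foldr word_cons v w)"
  using assms by (induction u) (auto simp: foldr_word_cons_assoc_step reduced_foldr)

lemma foldr_word_cons_inverse:
  "freely_reduced v \<Longrightarrow> foldr word_cons (rev (map inv_letter u)) (foldr word_cons u v) = v"
  by (induction u) (auto simp: word_cons_inv_letter reduced_foldr)

lemma group_free_group: "group (free_group :: 'n letter list monoid)"
proof (rule groupI)
  fix x :: "'n letter list" assume x: "x \<in> carrier free_group"
  have "foldr word_cons (foldr word_cons (rev (map inv_letter x)) []) x = []"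
    using foldr_word_cons_inverse[of "[]" x] x foldr_word_cons_Nil[of x]
    by (simp add: foldr_word_cons_assoc free_group_def)
  then show "\<exists>y\<in>carrier free_group. y \<otimes>\<^bsub>free_group\<^esub> x = \<one>\<^bsub>free_group\<^esub>"
    by (intro bexI[of _ "foldr word_cons (rev (map inv_letter x)) []"])
       (auto simp: free_group_def reduced_foldr)
qed (auto simp: free_group_def reduced_foldr foldr_word_cons_assoc)


section \<open>Commensurators\<close>

definition conj_subgroup :: "('a, 'b) monoid_scheme \<Rightarrow> 'a \<Rightarrow> 'a set \<Rightarrow> 'a set" where
  "conj_subgroup G g H = (g <#\<^bsub>G\<^esub> H) #>\<^bsub>G\<^esub> (inv\<^bsub>G\<^esub> g)"

definition conj_class :: "('a, 'b) monoid_scheme \<Rightarrow> 'a set \<Rightarrow> 'a set set" where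
  "conj_class G H = (\<lambda>g. conj_subgroup G g H) ` carrier G"

definition cosets_in :: "('a, 'b) monoid_scheme \<Rightarrow> 'a set \<Rightarrow> 'a set \<Rightarrow> 'a set set" where
  "cosets_in G K H = rcosets\<^bsub>G\<lparr>carrier := K\<rparr>\<^esub> H"

definition commensurator :: "('a, 'b) monoid_scheme \<Rightarrow> 'a set \<Rightarrow> 'a set" where
  "commensurator G H = {g \<in> carrier G.
     finite (cosets_in G H (H \<inter> conj_subgroup G g H)) \<and>
     finite (cosets_in G (conj_subgroup G g H) (H \<inter> conj_subgroup G g H))}"

definition finitely_generated_subgroup :: "('a, 'b) monoid_scheme \<Rightarrow> 'a set \<Rightarrow> bool" where
  "finitely_generated_subgroup G H \<longleftrightarrow>
     subgroup H G \<and> (\<exists>X. finite X \<and> X \<subseteq> carrier G \<and> generate G X = H)"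


section \<open>The boundary of the free group\<close>

text \<open>The boundary of the Cayley tree: every boundary point is represented by a unique geodesic
  ray issuing from the identity, that is, by an infinite freely reduced word.\<close>

lemma snth_sconst: "sconst a !! i = a"
  by simp

typedef 'n boundary = "{\<xi> :: 'n letter stream. \<forall>i. \<xi> !! Suc i \<noteq> inv_letter (\<xi> !! i)}"
  morphisms ray Abs_boundary
  by (rule exI[of _ "sconst (undefined, True)"]) (simp add: snth_sconst del: snth.simps)

setup_lifting type_definition_boundary

text \<open>The visual metric based at the identity: the Gromov product of two distinct boundary points
  is the length of the common initial segment of their rays.\<close>

instantiation boundary :: (type) metric_space
begin

definition dist_boundary :: "'a boundary \<Rightarrow> 'a boundary \<Rightarrow> real" where
  "dist \<xi> \<zeta> = (if \<xi> = \<zeta> then 0 else (1 / 2) ^ (LEAST i. ray \<xi> !! i \<noteq> ray \<zeta> !! i))"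

definition uniformity_boundary :: "('a boundary \<times> 'a boundary) filter" where
  "uniformity_boundary = (INF e\<in>{0<..}. principal {(x, y). dist x y < e})"

definition open_boundary :: "'a boundary set \<Rightarrow> bool" where
  "open_boundary U \<longleftrightarrow> (\<forall>x\<in>U. eventually (\<lambda>(x', y). x' = x \<longrightarrow> y \<in> U) uniformity)"

lemma dist_boundary_le_iff_raw:
  "dist \<xi> \<zeta> \<le> (1 / 2) ^ n \<longleftrightarrow> (\<forall>i<n. ray \<xi> !! i = ray \<zeta> !! i)" for \<xi> \<zeta> :: "'a boundary"
proof (cases "\<xi> = \<zeta>")
  case True
  then show ?thesis by (simp add: dist_boundary_def)
next
  case False
  then have "\<exists>i. ray \<xi> !! i \<noteq> ray \<zeta> !! i"
    using smap_alt[of id "ray \<xi>" "ray \<zeta>"] by (auto simp: ray_inject stream.map_id)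
  then have *: "ray \<xi> !! (LEAST i. ray \<xi> !! i \<noteq> ray \<zeta> !! i)
      \<noteq> ray \<zeta> !! (LEAST i. ray \<xi> !! i \<noteq> ray \<zeta> !! i)"
    by (rule LeastI_ex)
  have "dist \<xi> \<zeta> \<le> (1 / 2) ^ n \<longleftrightarrow> n \<le> (LEAST i. ray \<xi> !! i \<noteq> ray \<zeta> !! i)"
    using False by (simp add: dist_boundary_def power_decreasing_iff)
  also have "\<dots> \<longleftrightarrow> (\<forall>i<n. ray \<xi> !! i = ray \<zeta> !! i)"
    using * not_less_Least[of _ "\<lambda>i. ray \<xi> !! i \<noteq> ray \<zeta> !! i"]
    by (meson leI less_le_trans)
  finally show ?thesis .
qed

instance
proof
  fix x y z :: "'a boundary"
  show "dist x y = 0 \<longleftrightarrow> x = y"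
    by (simp add: dist_boundary_def)
  show "dist x y \<le> dist x z + dist y z"
  proof (cases "x = z \<or> y = z")
    case True
    have "dist x y = dist y x"
      by (simp add: dist_boundary_def eq_commute)
    moreover have "dist z z = 0"
      by (simp add: dist_boundary_def)
    ultimately show ?thesis using True by auto
  next
    case False
    then obtain m n where mn: "dist x z = (1 / 2) ^ m" "dist y z = (1 / 2) ^ n"
      by (simp add: dist_boundary_def)
    have "dist x z \<le> (1 / 2) ^ min m n" "dist y z \<le> (1 / 2) ^ min m n"
      unfolding mn by (auto intro: power_decreasing)
    then have "dist x y \<le> (1 / 2) ^ min m n"
      unfolding dist_boundary_le_iff_raw by simp
    also have "\<dots> \<le> dist x z + dist y z"
      unfolding mn by (simp add: min_def)
    finally show ?thesis .
  qed
qed (auto simp: uniformity_boundary_def open_boundary_def)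

end

lemma dist_boundary_le_iff:
  "dist \<xi> \<zeta> \<le> (1 / 2) ^ n \<longleftrightarrow> (\<forall>i<n. ray \<xi> !! i = ray \<zeta> !! i)" for \<xi> \<zeta> :: "'n boundary"
  by (rule dist_boundary_le_iff_raw)

lemma bounded_boundary: "bounded (S :: 'n boundary set)"
proof -
  have "dist x y \<le> 1" for x y :: "'n boundary"
    using dist_boundary_le_iff[of x y 0] by simp
  then show ?thesis
    unfolding bounded_def by blast
qed

definition ray_cons :: "'n letter \<Rightarrow> 'n letter stream \<Rightarrow> 'n letter stream" where
  "ray_cons a \<xi> = (if shd \<xi> = inv_letter a then stl \<xi> else a ## \<xi>)"

lemma reduced_ray_cons:
  assumes "\<forall>i. \<xi> !! Suc i \<noteq> inv_letter (\<xi> !! i)"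
  shows "\<forall>i. ray_cons a \<xi> !! Suc i \<noteq> inv_letter (ray_cons a \<xi> !! i)"
proof
  fix i
  show "ray_cons a \<xi> !! Suc i \<noteq> inv_letter (ray_cons a \<xi> !! i)"
    using assms[rule_format, of "i - 1"] assms[rule_format, of "Suc i"]
    by (cases i) (auto simp: ray_cons_def)
qed

lemma ray_cons_inv_letter:
  assumes "\<forall>i. \<xi> !! Suc i \<noteq> inv_letter (\<xi> !! i)"
  shows "ray_cons (inv_letter a) (ray_cons a \<xi>) = \<xi>"
  using assms[rule_format, of 0] by (cases \<xi>) (auto simp: ray_cons_def)

lift_definition letter_act :: "'n letter \<Rightarrow> 'n boundary \<Rightarrow> 'n boundary" is ray_cons
  using reduced_ray_cons by blast

definition boundary_act :: "'n letter list \<Rightarrow> 'n boundary \<Rightarrow> 'n boundary" where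
  "boundary_act g = foldr letter_act g"

lemma letter_act_inv_letter [simp]: "letter_act (inv_letter a) (letter_act a \<xi>) = \<xi>"
  by transfer (rule ray_cons_inv_letter)

lemma letter_act_inv_letter' [simp]: "letter_act a (letter_act (inv_letter a) \<xi>) = \<xi>"
  using letter_act_inv_letter[of "inv_letter a" \<xi>] by simp

lemma ray_letter_act_cong:
  assumes "\<forall>i<Suc (Suc n). ray \<xi> !! i = ray \<zeta> !! i"
  shows "\<forall>i<n. ray (letter_act a \<xi>) !! i = ray (letter_act a \<zeta>) !! i"
proof (intro allI impI)
  fix i assume "i < n"
  then show "ray (letter_act a \<xi>) !! i = ray (letter_act a \<zeta>) !! i"
    using assms[rule_format, of 0] assms[rule_format, of "Suc i"] assms[rule_format, of "i - 1"]
    by (cases i) (auto simp: letter_act.rep_eq ray_cons_def)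
qed

lemma continuous_on_letter_act: "continuous_on UNIV (letter_act a)"
proof (unfold continuous_on_iff, intro ballI allI impI)
  fix \<xi> :: "'a boundary" and e :: real assume "0 < e"
  then obtain n where n: "(1 / 2) ^ n < e"
    using real_arch_pow_inv[of e "1 / 2"] by auto
  have "dist (letter_act a \<zeta>) (letter_act a \<xi>) < e"
    if "dist \<zeta> \<xi> < (1 / 2) ^ Suc (Suc n)" for \<zeta>
  proof -
    have "dist (letter_act a \<zeta>) (letter_act a \<xi>) \<le> (1 / 2) ^ n"
      using that ray_letter_act_cong[of n \<zeta> \<xi> a]
      by (metis dist_boundary_le_iff less_imp_le)
    with n show ?thesis by simp
  qed
  then show "\<exists>d>0. \<forall>\<zeta>\<in>UNIV. dist \<zeta> \<xi> < d \<longrightarrow> dist (letter_act a \<zeta>) (letter_act a \<xi>) < e"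
    by (intro exI[of _ "(1 / 2) ^ Suc (Suc n)"]) auto
qed

lemma closed_letter_act_image:
  assumes "closed S"
  shows "closed (letter_act a ` S)"
proof -
  have "letter_act a ` S = letter_act (inv_letter a) -` S"
    by (auto simp: image_iff) (metis letter_act_inv_letter')
  then show ?thesis
    using assms continuous_on_letter_act[of "inv_letter a"] by (simp add: closed_vimage)
qed

lemma closed_boundary_act_image: "closed S \<Longrightarrow> closed (boundary_act g ` S)"
proof (induction g)
  case (Cons a g)
  then have "closed (letter_act a ` boundary_act g ` S)"
    by (intro closed_letter_act_image) auto
  then show ?case
    by (simp add: boundary_act_def image_image)
qed (simp add: boundary_act_def)

lemma inj_boundary_act: "inj (boundary_act g)"
proof (induction g)
  case (Cons a g)
  have "inj (letter_act a)"
    by (rule inj_on_inverseI[of _ "letter_act (inv_letter a)"]) simp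
  with Cons show ?case
    using inj_compose[of "letter_act a" "boundary_act g"] by (simp add: boundary_act_def comp_def)
qed (simp add: boundary_act_def)

text \<open>The accumulation points in the boundary of a subgroup \<open>H\<close> of \<open>free_group\<close>: a sequence of
  group elements converges to \<open>\<xi>\<close> iff for each \<open>n\<close> almost all of them share with \<open>ray \<xi>\<close> an
  initial segment of length \<open>n\<close>.\<close>

definition limit_set :: "'n letter list set \<Rightarrow> 'n boundary set" where
  "limit_set H = {\<xi>. \<exists>h :: nat \<Rightarrow> 'n letter list. (\<forall>k. h k \<in> H) \<and>
     (\<forall>n. eventually (\<lambda>k. take n (h k) = stake n (ray \<xi>)) sequentially)}"


section \<open>The space of closed subsets of the boundary with at least two points\<close>

definition hausdorff_dist :: "'a :: metric_space set \<Rightarrow> 'a set \<Rightarrow> real" where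
  "hausdorff_dist S T = max (SUP x\<in>S. infdist x T) (SUP y\<in>T. infdist y S)"

lemma hausdorff_dist_le_iff:
  assumes "bounded S" "bounded T" "S \<noteq> {}" "T \<noteq> {}"
  shows "hausdorff_dist S T \<le> r \<longleftrightarrow> (\<forall>x\<in>S. infdist x T \<le> r) \<and> (\<forall>y\<in>T. infdist y S \<le> r)"
proof -
  have bdd: "bdd_above ((\<lambda>x. infdist x B) ` A)"
    if AB: "bounded A" "B \<noteq> {}" for A B :: "'a set"
  proof -
    obtain b where b: "b \<in> B" using AB(2) by blast
    obtain e where e: "\<And>x. x \<in> A \<Longrightarrow> dist b x \<le> e"
      using AB(1) by (meson bounded_any_center)
    have "infdist x B \<le> e" if "x \<in> A" for x
      using infdist_le[OF b, of x] e[OF that] by (simp add: dist_commute)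
    then show ?thesis by (auto intro!: bdd_aboveI2)
  qed
  show ?thesis
    using assms bdd[of S T] bdd[of T S] by (simp add: hausdorff_dist_def cSUP_le_iff)
qed

lemma hausdorff_dist_triangle:
  assumes "bounded S" "bounded T" "bounded U" "S \<noteq> {}" "T \<noteq> {}" "U \<noteq> {}"
  shows "hausdorff_dist S T \<le> hausdorff_dist S U + hausdorff_dist T U"
proof -
  have *: "infdist x C \<le> infdist x B + r"
    if "B \<noteq> {}" "\<forall>b\<in>B. infdist b C \<le> r" for x r and B C :: "'a set"
  proof -
    have "infdist x C - r \<le> dist x b" if "b \<in> B" for b
      using infdist_triangle[of x C b] \<open>\<forall>b\<in>B. infdist b C \<le> r\<close> that by fastforce
    then have "infdist x C - r \<le> infdist x B"
      using \<open>B \<noteq> {}\<close> by (simp add: infdist_notempty cINF_greatest)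
    then show ?thesis by simp
  qed
  have SU: "\<forall>x\<in>S. infdist x U \<le> hausdorff_dist S U" "\<forall>x\<in>U. infdist x S \<le> hausdorff_dist S U"
    using assms hausdorff_dist_le_iff[of S U "hausdorff_dist S U"] by auto
  have TU: "\<forall>x\<in>T. infdist x U \<le> hausdorff_dist T U" "\<forall>x\<in>U. infdist x T \<le> hausdorff_dist T U"
    using assms hausdorff_dist_le_iff[of T U "hausdorff_dist T U"] by auto
  have "infdist x T \<le> hausdorff_dist S U + hausdorff_dist T U" if "x \<in> S" for x
    using *[OF assms(6) TU(2), of x] SU(1) that by fastforce
  moreover have "infdist y S \<le> hausdorff_dist S U + hausdorff_dist T U" if "y \<in> T" for y
    using *[OF assms(6) SU(2), of y] TU(1) that by fastforce
  ultimately show ?thesis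
    using assms by (simp add: hausdorff_dist_le_iff)
qed

typedef 'n cspace = "{S :: 'n boundary set. closed S \<and> (\<exists>x\<in>S. \<exists>y\<in>S. x \<noteq> y)}"
  morphisms points Abs_cspace
proof -
  let ?p = "\<lambda>b. Abs_boundary (sconst (undefined :: 'n, b))"
  have "ray (?p b) = sconst (undefined, b)" for b
    by (rule Abs_boundary_inverse) (simp add: snth_sconst del: snth.simps)
  then have "?p True \<noteq> ?p False"
    by (metis prod.inject snth_sconst)
  then show ?thesis
    by (intro exI[of _ UNIV]) auto
qed

setup_lifting type_definition_cspace

lemma points_nonempty: "points S \<noteq> {}"
  using points[of S] by blast

instantiation cspace :: (type) metric_space
begin

definition dist_cspace :: "'a cspace \<Rightarrow> 'a cspace \<Rightarrow> real" where
  "dist S T = hausdorff_dist (points S) (points T)"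

definition uniformity_cspace :: "('a cspace \<times> 'a cspace) filter" where
  "uniformity_cspace = (INF e\<in>{0<..}. principal {(x, y). dist x y < e})"

definition open_cspace :: "'a cspace set \<Rightarrow> bool" where
  "open_cspace U \<longleftrightarrow> (\<forall>x\<in>U. eventually (\<lambda>(x', y). x' = x \<longrightarrow> y \<in> U) uniformity)"

instance
proof
  fix S T U :: "'a cspace"
  have iff: "dist S T \<le> r \<longleftrightarrow>
    (\<forall>x\<in>points S. infdist x (points T) \<le> r) \<and> (\<forall>y\<in>points T. infdist y (points S) \<le> r)"
    for S T :: "'a cspace" and r
    by (simp add: dist_cspace_def hausdorff_dist_le_iff bounded_boundary points_nonempty)
  show "dist S T = 0 \<longleftrightarrow> S = T"
  proof
    assume "dist S T = 0"
    then have "\<forall>x\<in>points S. infdist x (points T) = 0" "\<forall>y\<in>points T. infdist y (points S) = 0"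
      using iff[of S T 0] by (simp_all add: order_antisym infdist_nonneg)
    then have "points S \<subseteq> closure (points T)" "points T \<subseteq> closure (points S)"
      by (simp_all add: subset_iff in_closure_iff_infdist_zero points_nonempty)
    then have "points S = points T"
      using points[of S] points[of T] by auto
    then show "S = T" by (simp add: points_inject)
  next
    assume "S = T"
    then have "dist S T \<le> 0" using iff[of S T 0] by auto
    moreover have "0 \<le> dist S T"
    proof -
      obtain x where x: "x \<in> points S" using points_nonempty by blast
      have "infdist x (points T) \<le> dist S T" using iff[of S T "dist S T"] x by auto
      then show ?thesis using infdist_nonneg[of x "points T"] by linarith
    qed
    ultimately show "dist S T = 0" by simp
  qed
  show "dist S T \<le> dist S U + dist T U"
    unfolding dist_cspace_def
    by (rule hausdorff_dist_triangle) (auto simp: bounded_boundary points_nonempty)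
qed (auto simp: uniformity_cspace_def open_cspace_def)

end

lift_definition translate :: "'n letter list \<Rightarrow> 'n cspace \<Rightarrow> 'n cspace" is
  "\<lambda>g S. boundary_act g ` S"
  using closed_boundary_act_image by (fastforce simp: inj_eq[OF inj_boundary_act])


section \<open>Subset currents\<close>

definition subset_currents :: "'n cspace measure set" where
  "subset_currents = {\<mu>. sets \<mu> = sets borel \<and>
     (\<forall>g\<in>carrier free_group. \<forall>A\<in>sets borel. emeasure \<mu> (translate g ` A) = emeasure \<mu> A) \<and>
     (\<forall>K. compact K \<longrightarrow> emeasure \<mu> K < \<infinity>)}"

definition compactly_supported :: "('n cspace \<Rightarrow> real) set" where
  "compactly_supported = {f. continuous_on UNIV f \<and> compact (closure {S. f S \<noteq> 0})}"

text \<open>The coarsest topology on \<open>subset_currents\<close> for which integration against each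
  \<open>f \<in> compactly_supported\<close> is continuous.\<close>

definition subset_current_topology :: "'n cspace measure topology" where
  "subset_current_topology = pullback_topology subset_currents
     (\<lambda>\<mu>. \<lambda>f\<in>compactly_supported. integral\<^sup>L \<mu> f)
     (product_topology (\<lambda>_. euclideanreal) compactly_supported)"

lemma topspace_subset_current_topology [simp]:
  "topspace subset_current_topology = subset_currents"
  by (auto simp: subset_current_topology_def topspace_pullback_topology)


section \<open>Counting and rational subset currents\<close>

text \<open>The measure \<open>A \<mapsto> \<Sum>H\<^sub>1\<in>[H]. \<delta>\<^bsub>\<Lambda>(H\<^sub>1)\<^esub>(A)\<close>; an integral against \<open>count_space\<close>
  is a possibly infinite sum.\<close>

definition dirac_sum :: "'n letter list set \<Rightarrow> 'n cspace measure" where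
  "dirac_sum H = measure_of UNIV (sets borel)
     (\<lambda>A. \<integral>\<^sup>+ H\<^sub>1. emeasure (return borel (Abs_cspace (limit_set H\<^sub>1))) A
       \<partial>count_space (conj_class free_group H))"

lemma sets_dirac_sum [simp]: "sets (dirac_sum H) = sets borel"
  using sets.sigma_sets_eq[of borel] by (simp add: dirac_sum_def sets_measure_of_conv)

lemma emeasure_dirac_sum:
  assumes "A \<in> sets borel"
  shows "emeasure (dirac_sum H) A =
    (\<integral>\<^sup>+ H\<^sub>1. emeasure (return borel (Abs_cspace (limit_set H\<^sub>1))) A
       \<partial>count_space (conj_class free_group H))"
proof (unfold dirac_sum_def, rule emeasure_measure_of_sigma)
  let ?f = "\<lambda>A. \<integral>\<^sup>+ H\<^sub>1. emeasure (return borel (Abs_cspace (limit_set H\<^sub>1))) A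
       \<partial>count_space (conj_class free_group H)"
  show "sigma_algebra UNIV (sets (borel :: 'a cspace measure))"
    using sets.sigma_algebra_axioms[of borel] by simp
  show "positive (sets borel) ?f"
    by (simp add: positive_def)
  show "countably_additive (sets borel) ?f"
  proof (rule countably_additiveI)
    fix B :: "nat \<Rightarrow> 'a cspace set"
    assume B: "range B \<subseteq> sets borel" "disjoint_family B"
    have "(\<Sum>i. ?f (B i)) =
      (\<integral>\<^sup>+ H\<^sub>1. (\<Sum>i. emeasure (return borel (Abs_cspace (limit_set H\<^sub>1))) (B i))
       \<partial>count_space (conj_class free_group H))"
      by (rule nn_integral_suminf[symmetric]) simp
    also have "\<dots> = ?f (\<Union>i. B i)"
      using B by (subst suminf_emeasure) auto
    finally show "(\<Sum>i. ?f (B i)) = ?f (\<Union>i. B i)" .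
  qed
qed (use assms in simp)

text \<open>If \<open>H\<close> is its own commensurator, the scaling factor is \<open>1\<close> and this is \<open>dirac_sum H\<close>.\<close>

definition counting_current :: "'n letter list set \<Rightarrow> 'n cspace measure" where
  "counting_current H =
     (let C = commensurator free_group H
      in scale_measure (of_nat (card (cosets_in free_group C H))) (dirac_sum C))"

definition rational_subset_currents :: "'n cspace measure set" where
  "rational_subset_currents = {\<mu> \<in> subset_currents. \<exists>c H. 0 \<le> (c :: real) \<and>
     finitely_generated_subgroup free_group H \<and> H \<noteq> {\<one>\<^bsub>free_group\<^esub>} \<and>
     \<mu> = scale_measure (ennreal c) (counting_current H)}"

end

theory Submission
  imports Defs
begin

text \<open>
  A closed set \<open>S\<close> of at least two boundary points is the same thing as its convex hull, a subtree
  without leaves of the Cayley tree.  By invariance a subset current \<open>\<mu>\<close> is determined by its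
  restriction to the compact open set of those \<open>S\<close> whose hull passes through the identity
  (\<open>compact_branching\<close>, \<open>compact_translate_branching_cover\<close>), and there by the masses it gives to
  the possible \<open>r\<close>-balls \<open>T\<close> around the identity, for all \<open>r\<close>.  Convergence of these masses implies
  convergence of all integrals of continuous functions with compact support
  (\<open>converges_if_compactly_supported\<close>).  So it suffices to approximate, for fixed \<open>r\<close>, the finitely
  many numbers \<open>\<mu>(T)\<close> by a rational current.

  Finite folded graphs without leaves supply the currents.  If such a graph is connected, the reduced
  loops at a vertex form a finitely generated subgroup \<open>H\<close> whose limit set is the set of rays starting
  at that vertex; the universal cover of the graph is the hull of the limit set.  The commensurator of
  \<open>H\<close> is the stabilizer of this hull, and the counting current of \<open>H\<close> gives to \<open>T\<close> as its mass the
  number of vertices of the graph around which the \<open>r\<close>-ball of the universal cover looks like \<open>T\<close>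
  (\<open>emeasure_counting_current_branching\<close>).  That \<open>H\<close> has no smaller limit set rests on the fact that a
  reduced walk in the graph can always be continued to a reduced loop, because the random walk without
  backtracking preserves the uniform distribution on the arcs (\<open>reduced_walk_extends_to_loop\<close>).

  Invariance of \<open>\<mu>\<close> under a basis element \<open>a\<close> says that hulls leaving the identity along \<open>a\<close> and hulls
  arriving there along \<open>a\<close> show the same pictures of the common part of the balls at the two ends of the
  edge, with equal masses (\<open>edge_balance\<close>).  These are linear equations with integer coefficients for
  the numbers \<open>\<mu>(T)\<close>, so they have solutions \<open>p(T) / q\<close> with natural numbers \<open>p(T)\<close> and \<open>q\<close> arbitrarily
  close to \<open>\<mu>(T)\<close>.  Take \<open>p(T)\<close> vertices of type \<open>T\<close>.  The equations for the \<open>p(T)\<close> say precisely that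
  for every \<open>a\<close> the vertices can be matched along edges labelled \<open>a\<close> so that both ends agree on the common
  part of their balls, and in the resulting graph every vertex of type \<open>T\<close> has the \<open>r\<close>-ball \<open>T\<close>
  (\<open>readable_words_matched\<close>).

  This graph need not be connected, whereas a rational current belongs to a single subgroup.  Every
  component contains an edge which is not a bridge.  In \<open>M\<close> disjoint copies of the graph let this edge
  lead from each copy to the next one, and join the ends left over in the first and the last copy to
  a ring through all components.  The new graph is connected, and only a number of balls that is
  independent of \<open>M\<close> has changed, so for large \<open>M\<close> the frequencies of the types are as close to the old
  ones as desired (\<open>connected_graph_approximating_graph\<close>).
\<close>

section \<open>Reduced words, rays and the action on the boundary\<close>

interpretation free: group "free_group :: 'n letter list monoid"
  by (rule group_free_group)

lemma carrier_free_group [simp]: "carrier free_group = {w. freely_reduced w}"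
  and mult_free_group [simp]: "u \<otimes>\<^bsub>free_group\<^esub> w = foldr word_cons u w"
  and one_free_group [simp]: "\<one>\<^bsub>free_group\<^esub> = []"
  by (simp_all add: free_group_def)

abbreviation word_inverse :: "'n letter list \<Rightarrow> 'n letter list" where
  "word_inverse w \<equiv> rev (map inv_letter w)"

lemma freely_reduced_nth:
  "freely_reduced w \<longleftrightarrow> (\<forall>i. Suc i < length w \<longrightarrow> w ! Suc i \<noteq> inv_letter (w ! i))"
  by (auto simp: freely_reduced_def successively_conv_nth)

lemma reduced_append:
  "freely_reduced (u @ w) \<longleftrightarrow>
     freely_reduced u \<and> freely_reduced w \<and> (u \<noteq> [] \<and> w \<noteq> [] \<longrightarrow> hd w \<noteq> inv_letter (last u))"
  by (auto simp: freely_reduced_def successively_append_iff)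

lemma reduced_take: "freely_reduced w \<Longrightarrow> freely_reduced (take n w)"
  by (metis append_take_drop_id reduced_append)

lemma reduced_word_inverse: "freely_reduced w \<Longrightarrow> freely_reduced (word_inverse w)"
  by (induction w) (auto simp: reduced_append reduced_Cons last_rev hd_map)

lemma inv_free_group: "freely_reduced w \<Longrightarrow> inv\<^bsub>free_group\<^esub> w = word_inverse w"
proof (rule free.inv_equality)
  assume w: "freely_reduced w"
  have "foldr word_cons (word_inverse w) w = foldr word_cons (word_inverse w) (foldr word_cons w [])"
    using w by (simp add: foldr_word_cons_Nil)
  also have "\<dots> = []"
    by (rule foldr_word_cons_inverse) simp
  finally show "word_inverse w \<otimes>\<^bsub>free_group\<^esub> w = \<one>\<^bsub>free_group\<^esub>" by simp
qed (auto intro: reduced_word_inverse)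

lemma ray_Suc_neq: "ray \<xi> !! Suc i \<noteq> inv_letter (ray \<xi> !! i)"
  using ray[of \<xi>] by simp

lemma reduced_stake: "freely_reduced (stake n (ray \<xi>))"
  by (simp add: freely_reduced_nth ray_Suc_neq del: snth.simps)

lemma boundary_eqI:
  assumes "\<And>n. stake n (ray \<xi>) = stake n (ray \<zeta>)"
  shows "\<xi> = \<zeta>"
proof -
  have "ray \<xi> !! i = ray \<zeta> !! i" for i
    using assms[of "Suc i"] by (metis lessI stake_nth)
  then have "ray \<xi> = ray \<zeta>"
    using smap_alt[of id "ray \<xi>" "ray \<zeta>"] by (simp add: stream.map_id)
  then show ?thesis by (simp add: ray_inject)
qed

lemma stake_eq_iff: "stake n s = stake n t \<longleftrightarrow> (\<forall>i<n. s !! i = t !! i)"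
  by (metis length_stake nth_equalityI stake_nth)

lemma dist_le_iff_stake: "dist \<xi> \<zeta> \<le> (1 / 2) ^ n \<longleftrightarrow> stake n (ray \<xi>) = stake n (ray \<zeta>)"
  by (simp add: dist_boundary_le_iff stake_eq_iff)

lemma closed_by_initial_words: "closed {\<xi>. \<forall>n. stake n (ray \<xi>) \<in> T n}"
  unfolding closed_sequential_limits
proof (intro allI impI, elim conjE)
  fix x l assume x: "\<forall>n. x n \<in> {\<xi>. \<forall>n. stake n (ray \<xi>) \<in> T n}" "x \<longlonglongrightarrow> l"
  have "stake n (ray l) \<in> T n" for n
  proof -
    have "\<forall>\<^sub>F k in sequentially. dist (x k) l < (1 / 2) ^ n"
      using x(2) by (rule tendstoD) simp
    then obtain k where "dist (x k) l < (1 / 2) ^ n"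
      by (meson eventually_happens sequentially_bot)
    then have "stake n (ray (x k)) = stake n (ray l)"
      by (simp flip: dist_le_iff_stake)
    moreover have "stake n (ray (x k)) \<in> T n" using x(1) by blast
    ultimately show ?thesis by simp
  qed
  then show "l \<in> {\<xi>. \<forall>n. stake n (ray \<xi>) \<in> T n}" by simp
qed

text \<open>In a tree without dead ends every vertex lies on an infinite branch: extend it again and
  again by an arbitrarily chosen child.  The rays of a graph and the points of the limit of a
  Cauchy sequence of closed sets are found in this way.\<close>

lemma ray_through_tree:
  assumes w: "w \<in> Q"
    and pre: "\<And>u n. u \<in> Q \<Longrightarrow> take n u \<in> Q"
    and red: "\<And>u. u \<in> Q \<Longrightarrow> freely_reduced u"
    and ext: "\<And>u. u \<in> Q \<Longrightarrow> \<exists>a. u @ [a] \<in> Q"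
  obtains \<xi> where "\<And>n. stake n (ray \<xi>) \<in> Q" "stake (length w) (ray \<xi>) = w"
proof -
  define e where "e u = (SOME a. u @ [a] \<in> Q)" for u
  have e: "u @ [e u] \<in> Q" if "u \<in> Q" for u
    unfolding e_def using ext[OF that] by (rule someI_ex)
  define f where "f = rec_nat w (\<lambda>_ u. u @ [e u])"
  have f0: "f 0 = w" and fS: "f (Suc n) = f n @ [e (f n)]" for n
    by (simp_all add: f_def)
  have fQ: "f n \<in> Q" for n by (induction n) (auto simp: f0 fS w e)
  have len: "length (f n) = length w + n" for n by (induction n) (auto simp: f0 fS)
  have mono: "take (length (f m)) (f (m + k)) = f m" for m k
  proof (induction k)
    case (Suc k)
    have "length (f m) \<le> length (f (m + k))" by (simp add: len)
    then show ?case using Suc by (simp add: fS)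
  qed simp
  have nth: "f (m + k) ! i = f m ! i" if "i < length (f m)" for m k i
    using mono[of m k] that by (metis nth_take)
  have nth': "f m ! i = f (Suc i) ! i" if "i < length (f m)" for m i
  proof (cases "m \<le> Suc i")
    case True
    then show ?thesis using nth[OF that, of "Suc i - m"] by simp
  next
    case False
    then show ?thesis using nth[of i "Suc i" "m - Suc i"] by (simp add: len)
  qed
  define s where "s = smap (\<lambda>i. f (Suc i) ! i) (fromN 0)"
  have s: "s !! i = f (Suc i) ! i" for i by (simp add: s_def del: snth.simps)
  have st: "stake n s = take n (f m)" if "n \<le> length (f m)" for n m
    by (rule nth_equalityI) (use that nth'[of _ m] in \<open>auto simp: s simp del: snth.simps\<close>)
  have sQ: "stake n s \<in> Q" for n
    using st[of n n] pre[OF fQ[of n], of n] by (simp add: len)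
  have "s !! Suc i \<noteq> inv_letter (s !! i)" for i
    using red[OF sQ[of "Suc (Suc i)"]] unfolding freely_reduced_nth
    by (auto simp del: snth.simps stake.simps dest: spec[of _ i])
  then have "ray (Abs_boundary s) = s"
    by (intro Abs_boundary_inverse) blast
  then show thesis
    using that[of "Abs_boundary s"] sQ st[of "length w" 0] by (simp add: f0)
qed

lemma letter_act_word: "boundary_act [a] \<xi> = letter_act a \<xi>"
  by (simp add: boundary_act_def)

lemma boundary_act_Nil [simp]: "boundary_act [] \<xi> = \<xi>"
  by (simp add: boundary_act_def)

lemma boundary_act_Cons: "boundary_act (a # w) \<xi> = letter_act a (boundary_act w \<xi>)"
  by (simp add: boundary_act_def)

lemma boundary_act_append: "boundary_act (u @ w) \<xi> = boundary_act u (boundary_act w \<xi>)"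
  by (simp add: boundary_act_def)

lemma boundary_act_word_cons: "boundary_act (word_cons a w) \<xi> = letter_act a (boundary_act w \<xi>)"
  by (cases w) (auto simp: word_cons_def boundary_act_Cons)

lemma boundary_act_mult:
  "boundary_act (foldr word_cons u w) \<xi> = boundary_act u (boundary_act w \<xi>)"
  by (induction u) (auto simp: boundary_act_word_cons boundary_act_Cons)

lemma boundary_act_word_inverse [simp]:
  "boundary_act (word_inverse w) (boundary_act w \<xi>) = \<xi>"
  by (induction w arbitrary: \<xi>) (auto simp: boundary_act_Cons boundary_act_append)

lemma boundary_act_word_inverse' [simp]:
  "boundary_act w (boundary_act (word_inverse w) \<xi>) = \<xi>"
  by (induction w arbitrary: \<xi>) (auto simp: boundary_act_Cons boundary_act_append)

lemma boundary_act_image_inverse [simp]: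
  "boundary_act (word_inverse w) ` boundary_act w ` S = S"
  "boundary_act w ` boundary_act (word_inverse w) ` S = S"
  by (simp_all add: image_image)

lemma boundary_act_mult_image:
  "boundary_act (foldr word_cons u w) ` S = boundary_act u ` boundary_act w ` S"
  by (simp add: image_image boundary_act_mult)

lemma stake_letter_act_cong:
  "stake (Suc (Suc n)) (ray \<xi>) = stake (Suc (Suc n)) (ray \<zeta>) \<Longrightarrow>
   stake n (ray (letter_act a \<xi>)) = stake n (ray (letter_act a \<zeta>))"
  using ray_letter_act_cong[of n \<xi> \<zeta> a] unfolding stake_eq_iff by blast

text \<open>Nothing cancels when \<open>w\<inverse>\<close> is put in front of a ray that does not start with the first letter
  of \<open>w\<close>; so \<open>w\<inverse>\<close> carries all these rays into a single cylinder, away from the identity.\<close>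

lemma shd_boundary_act_word_inverse:
  assumes "freely_reduced w" "w \<noteq> []" "shd (ray \<xi>) \<noteq> hd w"
  shows "shd (ray (boundary_act (word_inverse w) \<xi>)) = inv_letter (last w)"
  using assms
proof (induction w arbitrary: \<xi>)
  case (Cons a w)
  have sh: "shd (ray (letter_act (inv_letter a) \<xi>)) = inv_letter a"
    using Cons.prems by (simp add: letter_act.rep_eq ray_cons_def)
  show ?case
  proof (cases "w = []")
    case True
    then show ?thesis using sh by (simp add: boundary_act_Cons)
  next
    case False
    then have "hd w \<noteq> inv_letter a" using Cons.prems by (simp add: reduced_Cons)
    then show ?thesis
      using Cons.IH[of "letter_act (inv_letter a) \<xi>"] sh False Cons.prems
      by (simp add: boundary_act_append boundary_act_Cons reduced_Cons)
  qed
qed simp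

section \<open>The topology of the space of closed sets\<close>

text \<open>The sphere of radius \<open>n\<close> around the identity in the union of the rays; since the words of
  length \<open>n\<close> determine their prefixes, it encodes the whole ball.\<close>

definition initial_words :: "nat \<Rightarrow> 'n boundary set \<Rightarrow> 'n letter list set" where
  "initial_words n S = (\<lambda>\<xi>. stake n (ray \<xi>)) ` S"

lemma initial_words_length: "w \<in> initial_words n S \<Longrightarrow> length w = n"
  by (auto simp: initial_words_def)

lemma initial_words_reduced: "w \<in> initial_words n S \<Longrightarrow> freely_reduced w"
  by (auto simp: initial_words_def reduced_stake)

lemma take_initial_words: "m \<le> n \<Longrightarrow> take m ` initial_words n S = initial_words m S"
  by (simp add: initial_words_def image_image take_stake min_absorb1)

lemma initial_words_eq_mono:
  "initial_words n S = initial_words n T \<Longrightarrow> m \<le> n \<Longrightarrow> initial_words m S = initial_words m T"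
  by (metis take_initial_words)

lemma initial_words_in_finite:
  "initial_words n S \<in> Pow {w :: ('n :: finite) letter list. set w \<subseteq> UNIV \<and> length w = n}"
  by (auto simp: initial_words_def)

lemma finite_word_sets: "finite (Pow {w :: ('n :: finite) letter list. set w \<subseteq> UNIV \<and> length w = n})"
  by (intro iffD2[OF finite_Pow_iff] finite_lists_length_eq finite)

lemma infdist_le_iff_initial_words:
  assumes "S \<noteq> {}"
  shows "infdist \<xi> S \<le> (1 / 2) ^ n \<longleftrightarrow> stake n (ray \<xi>) \<in> initial_words n S"
proof
  assume "stake n (ray \<xi>) \<in> initial_words n S"
  then obtain \<zeta> where "\<zeta> \<in> S" "dist \<xi> \<zeta> \<le> (1 / 2) ^ n"
    by (auto simp: initial_words_def dist_le_iff_stake)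
  then show "infdist \<xi> S \<le> (1 / 2) ^ n" by (meson infdist_le order_trans)
next
  assume le: "infdist \<xi> S \<le> (1 / 2) ^ n"
  \<comment> \<open>The metric takes only the values \<open>0\<close> and \<open>2\<^sup>-\<^sup>k\<close>, so the infimum may be replaced by a
    point at distance less than \<open>2 * 2\<^sup>-\<^sup>n\<close>.\<close>
  have "infdist \<xi> S < 2 * (1 / 2) ^ n"
    using le by (rule order.strict_trans1) simp
  then obtain \<zeta> where \<zeta>: "\<zeta> \<in> S" "dist \<xi> \<zeta> < 2 * (1 / 2) ^ n"
    using assms by (metis (mono_tags, lifting) cINF_greatest infdist_notempty not_le)
  have "dist \<xi> \<zeta> \<le> (1 / 2) ^ n"
  proof (cases "\<xi> = \<zeta>")
    case False
    then obtain k where k: "dist \<xi> \<zeta> = (1 / 2) ^ k" by (simp add: dist_boundary_def)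
    show ?thesis
    proof (cases "n \<le> k")
      case True
      then show ?thesis unfolding k by (intro power_decreasing) auto
    next
      case False
      then obtain j where j: "n = Suc k + j" by (metis add_Suc less_iff_Suc_add not_le add_Suc_right)
      have "2 * (1 / 2) ^ n = (1 / 2 :: real) ^ k * (1 / 2) ^ j" by (simp add: j power_add)
      also have "\<dots> \<le> (1 / 2) ^ k" by (simp add: mult_left_le power_le_one)
      finally show ?thesis using \<zeta>(2) k by simp
    qed
  qed simp
  then show "stake n (ray \<xi>) \<in> initial_words n S"
    using \<zeta>(1) by (auto simp: initial_words_def dist_le_iff_stake)
qed

lemma dist_cspace_le_iff:
  "dist S T \<le> (1 / 2) ^ n \<longleftrightarrow> initial_words n (points S) = initial_words n (points T)"
proof -
  have "dist S T \<le> (1 / 2) ^ n \<longleftrightarrow>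
      (\<forall>x\<in>points S. infdist x (points T) \<le> (1 / 2) ^ n) \<and> (\<forall>y\<in>points T. infdist y (points S) \<le> (1 / 2) ^ n)"
    by (simp add: dist_cspace_def hausdorff_dist_le_iff bounded_boundary points_nonempty)
  also have "\<dots> \<longleftrightarrow> initial_words n (points S) = initial_words n (points T)"
  proof -
    have "(\<forall>x\<in>A. stake n (ray x) \<in> initial_words n B) \<longleftrightarrow> initial_words n A \<subseteq> initial_words n B" for A B :: "'a boundary set"
      unfolding initial_words_def image_subset_iff ..
    then show ?thesis
      by (simp only: infdist_le_iff_initial_words[OF points_nonempty] set_eq_subset)
  qed
  finally show ?thesis .
qed

lemma eventually_close_pow: "0 < e \<Longrightarrow> \<exists>n. (1 / 2 :: real) ^ n < e"
  using real_arch_pow_inv[of e "1 / 2"] by auto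

lemma open_if_finite_level:
  fixes U :: "'n cspace set"
  assumes "\<And>S T. S \<in> U \<Longrightarrow> initial_words n (points S) = initial_words n (points T) \<Longrightarrow> T \<in> U"
  shows "open U"
  unfolding open_dist
proof (intro ballI exI[of _ "(1 / 2) ^ n"] conjI allI impI)
  fix S T assume "S \<in> U" "dist T S < (1 / 2) ^ n"
  then show "T \<in> U" using assms[of S T] dist_cspace_le_iff[of T S n] by auto
qed simp

lemma closed_if_finite_level:
  fixes U :: "'n cspace set"
  assumes "\<And>S T. S \<in> U \<Longrightarrow> initial_words n (points S) = initial_words n (points T) \<Longrightarrow> T \<in> U"
  shows "closed U"
  unfolding closed_def by (rule open_if_finite_level[of _ n]) (use assms in \<open>metis ComplD ComplI\<close>)

definition cylinder :: "nat \<Rightarrow> 'n letter list set \<Rightarrow> 'n cspace set" where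
  "cylinder n T = {S. initial_words n (points S) = T}"

lemma open_cylinder: "open (cylinder n T)" and closed_cylinder: "closed (cylinder n T)"
  by (auto intro!: open_if_finite_level[of _ n] closed_if_finite_level[of _ n] simp: cylinder_def)

text \<open>The sets \<open>S\<close> whose convex hull in the Cayley tree passes through the identity.\<close>

definition branching :: "'n cspace set" where
  "branching = {S. \<exists>\<xi>\<in>points S. \<exists>\<zeta>\<in>points S. shd (ray \<xi>) \<noteq> shd (ray \<zeta>)}"

lemma branching_iff:
  "S \<in> branching \<longleftrightarrow> (\<exists>u\<in>initial_words 1 (points S). \<exists>w\<in>initial_words 1 (points S). u \<noteq> w)"
  by (auto simp: branching_def initial_words_def)

lemma branching_cong:
  "initial_words n (points S) = initial_words n (points T) \<Longrightarrow> 1 \<le> n \<Longrightarrow>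
    S \<in> branching \<longleftrightarrow> T \<in> branching"
  using initial_words_eq_mono[of n "points S" "points T" 1] by (simp add: branching_iff)

lemma open_branching: "open branching" and closed_branching: "closed branching"
  by (auto intro!: open_if_finite_level[of _ 1] closed_if_finite_level[of _ 1]
      simp: branching_iff)

text \<open>Closeness means equality of the initial words, so these stabilize along a Cauchy sequence.\<close>

lemma Cauchy_cspace_stabilizes:
  assumes "Cauchy (f :: nat \<Rightarrow> 'n cspace)"
  obtains N where "\<And>n m. N n \<le> m \<Longrightarrow> initial_words n (points (f m)) = initial_words n (points (f (N n)))"
proof -
  have "\<exists>N. \<forall>m\<ge>N. initial_words n (points (f m)) = initial_words n (points (f N))" for n
  proof -
    obtain N where N: "\<And>m k. m \<ge> N \<Longrightarrow> k \<ge> N \<Longrightarrow> dist (f m) (f k) < (1 / 2) ^ n"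
      using assms unfolding Cauchy_def by (metis zero_less_divide_1_iff zero_less_numeral zero_less_power)
    then show ?thesis
      using dist_cspace_le_iff by (metis less_imp_le order_refl)
  qed
  then show thesis using that by metis
qed

text \<open>The stable balls of a Cauchy sequence form a tree without dead ends; its branches make up the
  limit.\<close>

lemma complete_branching: "complete (branching :: 'n cspace set)"
  unfolding complete_def
proof (intro allI impI, elim conjE)
  fix f :: "nat \<Rightarrow> 'n cspace"
  assume fb: "\<forall>n. f n \<in> branching" and "Cauchy f"
  from Cauchy_cspace_stabilizes[OF this(2)] obtain N where
    N: "\<And>n m. N n \<le> m \<Longrightarrow> initial_words n (points (f m)) = initial_words n (points (f (N n)))"
    by blast
  define T where "T n = initial_words n (points (f (N n)))" for n
  have T_take: "take m ` T n = T m" if "m \<le> n" for m n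
  proof -
    have "T n = initial_words n (points (f (max (N n) (N m))))"
         "T m = initial_words m (points (f (max (N n) (N m))))"
      unfolding T_def by (rule N[symmetric], simp)+
    then show ?thesis using take_initial_words[OF that] by simp
  qed
  have len: "length w = n" if "w \<in> T n" for w n
    using that by (simp add: T_def initial_words_length)
  define Q where "Q = (\<Union>n. T n)"
  have Q: "w \<in> Q \<longleftrightarrow> w \<in> T (length w)" for w
    using len by (auto simp: Q_def)
  define S where "S = {\<xi>. \<forall>n. stake n (ray \<xi>) \<in> T n}"
  have W: "initial_words n S = T n" for n
  proof
    show "initial_words n S \<subseteq> T n" by (auto simp: initial_words_def S_def)
    show "T n \<subseteq> initial_words n S"
    proof
      fix w assume w: "w \<in> T n"
      obtain \<xi> where \<xi>: "\<And>k. stake k (ray \<xi>) \<in> Q" "stake (length w) (ray \<xi>) = w"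
      proof (rule ray_through_tree[of w Q])
        show "w \<in> Q" using w by (auto simp: Q_def)
        show "take k u \<in> Q" if "u \<in> Q" for u k
        proof (cases "k \<le> length u")
          case True
          then have "take k u \<in> T k" using T_take[of k "length u"] that unfolding Q by blast
          then show ?thesis by (auto simp: Q_def)
        qed (use that in simp)
        show "freely_reduced u" if "u \<in> Q" for u
          using that by (auto simp: Q_def T_def initial_words_reduced)
        show "\<exists>a. u @ [a] \<in> Q" if "u \<in> Q" for u
        proof -
          have "u \<in> take (length u) ` T (Suc (length u))"
            using T_take[of "length u" "Suc (length u)"] that by (simp add: Q)
          then obtain v where v: "v \<in> T (Suc (length u))" "u = take (length u) v" by blast
          have "v = u @ [v ! length u]"
            using v len[OF v(1)] by (metis lessI take_Suc_conv_app_nth take_all order_refl)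
          then have "u @ [v ! length u] \<in> T (Suc (length u))" using v(1) by simp
          then show ?thesis unfolding Q_def by blast
        qed
      qed blast
      then have "\<xi> \<in> S" by (auto simp: S_def Q)
      then show "w \<in> initial_words n S"
        using \<xi>(2) len[OF w] by (auto simp: initial_words_def)
    qed
  qed
  have "closed S" unfolding S_def by (rule closed_by_initial_words)
  moreover have two: "\<exists>u\<in>initial_words 1 S. \<exists>w\<in>initial_words 1 S. u \<noteq> w"
    using fb[rule_format, of "N 1"] by (simp add: W T_def branching_iff)
  moreover have "\<exists>x\<in>S. \<exists>y\<in>S. x \<noteq> y"
  proof -
    from two obtain u w where "u \<in> initial_words 1 S" "w \<in> initial_words 1 S" "u \<noteq> w" by blast
    then obtain x y where "x \<in> S" "y \<in> S" "u = stake 1 (ray x)" "w = stake 1 (ray y)"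
      unfolding initial_words_def by blast
    with \<open>u \<noteq> w\<close> show ?thesis by metis
  qed
  ultimately have pts: "points (Abs_cspace S) = S" by (simp add: Abs_cspace_inverse)
  show "\<exists>l\<in>branching. f \<longlonglongrightarrow> l"
  proof (rule bexI[of _ "Abs_cspace S"])
    show "Abs_cspace S \<in> branching" using two by (simp add: branching_iff pts)
    show "f \<longlonglongrightarrow> Abs_cspace S"
    proof (rule metric_LIMSEQ_I)
      fix e :: real assume "0 < e"
      then obtain n where n: "(1 / 2) ^ n < e" using eventually_close_pow by blast
      have "dist (f m) (Abs_cspace S) < e" if "m \<ge> N n" for m
      proof -
        have "dist (f m) (Abs_cspace S) \<le> (1 / 2) ^ n"
          using N[OF that] by (simp add: dist_cspace_le_iff pts W T_def)
        with n show ?thesis by simp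
      qed
      then show "\<exists>no. \<forall>m\<ge>no. dist (f m) (Abs_cspace S) < e" by blast
    qed
  qed
qed

text \<open>The tree is locally finite, so there are finitely many possibilities for the words of each
  length read along a closed set: this gives total boundedness.  Passing through the identity keeps
  a limit of such sets from degenerating to a single point.\<close>

lemma compact_branching: "compact (branching :: ('n :: finite) cspace set)"
  unfolding compact_eq_totally_bounded
proof (intro conjI allI impI complete_branching)
  fix e :: real assume "0 < e"
  then obtain n where n: "(1 / 2) ^ n < e" using eventually_close_pow by blast
  let ?W = "\<lambda>S :: 'n cspace. initial_words n (points S)"
  have "finite (?W ` branching)"
    by (rule finite_subset[OF _ finite_word_sets[of n]]) (use initial_words_in_finite in blast)
  then obtain B where B: "finite B" "B \<subseteq> branching" "?W ` branching = ?W ` B"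
    using finite_subset_image[of "?W ` branching" ?W branching] by blast
  have "branching \<subseteq> (\<Union>x\<in>B. ball x e)"
  proof
    fix S :: "'n cspace" assume "S \<in> branching"
    then obtain x where "x \<in> B" "?W S = ?W x" using B(3) by blast
    then have "dist x S \<le> (1 / 2) ^ n" by (simp add: dist_cspace_le_iff)
    then have "S \<in> ball x e" using n unfolding mem_ball by (rule order.strict_trans1)
    then show "S \<in> (\<Union>x\<in>B. ball x e)" using \<open>x \<in> B\<close> by blast
  qed
  then show "\<exists>k. finite k \<and> (branching :: 'n cspace set) \<subseteq> (\<Union>x\<in>k. ball x e)"
    using B(1) by blast
qed

subsection \<open>Translations\<close>

lemma points_translate: "points (translate g S) = boundary_act g ` points S"
  by (rule translate.rep_eq)

lemma translate_word_inverse [simp]: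
  "translate (word_inverse g) (translate g S) = S"
  "translate g (translate (word_inverse g) S) = S"
  by (simp_all add: points_translate flip: points_inject)

lemma translate_image_eq_vimage: "translate g ` A = translate (word_inverse g) -` A"
  by (auto simp: image_iff) (metis translate_word_inverse(2))

lemma initial_words_letter_act_cong:
  assumes "initial_words (Suc (Suc n)) S = initial_words (Suc (Suc n)) T"
  shows "initial_words n (letter_act a ` S) = initial_words n (letter_act a ` T)"
proof -
  have "initial_words n (letter_act a ` S) \<subseteq> initial_words n (letter_act a ` T)"
    if "initial_words (Suc (Suc n)) S = initial_words (Suc (Suc n)) T" for S T :: "'a boundary set"
  proof
    fix w assume "w \<in> initial_words n (letter_act a ` S)"
    then obtain \<xi> where \<xi>: "\<xi> \<in> S" "w = stake n (ray (letter_act a \<xi>))"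
      by (auto simp: initial_words_def)
    then have "stake (Suc (Suc n)) (ray \<xi>) \<in> initial_words (Suc (Suc n)) T"
      using that by (auto simp: initial_words_def simp del: stake.simps)
    then obtain \<zeta> where "\<zeta> \<in> T" "stake (Suc (Suc n)) (ray \<xi>) = stake (Suc (Suc n)) (ray \<zeta>)"
      by (auto simp: initial_words_def simp del: stake.simps)
    then show "w \<in> initial_words n (letter_act a ` T)"
      using stake_letter_act_cong[of n \<xi> \<zeta> a] \<xi>(2)
      by (auto simp: initial_words_def simp del: stake.simps)
  qed
  from this[OF assms] this[OF assms[symmetric]] show ?thesis by blast
qed

lemma initial_words_boundary_act_cong:
  "initial_words (n + 2 * length g) S = initial_words (n + 2 * length g) T \<Longrightarrow>
   initial_words n (boundary_act g ` S) = initial_words n (boundary_act g ` T)"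
proof (induction g arbitrary: n)
  case (Cons a g)
  have "initial_words (Suc (Suc n)) (boundary_act g ` S) = initial_words (Suc (Suc n)) (boundary_act g ` T)"
    using Cons.prems by (intro Cons.IH) simp
  from initial_words_letter_act_cong[OF this, of a] show ?case
    by (simp add: image_image boundary_act_Cons)
qed simp

lemma continuous_on_translate: "continuous_on S (translate g)"
proof (unfold continuous_on_iff, intro ballI allI impI)
  fix x and e :: real assume "0 < e"
  then obtain n where n: "(1 / 2) ^ n < e" using eventually_close_pow by blast
  have "dist (translate g y) (translate g x) < e" if "dist y x < (1 / 2) ^ (n + 2 * length g)" for y
  proof -
    have "dist (translate g y) (translate g x) \<le> (1 / 2) ^ n"
      using that unfolding dist_cspace_le_iff points_translate
      by (intro initial_words_boundary_act_cong) (simp flip: dist_cspace_le_iff)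
    with n show ?thesis by simp
  qed
  then show "\<exists>d>0. \<forall>y\<in>S. dist y x < d \<longrightarrow> dist (translate g y) (translate g x) < e"
    by (intro exI[of _ "(1 / 2) ^ (n + 2 * length g)"]) auto
qed

lemma measurable_translate [measurable]: "translate g \<in> borel_measurable borel"
  by (intro borel_measurable_continuous_onI continuous_on_translate)

lemma open_translate_image: "open A \<Longrightarrow> open (translate g ` A)"
  and closed_translate_image: "closed A \<Longrightarrow> closed (translate g ` A)"
  unfolding translate_image_eq_vimage
  by (auto intro: open_vimage closed_vimage continuous_on_translate)

lemma ray_boundary_act_inverse_prefix:
  "ray (boundary_act (word_inverse (stake n (ray \<xi>))) \<xi>) = sdrop n (ray \<xi>)"
proof (induction n arbitrary: \<xi>)
  case (Suc n)
  have "ray (letter_act (inv_letter (shd (ray \<xi>))) \<xi>) = stl (ray \<xi>)"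
    by (simp add: letter_act.rep_eq ray_cons_def)
  with Suc[of "letter_act (inv_letter (shd (ray \<xi>))) \<xi>"] show ?case
    by (simp add: boundary_act_append boundary_act_Cons)
qed simp

text \<open>Two points of \<open>S\<close> have a longest common prefix \<open>g\<close>, a vertex of the hull of \<open>S\<close>; hence
  \<open>g\<inverse>S\<close> passes through the identity.\<close>

lemma translate_branching_cover:
  obtains g where "freely_reduced g" "S \<in> translate g ` branching"
proof -
  obtain \<xi> \<zeta> where x: "\<xi> \<in> points S" "\<zeta> \<in> points S" "\<xi> \<noteq> \<zeta>"
    using points[of S] by blast
  then have ex: "\<exists>i. ray \<xi> !! i \<noteq> ray \<zeta> !! i"
    using boundary_eqI[of \<xi> \<zeta>] by (auto simp: stake_eq_iff)
  define n where "n = (LEAST i. ray \<xi> !! i \<noteq> ray \<zeta> !! i)"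
  have n: "ray \<xi> !! n \<noteq> ray \<zeta> !! n"
    unfolding n_def using ex by (rule LeastI_ex)
  have eq: "stake n (ray \<xi>) = stake n (ray \<zeta>)"
    unfolding stake_eq_iff using not_less_Least[of _ "\<lambda>i. ray \<xi> !! i \<noteq> ray \<zeta> !! i"] n_def by blast
  define g where "g = stake n (ray \<xi>)"
  have "shd (ray (boundary_act (word_inverse g) \<xi>)) = ray \<xi> !! n"
       "shd (ray (boundary_act (word_inverse g) \<zeta>)) = ray \<zeta> !! n"
    using ray_boundary_act_inverse_prefix[of n \<xi>] ray_boundary_act_inverse_prefix[of n \<zeta>]
    by (simp_all add: g_def eq)
  then have "translate (word_inverse g) S \<in> branching"
    unfolding branching_def mem_Collect_eq points_translate using x n
    by (intro rev_bexI[OF imageI[of \<xi>]] rev_bexI[OF imageI[of \<zeta>]]) simp_all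
  then have "S \<in> translate g ` branching"
    by (metis imageI translate_word_inverse(2))
  moreover have "freely_reduced g" by (simp add: g_def reduced_stake)
  ultimately show thesis using that by blast
qed

lemma compact_translate_branching_cover:
  assumes "compact K"
  obtains G where "finite G" "\<And>g. g \<in> G \<Longrightarrow> freely_reduced g" "K \<subseteq> (\<Union>g\<in>G. translate g ` branching)"
proof -
  have "K \<subseteq> (\<Union>g\<in>{g. freely_reduced g}. translate g ` branching)"
  proof
    fix S show "S \<in> (\<Union>g\<in>{g. freely_reduced g}. translate g ` branching)"
      by (rule translate_branching_cover[of S]) blast
  qed
  then obtain G where "G \<subseteq> {g. freely_reduced g}" "finite G" "K \<subseteq> (\<Union>g\<in>G. translate g ` branching)"
    by (rule compactE_image[OF assms, rotated]) (auto intro: open_translate_image open_branching)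
  then show thesis using that by blast
qed

section \<open>Folded graphs\<close>

text \<open>Letters are pairs, but are to be treated as atoms.\<close>

declare split_paired_Ex [simp del] split_paired_All [simp del]

text \<open>An edge \<open>(u, x, v)\<close> is traversed from \<open>u\<close> to \<open>v\<close> by reading the basis element \<open>x\<close> and from
  \<open>v\<close> to \<open>u\<close> by reading its inverse.\<close>

definition step :: "('v \<times> 'n \<times> 'v) set \<Rightarrow> 'v \<Rightarrow> 'n letter \<Rightarrow> 'v \<Rightarrow> bool" where
  "step E u a v \<longleftrightarrow> (if snd a then (u, fst a, v) \<in> E else (v, fst a, u) \<in> E)"

fun walk :: "('v \<times> 'n \<times> 'v) set \<Rightarrow> 'v \<Rightarrow> 'n letter list \<Rightarrow> 'v \<Rightarrow> bool" where
  "walk E u [] v \<longleftrightarrow> u = v"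
| "walk E u (a # w) v \<longleftrightarrow> (\<exists>u'. step E u a u' \<and> walk E u' w v)"

definition ray_set :: "('v \<times> 'n \<times> 'v) set \<Rightarrow> 'v \<Rightarrow> 'n boundary set" where
  "ray_set E v = {\<xi>. \<forall>n. \<exists>u. walk E v (stake n (ray \<xi>)) u}"

abbreviation ray_space :: "('v \<times> 'n \<times> 'v) set \<Rightarrow> 'v \<Rightarrow> 'n cspace" where
  "ray_space E v \<equiv> Abs_cspace (ray_set E v)"

lemma step_inv_letter: "step E u (inv_letter a) v \<longleftrightarrow> step E v a u"
  by (simp add: step_def inv_letter_def)

lemma walk_append: "walk E u (w @ w') v \<longleftrightarrow> (\<exists>z. walk E u w z \<and> walk E z w' v)"
  by (induction w arbitrary: u) auto

lemma walk_word_inverse: "walk E u w v \<Longrightarrow> walk E v (word_inverse w) u"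
  by (induction w arbitrary: u) (auto simp: walk_append step_inv_letter)

lemma walk_take: "walk E u w v \<Longrightarrow> \<exists>z. walk E u (take n w) z"
  by (metis append_take_drop_id walk_append)

text \<open>In a folded graph two edges with the same label and a common origin (or a common end) are
  equal, so that walks are determined by the words they spell.  Excluding leaves makes every
  reduced word that can be read the beginning of a ray.\<close>

locale folded_graph =
  fixes V :: "'v set" and E :: "('v \<times> 'n :: finite \<times> 'v) set"
  assumes finite_V: "finite V" and edges: "E \<subseteq> V \<times> UNIV \<times> V"
    and det: "(u, x, v) \<in> E \<Longrightarrow> (u, x, v') \<in> E \<Longrightarrow> v = v'"
    and codet: "(u, x, v) \<in> E \<Longrightarrow> (u', x, v) \<in> E \<Longrightarrow> u = u'"
    and no_leaf: "v \<in> V \<Longrightarrow> \<exists>a b u u'. a \<noteq> b \<and> step E v a u \<and> step E v b u'"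
begin

lemma step_det: "step E u a v \<Longrightarrow> step E u a v' \<Longrightarrow> v = v'"
  by (auto simp: step_def split: if_splits intro: det codet)

lemma step_codet: "step E u a v \<Longrightarrow> step E u' a v \<Longrightarrow> u = u'"
  by (metis step_inv_letter step_det)

lemma step_in_V: "step E u a v \<Longrightarrow> u \<in> V \<and> v \<in> V"
  using edges by (auto simp: step_def split: if_splits)

lemma walk_det: "walk E u w v \<Longrightarrow> walk E u w v' \<Longrightarrow> v = v'"
  by (induction w arbitrary: u) (auto dest: step_det)

lemma walk_in_V: "walk E u w v \<Longrightarrow> u \<in> V \<Longrightarrow> v \<in> V"
  by (induction w arbitrary: u) (auto dest: step_in_V)

lemma walk_word_cons: "step E u a z \<Longrightarrow> walk E z w v \<Longrightarrow> walk E u (word_cons a w) v"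
  by (cases w) (auto simp: word_cons_def step_inv_letter dest: step_codet)

lemma walk_mult: "walk E u w z \<Longrightarrow> walk E z w' v \<Longrightarrow> walk E u (foldr word_cons w w') v"
  by (induction w arbitrary: u) (auto intro: walk_word_cons)

lemma extend_walk:
  assumes "v \<in> V" "walk E v w u" "freely_reduced w"
  shows "\<exists>a u'. freely_reduced (w @ [a]) \<and> walk E v (w @ [a]) u'"
proof -
  obtain a b z z' where ab: "a \<noteq> b" "step E u a z" "step E u b z'"
    using no_leaf[OF walk_in_V[OF assms(2,1)]] by blast
  show ?thesis
  proof (cases "w \<noteq> [] \<and> a = inv_letter (last w)")
    case True
    then have "freely_reduced (w @ [b])" using ab assms by (simp add: reduced_append reduced_Cons)
    then show ?thesis using assms(2) ab by (auto simp: walk_append)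
  next
    case False
    then have "freely_reduced (w @ [a])" using ab assms by (auto simp: reduced_append reduced_Cons)
    then show ?thesis using assms(2) ab by (auto simp: walk_append)
  qed
qed

lemma ray_through_walk:
  assumes "v \<in> V" "walk E v w u" "freely_reduced w"
  obtains \<xi> where "\<xi> \<in> ray_set E v" "stake (length w) (ray \<xi>) = w"
proof -
  let ?Q = "{w. freely_reduced w \<and> (\<exists>u. walk E v w u)}"
  obtain \<xi> where "\<And>n. stake n (ray \<xi>) \<in> ?Q" "stake (length w) (ray \<xi>) = w"
  proof (rule ray_through_tree[of w ?Q])
    show "take n z \<in> ?Q" if "z \<in> ?Q" for n z
      using that walk_take[of E v z _ n] reduced_take[of z n] by auto
  qed (use assms extend_walk in auto)
  then show thesis using that[of \<xi>] by (simp add: ray_set_def)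
qed

lemma initial_words_ray_set:
  assumes "v \<in> V"
  shows "initial_words n (ray_set E v) = {w. length w = n \<and> freely_reduced w \<and> (\<exists>u. walk E v w u)}"
proof
  show "initial_words n (ray_set E v) \<subseteq> {w. length w = n \<and> freely_reduced w \<and> (\<exists>u. walk E v w u)}"
    by (auto simp: initial_words_def ray_set_def reduced_stake)
  show "{w. length w = n \<and> freely_reduced w \<and> (\<exists>u. walk E v w u)} \<subseteq> initial_words n (ray_set E v)"
  proof clarify
    fix w u assume w: "freely_reduced w" "walk E v w u" "n = length w"
    from ray_through_walk[OF assms w(2,1)] obtain \<xi> where
      "\<xi> \<in> ray_set E v" "stake (length w) (ray \<xi>) = w" by blast
    then show "w \<in> initial_words (length w) (ray_set E v)" unfolding initial_words_def by force
  qed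
qed

lemma closed_ray_set: "closed (ray_set E v)"
  using closed_by_initial_words[of "\<lambda>_. {w. \<exists>u. walk E v w u}"] by (simp add: ray_set_def)

lemma ray_set_branches:
  assumes "v \<in> V"
  shows "\<exists>\<xi>\<in>ray_set E v. \<exists>\<zeta>\<in>ray_set E v. shd (ray \<xi>) \<noteq> shd (ray \<zeta>)"
proof -
  obtain a b u u' where ab: "a \<noteq> b" "step E v a u" "step E v b u'" using no_leaf[OF assms] by blast
  obtain \<xi> where \<xi>: "\<xi> \<in> ray_set E v" "stake (length [a]) (ray \<xi>) = [a]"
    using ray_through_walk[OF assms, of "[a]" u] ab by (auto simp: reduced_Cons)
  obtain \<zeta> where \<zeta>: "\<zeta> \<in> ray_set E v" "stake (length [b]) (ray \<zeta>) = [b]"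
    using ray_through_walk[OF assms, of "[b]" u'] ab by (auto simp: reduced_Cons)
  show ?thesis using \<xi> \<zeta> ab(1) by (intro bexI[of _ \<xi>] bexI[of _ \<zeta>]) auto
qed

lemma points_ray_space: "v \<in> V \<Longrightarrow> points (ray_space E v) = ray_set E v"
proof (rule Abs_cspace_inverse, intro CollectI conjI closed_ray_set)
  assume "v \<in> V"
  from ray_set_branches[OF this] show "\<exists>x\<in>ray_set E v. \<exists>y\<in>ray_set E v. x \<noteq> y" by metis
qed

lemma ray_space_branching: "v \<in> V \<Longrightarrow> ray_space E v \<in> branching"
  by (simp add: branching_def points_ray_space ray_set_branches)

text \<open>A step of the graph translates the rays at its end onto the rays at its origin: either the
  letter is put in front of a ray, or it cancels the first letter, which undoes the step.\<close>

lemma letter_act_ray_set: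
  assumes "step E u a v"
  shows "letter_act a ` ray_set E v = ray_set E u"
proof -
  have *: "letter_act a \<xi> \<in> ray_set E u" if st: "step E u a v" and \<xi>: "\<xi> \<in> ray_set E v" for u a v \<xi>
  proof (cases "shd (ray \<xi>) = inv_letter a")
    case True
    then have r: "ray \<xi> = inv_letter a ## ray (letter_act a \<xi>)"
      by (metis letter_act.rep_eq ray_cons_def stream.collapse)
    have "\<exists>z. walk E u (stake n (ray (letter_act a \<xi>))) z" for n
    proof -
      obtain z where "walk E v (stake (Suc n) (ray \<xi>)) z" using \<xi> unfolding ray_set_def by blast
      then show ?thesis
        using st unfolding r by (auto simp: step_inv_letter dest: step_codet)
    qed
    then show ?thesis by (simp add: ray_set_def)
  next
    case False
    then have r: "ray (letter_act a \<xi>) = a ## ray \<xi>"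
      by (simp add: letter_act.rep_eq ray_cons_def)
    have "\<exists>z. walk E u (stake n (ray (letter_act a \<xi>))) z" for n
    proof (cases n)
      case (Suc m)
      obtain z where "walk E v (stake m (ray \<xi>)) z" using \<xi> unfolding ray_set_def by blast
      then show ?thesis using st unfolding r Suc by auto
    qed auto
    then show ?thesis by (simp add: ray_set_def)
  qed
  show ?thesis
  proof
    show "letter_act a ` ray_set E v \<subseteq> ray_set E u" using *[OF assms] by blast
    show "ray_set E u \<subseteq> letter_act a ` ray_set E v"
    proof
      fix \<xi> assume "\<xi> \<in> ray_set E u"
      then have "letter_act (inv_letter a) \<xi> \<in> ray_set E v"
        using *[of v "inv_letter a" u \<xi>] assms by (simp add: step_inv_letter)
      then show "\<xi> \<in> letter_act a ` ray_set E v"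
        by (metis imageI letter_act_inv_letter')
    qed
  qed
qed

lemma boundary_act_ray_set: "walk E u w v \<Longrightarrow> boundary_act w ` ray_set E v = ray_set E u"
proof (induction w arbitrary: u)
  case (Cons a w)
  then obtain z where "step E u a z" "walk E z w v" by auto
  then have "letter_act a ` boundary_act w ` ray_set E v = ray_set E u"
    using Cons.IH letter_act_ray_set by simp
  then show ?case by (simp add: image_image boundary_act_Cons)
qed simp

text \<open>The hull of \<open>ray_set E v\<close> has no other vertices than the words that can be read at \<open>v\<close>: a word that
  leaves the graph also leaves the hull, because its inverse moves all rays into one cylinder.\<close>

lemma readable_if_branching:
  assumes "v \<in> V" "freely_reduced g"
    and "boundary_act (word_inverse g) ` ray_set E v = points S" "S \<in> branching"
  obtains u where "walk E v g u"
proof (rule ccontr)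
  assume "\<not> thesis"
  then have no: "\<nexists>u. walk E v g u" using that by blast
  have "\<exists>p a q u. g = p @ a # q \<and> walk E v p u \<and> (\<nexists>z. step E u a z)"
    using no
  proof (induction g rule: rev_induct)
    case (snoc b g)
    show ?case
    proof (cases "\<exists>u. walk E v g u")
      case True
      then obtain u where "walk E v g u" by blast
      then show ?thesis using snoc.prems
        by (intro exI[of _ g] exI[of _ b] exI[of _ "[]"] exI[of _ u]) (auto simp: walk_append)
    next
      case False
      then obtain p a q u where "g = p @ a # q" "walk E v p u" "\<nexists>z. step E u a z"
        using snoc.IH by blast
      then show ?thesis by (intro exI[of _ p] exI[of _ a] exI[of _ "q @ [b]"]) auto
    qed
  qed simp
  then obtain p a q u where g: "g = p @ a # q" and p: "walk E v p u" and a: "\<nexists>z. step E u a z"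
    by blast
  have "boundary_act (word_inverse p) ` ray_set E v = ray_set E u"
    using boundary_act_ray_set[OF p] boundary_act_image_inverse(1) by metis
  then have S: "points S = boundary_act (word_inverse (a # q)) ` ray_set E u"
    unfolding assms(3)[symmetric] g
    by (simp add: boundary_act_append image_image boundary_act_Cons flip: \<open>_ = ray_set E u\<close>)
  have "shd (ray \<xi>) \<noteq> a" if "\<xi> \<in> ray_set E u" for \<xi>
  proof
    assume sh: "shd (ray \<xi>) = a"
    have "\<exists>z. walk E u (stake 1 (ray \<xi>)) z" using that unfolding ray_set_def by blast
    then show False using a sh by auto
  qed
  then have "shd (ray \<zeta>) = inv_letter (last (a # q))" if "\<zeta> \<in> points S" for \<zeta>
    using that shd_boundary_act_word_inverse[of "a # q"] assms(2) unfolding S g reduced_append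
    by (auto simp del: last.simps)
  then show False using assms(4) unfolding branching_def by auto
qed

end

subsection \<open>Returning to the start without backtracking\<close>

text \<open>A doubly stochastic matrix preserves the uniform distribution; no mass leaves an invariant set
  \<open>R\<close>, hence none can enter it.\<close>

lemma doubly_stochastic_closed:
  fixes p :: "'e \<Rightarrow> 'e \<Rightarrow> real"
  assumes D: "finite D" "R \<subseteq> D" and nonneg: "\<And>e f. 0 \<le> p e f"
    and out: "\<And>e. e \<in> D \<Longrightarrow> (\<Sum>f\<in>D. p e f) = 1" and into: "\<And>f. f \<in> D \<Longrightarrow> (\<Sum>e\<in>D. p e f) = 1"
    and closed: "\<And>e f. e \<in> R \<Longrightarrow> f \<in> D \<Longrightarrow> p e f \<noteq> 0 \<Longrightarrow> f \<in> R"
    and ef: "f \<in> R" "e \<in> D" "p e f \<noteq> 0"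
  shows "e \<in> R"
proof (rule ccontr)
  assume "e \<notin> R"
  have fin: "finite R" using D finite_subset by blast
  have "real (card R) = (\<Sum>e\<in>R. \<Sum>f\<in>D. p e f)" using D out by (simp add: subset_iff)
  also have "\<dots> = (\<Sum>e\<in>R. \<Sum>f\<in>R. p e f)"
    by (intro sum.cong refl sum.mono_neutral_right) (use D closed in auto)
  also have "\<dots> = (\<Sum>f\<in>R. \<Sum>e\<in>R. p e f)" by (rule sum.swap)
  finally have 1: "real (card R) = (\<Sum>f\<in>R. \<Sum>e\<in>R. p e f)" .
  have "real (card R) = (\<Sum>f\<in>R. \<Sum>e\<in>D. p e f)" using D into by (simp add: subset_iff)
  also have "\<dots> = (\<Sum>f\<in>R. \<Sum>e\<in>R. p e f) + (\<Sum>f\<in>R. \<Sum>e\<in>D - R. p e f)"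
    unfolding sum.distrib[symmetric]
    by (intro sum.cong refl) (use D sum.subset_diff[of R D] in \<open>simp add: add.commute\<close>)
  finally have "(\<Sum>f\<in>R. \<Sum>e\<in>D - R. p e f) = 0" using 1 by simp
  then have "(\<Sum>e\<in>D - R. p e f) = 0"
    using fin ef by (subst (asm) sum_nonneg_eq_0_iff) (auto intro: sum_nonneg nonneg)
  then have "p e f = 0"
    using D ef \<open>e \<notin> R\<close> by (subst (asm) sum_nonneg_eq_0_iff) (auto intro: nonneg)
  with ef show False by simp
qed

context folded_graph
begin

definition arcs :: "('v \<times> 'n letter \<times> 'v) set" where
  "arcs = {(u, a, v). step E u a v}"

definition labels_at :: "'v \<Rightarrow> 'n letter set" where
  "labels_at v = {a. \<exists>u. step E v a u}"

definition follows :: "'v \<times> 'n letter \<times> 'v \<Rightarrow> 'v \<times> 'n letter \<times> 'v \<Rightarrow> bool" where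
  "follows e f \<longleftrightarrow> snd (snd e) = fst f \<and> fst (snd f) \<noteq> inv_letter (fst (snd e))"

lemma finite_arcs: "finite arcs"
proof (rule finite_subset)
  show "arcs \<subseteq> V \<times> UNIV \<times> V" using step_in_V by (auto simp: arcs_def)
qed (use finite_V in auto)

lemma card_labels_at: "v \<in> V \<Longrightarrow> 2 \<le> card (labels_at v)"
proof -
  assume "v \<in> V"
  then obtain a b u u' where "a \<noteq> b" "step E v a u" "step E v b u'" using no_leaf by blast
  then have "card {a, b} = 2" "{a, b} \<subseteq> labels_at v" by (auto simp: labels_at_def)
  then show ?thesis by (metis card_mono finite)
qed

lemma card_following:
  assumes "(u, a, v) \<in> arcs"
  shows "card {f \<in> arcs. follows (u, a, v) f} = card (labels_at v) - 1"
proof -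
  define t where "t b = (THE z. step E v b z)" for b
  have t: "step E v b z \<longleftrightarrow> b \<in> labels_at v \<and> z = t b" for b z
  proof
    assume st: "step E v b z"
    then have "t b = z" unfolding t_def by (rule the_equality) (rule step_det[OF _ st])
    with st show "b \<in> labels_at v \<and> z = t b" by (auto simp: labels_at_def)
  next
    assume "b \<in> labels_at v \<and> z = t b"
    then obtain y where y: "step E v b y" "z = t b" by (auto simp: labels_at_def)
    moreover have "t b = y" unfolding t_def using y(1) by (rule the_equality) (rule step_det[OF _ y(1)])
    ultimately show "step E v b z" by simp
  qed
  have "{f \<in> arcs. follows (u, a, v) f} = (\<lambda>b. (v, b, t b)) ` (labels_at v - {inv_letter a})"
    by (auto simp: arcs_def follows_def t)
  moreover have "inj_on (\<lambda>b. (v, b, t b)) (labels_at v - {inv_letter a})" by (auto simp: inj_on_def)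
  moreover have "inv_letter a \<in> labels_at v"
    using assms step_inv_letter[of E v a u] by (auto simp: labels_at_def arcs_def)
  ultimately show ?thesis by (simp add: card_image)
qed

lemma card_followed:
  assumes "(v, b, z) \<in> arcs"
  shows "card {e \<in> arcs. follows e (v, b, z)} = card (labels_at v) - 1"
proof -
  define rv where "rv e = (snd (snd e), inv_letter (fst (snd e)), fst e)" for e :: "'v \<times> 'n letter \<times> 'v"
  have rv: "rv (rv e) = e" "rv e \<in> arcs \<longleftrightarrow> e \<in> arcs"
    "follows e (v, b, z) \<longleftrightarrow> follows (z, inv_letter b, v) (rv e)" for e
    by (cases e; auto simp: rv_def arcs_def step_inv_letter follows_def)+
  have "bij_betw rv {e \<in> arcs. follows e (v, b, z)} {f \<in> arcs. follows (z, inv_letter b, v) f}"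
    by (rule bij_betw_byWitness[of _ rv]) (auto simp: rv)
  from bij_betw_same_card[OF this] show ?thesis
    using card_following[of z "inv_letter b" v] assms by (simp add: arcs_def step_inv_letter)
qed

text \<open>Continue a walk at random, choosing with equal probability among the arcs that do not backtrack.
  An arc ending at \<open>v\<close> and an arc starting at \<open>v\<close> have equally many continuations, respectively
  predecessors, so the transition matrix is doubly stochastic.\<close>

lemma arc_set_closed_backwards:
  assumes R: "R \<subseteq> arcs" "\<And>e f. e \<in> R \<Longrightarrow> f \<in> arcs \<Longrightarrow> follows e f \<Longrightarrow> f \<in> R"
    and ef: "f \<in> R" "e \<in> arcs" "follows e f"
  shows "e \<in> R"
proof (rule doubly_stochastic_closed[OF finite_arcs R(1)])
  let ?p = "\<lambda>e f. if follows e f then 1 / real (card (labels_at (fst f)) - 1) else 0"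
  have ne: "real (card (labels_at v) - 1) \<noteq> 0" if "v \<in> V" for v
    using card_labels_at[OF that] by simp
  show "0 \<le> ?p e f" for e f by simp
  show "(\<Sum>f\<in>arcs. ?p e f) = 1" if e: "e \<in> arcs" for e
  proof -
    obtain u a v where [simp]: "e = (u, a, v)" by (cases e)
    have "(\<Sum>f\<in>arcs. ?p e f) = (\<Sum>f\<in>{f \<in> arcs. follows e f}. 1 / real (card (labels_at v) - 1))"
      using finite_arcs by (intro sum.mono_neutral_cong_right) (auto simp: follows_def)
    also have "\<dots> = 1"
      using e card_following[of u a v] ne[of v] step_in_V[of u a v] by (auto simp: arcs_def)
    finally show ?thesis .
  qed
  show "(\<Sum>e\<in>arcs. ?p e f) = 1" if f: "f \<in> arcs" for f
  proof -
    obtain v b z where [simp]: "f = (v, b, z)" by (cases f)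
    have "(\<Sum>e\<in>arcs. ?p e f) = (\<Sum>e\<in>{e \<in> arcs. follows e f}. 1 / real (card (labels_at v) - 1))"
      using finite_arcs by (intro sum.mono_neutral_cong_right) (auto simp: follows_def)
    also have "\<dots> = 1"
      using f card_followed[of v b z] ne[of v] step_in_V[of v b z] by (auto simp: arcs_def)
    finally show ?thesis .
  qed
  show "f \<in> R" if "e \<in> R" "f \<in> arcs" "?p e f \<noteq> 0" for e f
    using R(2)[OF that(1,2)] that(3) by (auto split: if_splits)
  have "fst f \<in> V" using ef R(1) step_in_V by (cases f) (auto simp: arcs_def)
  then show "?p e f \<noteq> 0" using ef ne by simp
qed (use ef in auto)

text \<open>The arcs reachable from the last arc of \<open>w\<close> in at least one step form a set closed under
  continuation, hence under predecessors; walking back along \<open>w\<close> it contains the first arc of \<open>w\<close>.\<close>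

lemma reduced_walk_extends_to_loop:
  assumes "freely_reduced w" "w \<noteq> []" "walk E v w u"
  obtains m where "freely_reduced (w @ m)" "walk E v (w @ m) v"
proof -
  obtain w0 b where w: "w = w0 @ [b]" using assms(2) by (metis rev_exhaust)
  obtain u' where u': "walk E v w0 u'" "step E u' b u" using assms(3) by (auto simp: w walk_append)
  define R where "R = {(x, a, y). step E x a y \<and>
      (\<exists>m. freely_reduced (b # m @ [a]) \<and> walk E u m x)}"
  have sub: "R \<subseteq> arcs" by (auto simp: R_def arcs_def)
  have closed: "f \<in> R" if ef: "e \<in> R" "f \<in> arcs" "follows e f" for e f
  proof -
    obtain x a y m where e: "e = (x, a, y)" "step E x a y" "freely_reduced (b # m @ [a])" "walk E u m x"
      using ef(1) unfolding R_def by blast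
    obtain c z where f: "f = (y, c, z)" "step E y c z" "c \<noteq> inv_letter a"
      using ef(2,3) e by (cases f) (simp add: arcs_def follows_def)
    have "freely_reduced ((b # m @ [a]) @ [c])"
      unfolding reduced_append[of "b # m @ [a]"] using e(3) f(3) by (simp add: reduced_Cons[of c])
    then have "freely_reduced (b # (m @ [a]) @ [c])" by simp
    moreover have "walk E u (m @ [a]) y" using e by (auto simp: walk_append)
    ultimately show ?thesis unfolding R_def using f by (simp, blast)
  qed
  have backward: "e \<in> R" if "f \<in> R" "e \<in> arcs" "follows e f" for e f
    by (rule arc_set_closed_backwards[OF sub _ that]) (rule closed)
  have in_arcs: "(u', b, u) \<in> arcs" using u' by (simp add: arcs_def)
  have "(u', b, u) \<in> R"
  proof -
    obtain a y where ay: "freely_reduced ([b] @ [a])" "walk E u' ([b] @ [a]) y"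
      using extend_walk[of u' "[b]" u] u' step_in_V by (auto simp: reduced_Cons)
    then obtain z where z: "step E u' b z" "step E z a y" by auto
    with u' step_det have "z = u" by blast
    then have "(u, a, y) \<in> R" using z ay by (auto simp: R_def intro!: exI[of _ "[]"])
    moreover have "follows (u', b, u) (u, a, y)" using ay by (simp add: follows_def reduced_Cons)
    ultimately show ?thesis using backward[OF _ in_arcs] by blast
  qed
  moreover have "\<exists>z. step E v (hd w) z \<and> (v, hd w, z) \<in> R"
    if "freely_reduced w" "w = w0 @ [b]" "walk E v w0 u'" for w w0 v
    using that
  proof (induction w0 arbitrary: w v)
    case Nil
    then show ?case using u' \<open>(u', b, u) \<in> R\<close> by auto
  next
    case (Cons a w0)
    then obtain v' where v': "step E v a v'" "walk E v' w0 u'" by auto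
    obtain z where z: "step E v' (hd (w0 @ [b])) z" "(v', hd (w0 @ [b]), z) \<in> R"
      using Cons.IH[of "w0 @ [b]" v'] Cons.prems v' by (auto simp: reduced_Cons)
    have "follows (v, a, v') (v', hd (w0 @ [b]), z)"
      using Cons.prems by (auto simp: follows_def reduced_Cons)
    then have "(v, a, v') \<in> R" using backward[OF z(2)] v' unfolding arcs_def by blast
    then show ?case using Cons.prems v' by auto
  qed
  from this[OF assms(1) w u'(1)] obtain z where z: "step E v (hd w) z" "(v, hd w, z) \<in> R" by blast
  then obtain m where m: "freely_reduced (b # m @ [hd w])" "walk E u m v" by (auto simp: R_def)
  have "freely_reduced (w @ m)"
    using m(1) assms(1) unfolding w by (auto simp: reduced_append reduced_Cons)
  then show thesis using that[of m] m(2) assms(3) by (auto simp: walk_append)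
qed

end

section \<open>Limit sets, cosets and commensurators\<close>

lemma limit_set_iff: "\<xi> \<in> limit_set H \<longleftrightarrow> (\<forall>n. \<exists>h\<in>H. take n h = stake n (ray \<xi>))"
proof
  assume "\<xi> \<in> limit_set H"
  then obtain h where h: "\<And>k. h k \<in> H"
    "\<And>n. \<forall>\<^sub>F k in sequentially. take n (h k) = stake n (ray \<xi>)"
    by (auto simp: limit_set_def)
  show "\<forall>n. \<exists>h\<in>H. take n h = stake n (ray \<xi>)"
  proof
    fix n obtain k where "take n (h k) = stake n (ray \<xi>)"
      using eventually_happens[OF h(2)[of n]] by auto
    with h(1) show "\<exists>h\<in>H. take n h = stake n (ray \<xi>)" by blast
  qed
next
  assume "\<forall>n. \<exists>h\<in>H. take n h = stake n (ray \<xi>)"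
  then obtain h where h: "\<And>n. h n \<in> H" "\<And>n. take n (h n) = stake n (ray \<xi>)" by metis
  have *: "take n (h k) = stake n (ray \<xi>)" if "n \<le> k" for n k
    using arg_cong[OF h(2)[of k], of "take n"] that by (simp add: take_stake min_absorb1)
  have "\<forall>\<^sub>F k in sequentially. take n (h k) = stake n (ray \<xi>)" for n
    by (rule eventually_sequentiallyI[of n], rule *)
  with h(1) show "\<xi> \<in> limit_set H" by (auto simp: limit_set_def)
qed

lemma limit_set_mono: "H \<subseteq> K \<Longrightarrow> limit_set H \<subseteq> limit_set K"
  by (auto simp: limit_set_iff) blast

lemma take_stake_mono: "take n w = stake n s \<Longrightarrow> m \<le> n \<Longrightarrow> take m w = stake m s"
  by (metis min_absorb1 take_stake take_take)

lemma length_if_take_stake: "take n w = stake n s \<Longrightarrow> n \<le> length w"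
  by (metis length_stake length_take min.cobounded1)

lemma take_word_cons_letter_act:
  assumes "take (Suc (Suc n)) w = stake (Suc (Suc n)) (ray \<xi>)"
  shows "take n (word_cons a w) = stake n (ray (letter_act a \<xi>))"
proof -
  obtain b v where w: "w = b # v" using assms by (cases w) auto
  then have b: "shd (ray \<xi>) = b" and v: "take (Suc n) v = stake (Suc n) (stl (ray \<xi>))"
    using assms by auto
  show ?thesis
  proof (cases "b = inv_letter a")
    case True
    then show ?thesis using take_stake_mono[OF v, of n]
      by (simp add: w word_cons_def letter_act.rep_eq ray_cons_def b)
  next
    case False
    have "take n (a # w) = stake n (a ## ray \<xi>)"
      using take_stake_mono[OF assms, of "n - 1"] by (cases n) auto
    then show ?thesis using False by (simp add: w word_cons_def letter_act.rep_eq ray_cons_def b)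
  qed
qed

lemma take_mult_left:
  "take (n + 2 * length g) w = stake (n + 2 * length g) (ray \<xi>) \<Longrightarrow>
    take n (foldr word_cons g w) = stake n (ray (boundary_act g \<xi>))"
proof (induction g arbitrary: n)
  case (Cons a g)
  have "take (Suc (Suc n)) (foldr word_cons g w) = stake (Suc (Suc n)) (ray (boundary_act g \<xi>))"
    using Cons.prems by (intro Cons.IH) (simp add: algebra_simps)
  from take_word_cons_letter_act[OF this, of a] show ?case by (simp add: boundary_act_Cons)
qed simp

lemma foldr_word_cons_letter:
  "freely_reduced w \<Longrightarrow>
    foldr word_cons w [b] = (if w \<noteq> [] \<and> last w = inv_letter b then butlast w else w @ [b])"
proof (induction w)
  case (Cons a w)
  show ?case
  proof (cases "w = []")
    case True
    then show ?thesis by (auto simp: word_cons_def)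
  next
    case False
    show ?thesis
    proof (cases "last w = inv_letter b")
      case True
      have "freely_reduced (a # butlast w)"
        using reduced_take[OF Cons.prems, of "length w"] False
        by (cases "length w") (simp_all add: butlast_conv_take)
      then show ?thesis using Cons False True by (simp add: reduced_Cons word_cons_reduced)
    next
      case l: False
      have "b \<noteq> inv_letter (last w)" using l by auto
      then have "freely_reduced ((a # w) @ [b])"
        unfolding reduced_append using Cons.prems False by (simp add: reduced_Cons[of b])
      then show ?thesis using Cons False l by (simp add: reduced_Cons[of a w] word_cons_reduced)
    qed
  qed
qed simp

text \<open>Multiplication on the right by \<open>u\<close> cancels or appends at most \<open>length u\<close> letters at the end,
  so it does not move limit points.\<close>

lemma take_mult_right:
  "freely_reduced w \<Longrightarrow> freely_reduced u \<Longrightarrow> n + length u \<le> length w \<Longrightarrow>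
    take n (foldr word_cons w u) = take n w"
proof (induction u arbitrary: w)
  case Nil
  then show ?case by (simp add: foldr_word_cons_Nil)
next
  case (Cons b u)
  let ?w = "foldr word_cons w [b]"
  have "foldr word_cons w (b # u) = foldr word_cons w (foldr word_cons [b] u)"
    using Cons.prems by (simp add: word_cons_reduced)
  also have "\<dots> = foldr word_cons ?w u"
    using Cons.prems by (subst foldr_word_cons_assoc) (auto simp: reduced_Cons)
  finally have "take n (foldr word_cons w (b # u)) = take n (foldr word_cons ?w u)" by simp
  also have "\<dots> = take n ?w"
    using Cons.prems
    by (intro Cons.IH reduced_foldr) (auto simp: foldr_word_cons_letter reduced_Cons)
  also have "\<dots> = take n w"
    using Cons.prems by (auto simp: foldr_word_cons_letter take_butlast)
  finally show ?case .
qed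

lemma conj_subgroup_free_group:
  "freely_reduced g \<Longrightarrow> conj_subgroup free_group g H =
    (\<lambda>h. foldr word_cons (foldr word_cons g h) (word_inverse g)) ` H"
  by (auto simp: conj_subgroup_def l_coset_def r_coset_def inv_free_group)

lemma limit_set_conj_subset:
  assumes "freely_reduced g" "H \<subseteq> {w. freely_reduced w}"
  shows "boundary_act g ` limit_set H \<subseteq> limit_set (conj_subgroup free_group g H)"
proof clarify
  fix \<xi> assume \<xi>: "\<xi> \<in> limit_set H"
  show "boundary_act g \<xi> \<in> limit_set (conj_subgroup free_group g H)"
    unfolding limit_set_iff
  proof
    fix n
    obtain h where h: "h \<in> H" "take (n + length g + 2 * length g) h = stake (n + length g + 2 * length g) (ray \<xi>)"
      using \<xi> unfolding limit_set_iff by blast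
    let ?w = "foldr word_cons g h"
    have w: "take (n + length g) ?w = stake (n + length g) (ray (boundary_act g \<xi>))"
      using h(2) by (rule take_mult_left)
    then have "n + length g \<le> length ?w"
      by (rule length_if_take_stake)
    moreover have "freely_reduced ?w" using h(1) assms by (auto intro: reduced_foldr)
    ultimately have "take n (foldr word_cons ?w (word_inverse g)) = take n ?w"
      using assms by (intro take_mult_right) (auto simp: reduced_word_inverse)
    also have "\<dots> = stake n (ray (boundary_act g \<xi>))"
      using take_stake_mono[OF w, of n] by simp
    finally show "\<exists>h\<in>conj_subgroup free_group g H. take n h = stake n (ray (boundary_act g \<xi>))"
      using h(1) assms(1) by (auto simp: conj_subgroup_free_group)
  qed
qed

lemma cosets_in_eq: "cosets_in G K H = (\<lambda>a. H #>\<^bsub>G\<^esub> a) ` K"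
  by (auto simp: cosets_in_def RCOSETS_def r_coset_def)

lemma mem_r_coset_free_group: "x \<in> H #>\<^bsub>free_group\<^esub> a \<longleftrightarrow> (\<exists>h\<in>H. x = foldr word_cons h a)"
  by (auto simp: r_coset_def)

text \<open>All elements of \<open>H\<close> are within bounded distance of \<open>K\<close> if \<open>K\<close> has finite index.\<close>

lemma limit_set_finite_index:
  assumes H: "H \<subseteq> {w. freely_reduced w}" and K: "subgroup K free_group"
    and fin: "finite (cosets_in free_group H K)"
  shows "limit_set H \<subseteq> limit_set K"
proof
  fix \<xi> assume \<xi>: "\<xi> \<in> limit_set H"
  have Kc: "K \<subseteq> {w. freely_reduced w}" using subgroup.subset[OF K] by simp
  obtain C where C: "finite C" "C \<subseteq> H" "cosets_in free_group H K = (\<lambda>a. K #>\<^bsub>free_group\<^esub> a) ` C"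
    using finite_subset_image[OF fin, of "\<lambda>a. K #>\<^bsub>free_group\<^esub> a" H] unfolding cosets_in_eq by blast
  define L where "L = Max (insert 0 (length ` C))"
  have L: "length c \<le> L" if "c \<in> C" for c
    unfolding L_def using that C(1) by (intro Max_ge) auto
  show "\<xi> \<in> limit_set K"
    unfolding limit_set_iff
  proof
    fix n
    obtain h where h: "h \<in> H" "take (n + L) h = stake (n + L) (ray \<xi>)"
      using \<xi> unfolding limit_set_iff by blast
    obtain c where c: "c \<in> C" "K #>\<^bsub>free_group\<^esub> h = K #>\<^bsub>free_group\<^esub> c"
      using C(3) h(1) unfolding cosets_in_eq by blast
    have red: "freely_reduced h" "freely_reduced c" using h c C H by auto
    have "h \<in> K #>\<^bsub>free_group\<^esub> h"
      using subgroup.one_closed[OF K] by (auto simp: mem_r_coset_free_group intro!: bexI[of _ "[]"])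
    then obtain k where k: "k \<in> K" "h = foldr word_cons k c"
      unfolding c(2) mem_r_coset_free_group by blast
    have "foldr word_cons h (word_inverse c) = foldr word_cons k (foldr word_cons c (word_inverse c))"
      unfolding k(2) using red k Kc by (intro foldr_word_cons_assoc) (auto simp: reduced_word_inverse)
    also have "foldr word_cons c (word_inverse c) = []"
      using free.r_inv[of c] red by (simp add: inv_free_group)
    finally have k_eq: "foldr word_cons h (word_inverse c) = k"
      using k Kc by (auto simp: foldr_word_cons_Nil)
    have "n + L \<le> length h" using h(2) by (rule length_if_take_stake)
    then have "take n k = take n h"
      unfolding k_eq[symmetric] using red L[OF c(1)]
      by (intro take_mult_right) (auto simp: reduced_word_inverse)
    also have "\<dots> = stake n (ray \<xi>)" using take_stake_mono[OF h(2), of n] by simp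
    finally show "\<exists>h\<in>K. take n h = stake n (ray \<xi>)" using k(1) by blast
  qed
qed

lemma finite_image_factor:
  assumes "finite (g ` A)" "\<And>x y. x \<in> A \<Longrightarrow> y \<in> A \<Longrightarrow> g x = g y \<Longrightarrow> f x = f y"
  shows "finite (f ` A)"
proof (rule finite_surj[OF assms(1)])
  show "f ` A \<subseteq> (\<lambda>z. f (SOME x. x \<in> A \<and> g x = z)) ` g ` A"
  proof clarify
    fix x assume x: "x \<in> A"
    have s: "(SOME y. y \<in> A \<and> g y = g x) \<in> A \<and> g (SOME y. y \<in> A \<and> g y = g x) = g x"
      by (rule someI[of _ x]) (use x in simp)
    then have "f x = f (SOME y. y \<in> A \<and> g y = g x)"
      using assms(2)[OF x, of "SOME y. y \<in> A \<and> g y = g x"] by metis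
    with x show "f x \<in> (\<lambda>z. f (SOME x. x \<in> A \<and> g x = z)) ` g ` A" by blast
  qed
qed

lemma (in group) r_coset_eq_iff:
  assumes "subgroup H G" "a \<in> carrier G" "b \<in> carrier G"
  shows "H #> a = H #> b \<longleftrightarrow> a \<otimes> inv b \<in> H"
proof
  note sub = subgroup.subset[OF assms(1)]
  have car: "a \<otimes> inv b \<in> carrier G" using assms(2,3) by simp
  show "a \<otimes> inv b \<in> H" if "H #> a = H #> b"
    using coset_mult_inv2[OF that assms(2,3) sub] by (rule coset_join1[OF _ car assms(1)])
  show "H #> a = H #> b" if "a \<otimes> inv b \<in> H"
    by (rule coset_mult_inv1[OF coset_join2[OF car assms(1) that] assms(2,3) sub])
qed

lemma (in group) finite_index_inter:
  assumes "subgroup A G" "subgroup B G" "A \<subseteq> K" "K \<subseteq> carrier G" "finite (cosets_in G K B)"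
  shows "finite (cosets_in G A (A \<inter> B))"
  unfolding cosets_in_eq
proof (rule finite_image_factor)
  show "finite ((\<lambda>a. B #> a) ` A)"
    using assms(5) unfolding cosets_in_eq by (rule rev_finite_subset) (use assms(3) in blast)
  fix x y assume xy: "x \<in> A" "y \<in> A" "B #> x = B #> y"
  then have "x \<otimes> inv y \<in> A \<inter> B"
    using r_coset_eq_iff[OF assms(2)] assms(1) subgroup.mem_carrier[OF assms(1)]
    by (auto intro: subgroup.m_closed subgroup.m_inv_closed)
  then show "(A \<inter> B) #> x = (A \<inter> B) #> y"
    using r_coset_eq_iff[OF subgroups_Inter_pair[OF assms(1,2)]] xy subgroup.mem_carrier[OF assms(1)] by simp
qed

lemma (in group) finite_index_conj:
  assumes H: "subgroup H G" and K: "subgroup K G" "g \<in> K" and conj: "subgroup (conj_subgroup G g H) G"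
    and fin: "finite (cosets_in G K H)"
  shows "finite (cosets_in G K (conj_subgroup G g H))"
  unfolding cosets_in_eq
proof (rule finite_image_factor)
  have car: "x \<in> carrier G" if "x \<in> K" for x by (rule subgroup.mem_carrier[OF K(1) that])
  show "finite ((\<lambda>c. H #> (inv g \<otimes> c)) ` K)"
    using fin unfolding cosets_in_eq
  proof (rule rev_finite_subset)
    have "inv g \<otimes> c \<in> K" if "c \<in> K" for c
      by (rule subgroup.m_closed[OF K(1) subgroup.m_inv_closed[OF K] that])
    then show "(\<lambda>c. H #> (inv g \<otimes> c)) ` K \<subseteq> (\<lambda>a. H #> a) ` K" by blast
  qed
  fix x y assume xy: "x \<in> K" "y \<in> K" "H #> (inv g \<otimes> x) = H #> (inv g \<otimes> y)"
  then have "(inv g \<otimes> x) \<otimes> inv (inv g \<otimes> y) \<in> H"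
    using r_coset_eq_iff[OF H] K car by simp
  then have h: "inv g \<otimes> x \<otimes> (inv y \<otimes> g) \<in> H"
    using xy K car by (simp add: inv_mult_group)
  have "g \<otimes> (inv g \<otimes> z) = z" if "z \<in> carrier G" for z
    using that K car by (simp flip: m_assoc)
  then have "x \<otimes> inv y = g \<otimes> (inv g \<otimes> x \<otimes> (inv y \<otimes> g)) \<otimes> inv g"
    using xy K car by (simp add: m_assoc)
  then have "x \<otimes> inv y \<in> conj_subgroup G g H"
    using h unfolding conj_subgroup_def l_coset_def r_coset_def by auto
  then show "conj_subgroup G g H #> x = conj_subgroup G g H #> y"
    using r_coset_eq_iff[OF conj] xy car by simp
qed

section \<open>The counting current of a finite folded graph\<close>

lemma foldr_word_cons_reduce:
  "freely_reduced w \<Longrightarrow> foldr word_cons (foldr word_cons u []) w = foldr word_cons u w"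
  by (simp add: foldr_word_cons_assoc)

lemma word_inverse_twice: "word_inverse (word_inverse w) = w"
  by (simp add: rev_map comp_def)

lemma foldr_word_cons_right_inverse:
  "freely_reduced w \<Longrightarrow> foldr word_cons w (word_inverse w) = []"
  using free.r_inv[of w] by (simp add: inv_free_group)

lemma (in group) subgroup_conj_subgroup:
  assumes H: "subgroup H G" and g: "g \<in> carrier G"
  shows "subgroup (conj_subgroup G g H) G"
proof -
  let ?c = "\<lambda>h. g \<otimes> h \<otimes> inv g"
  have cancel: "inv g \<otimes> (g \<otimes> z) = z" if "z \<in> carrier G" for z
    using that g by (simp flip: m_assoc)
  have "?c \<in> hom G G"
    using g by (auto simp: hom_def m_assoc cancel)
  then have "group_hom G G ?c" by unfold_locales
  then have "subgroup (?c ` H) G" using H by (rule group_hom.subgroup_img_is_subgroup)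
  also have "?c ` H = conj_subgroup G g H"
    by (auto simp: conj_subgroup_def l_coset_def r_coset_def)
  finally show ?thesis .
qed

lemma subgroup_conj_free_group:
  "subgroup H free_group \<Longrightarrow> freely_reduced g \<Longrightarrow> subgroup (conj_subgroup free_group g H) free_group"
  by (rule free.subgroup_conj_subgroup) simp_all

lemma limit_set_conj:
  assumes "subgroup H free_group" "freely_reduced g"
  shows "limit_set (conj_subgroup free_group g H) = boundary_act g ` limit_set H"
proof
  note sub = subgroup.subset[OF assms(1)]
  show "boundary_act g ` limit_set H \<subseteq> limit_set (conj_subgroup free_group g H)"
    using limit_set_conj_subset[OF assms(2)] sub by simp
  have "word_inverse g \<in> carrier free_group" using assms(2) by (simp add: reduced_word_inverse)
  have conj_back: "conj_subgroup free_group (word_inverse g) (conj_subgroup free_group g H) \<subseteq> H"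
  proof
    fix x assume "x \<in> conj_subgroup free_group (word_inverse g) (conj_subgroup free_group g H)"
    then obtain h where h: "h \<in> H"
      "x = foldr word_cons (foldr word_cons (word_inverse g)
        (foldr word_cons (foldr word_cons g h) (word_inverse g))) g"
      unfolding conj_subgroup_free_group[OF reduced_word_inverse[OF assms(2)]]
        conj_subgroup_free_group[OF assms(2)] word_inverse_twice by blast
    have red: "freely_reduced h" using h(1) sub by auto
    have gg: "foldr word_cons (word_inverse g) g = []"
      using free.l_inv[of g] assms(2) by (simp add: inv_free_group)
    have "x = foldr word_cons (word_inverse g) (foldr word_cons g (foldr word_cons h (foldr word_cons (word_inverse g) g)))"
      unfolding h(2) using red assms(2)
      by (simp add: foldr_word_cons_assoc reduced_foldr reduced_word_inverse)
    also have "\<dots> = h" using red by (simp add: gg foldr_word_cons_Nil foldr_word_cons_inverse)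
    finally show "x \<in> H" using h(1) by simp
  qed
  have "boundary_act (word_inverse g) ` limit_set (conj_subgroup free_group g H)
      \<subseteq> limit_set (conj_subgroup free_group (word_inverse g) (conj_subgroup free_group g H))"
    using subgroup.subset[OF subgroup_conj_free_group[OF assms]] assms(2)
    by (intro limit_set_conj_subset) (auto simp: reduced_word_inverse)
  also have "\<dots> \<subseteq> limit_set H" by (rule limit_set_mono[OF conj_back])
  finally have "boundary_act g ` boundary_act (word_inverse g) ` limit_set (conj_subgroup free_group g H)
      \<subseteq> boundary_act g ` limit_set H" by (rule image_mono)
  then show "limit_set (conj_subgroup free_group g H) \<subseteq> boundary_act g ` limit_set H" by simp
qed

locale connected_folded_graph = folded_graph V E
  for V :: "'v set" and E :: "('v \<times> 'n :: finite \<times> 'v) set" +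
  fixes v0 :: 'v
  assumes v0: "v0 \<in> V" and connected: "v \<in> V \<Longrightarrow> \<exists>w. walk E v0 w v"
begin

definition loops :: "'n letter list set" where
  "loops = {w. freely_reduced w \<and> walk E v0 w v0}"

text \<open>The path to the base point is empty, so that a loop does not change when it is framed by paths
  to its ends.\<close>

definition path_to :: "'v \<Rightarrow> 'n letter list" where
  "path_to v = (if v = v0 then [] else SOME w. freely_reduced w \<and> walk E v0 w v)"

lemma path_to:
  assumes "v \<in> V"
  shows "freely_reduced (path_to v)" "walk E v0 (path_to v) v"
proof -
  obtain w where "walk E v0 w v" using connected[OF assms] by blast
  then have "freely_reduced (foldr word_cons w []) \<and> walk E v0 (foldr word_cons w []) v"
    using walk_mult[of v0 w v "[]" v] by (simp add: reduced_foldr)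
  from someI[of "\<lambda>w. freely_reduced w \<and> walk E v0 w v", OF this]
  show "freely_reduced (path_to v)" "walk E v0 (path_to v) v" by (auto simp: path_to_def)
qed

lemma subgroup_loops: "subgroup loops free_group"
proof (rule free.subgroupI)
  show "loops \<noteq> {}" by (auto simp: loops_def intro!: exI[of _ "[]"])
  show "inv\<^bsub>free_group\<^esub> a \<in> loops" if "a \<in> loops" for a
    using that walk_word_inverse by (auto simp: loops_def inv_free_group reduced_word_inverse)
  show "a \<otimes>\<^bsub>free_group\<^esub> b \<in> loops" if "a \<in> loops" "b \<in> loops" for a b
    using that walk_mult by (auto simp: loops_def reduced_foldr)
qed (auto simp: loops_def)

definition loop_through :: "'v \<times> 'n letter \<times> 'v \<Rightarrow> 'n letter list" where
  "loop_through = (\<lambda>(u, a, v). foldr word_cons (path_to u @ [a] @ word_inverse (path_to v)) [])"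

text \<open>Going back to the base point after every letter of a loop writes it as a product of the
  loops that pass through a single arc.\<close>

lemma walk_in_generate:
  assumes "walk E u w v" "u \<in> V"
  shows "foldr word_cons (path_to u @ w @ word_inverse (path_to v)) []
    \<in> generate free_group (loop_through ` arcs)"
  using assms
proof (induction w arbitrary: u)
  case Nil
  have "foldr word_cons (path_to v @ word_inverse (path_to v)) [] = []"
    using foldr_word_cons_inverse[of "[]" "word_inverse (path_to v)"]
    by (simp add: rev_map comp_def)
  then show ?case using Nil generate.one[of free_group] by simp
next
  case (Cons a w)
  then obtain z where z: "step E u a z" "walk E z w v" by auto
  then have zV: "z \<in> V" using step_in_V by blast
  let ?x = "loop_through (u, a, z)"
  let ?y = "foldr word_cons (path_to z @ w @ word_inverse (path_to v)) []"
  have "?x \<in> generate free_group (loop_through ` arcs)"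
    using z(1) by (intro generate.incl imageI) (simp add: arcs_def)
  moreover have "?y \<in> generate free_group (loop_through ` arcs)"
    using Cons.IH[OF z(2) zV] .
  ultimately have "?x \<otimes>\<^bsub>free_group\<^esub> ?y \<in> generate free_group (loop_through ` arcs)"
    by (rule generate.eng)
  moreover have "?x \<otimes>\<^bsub>free_group\<^esub> ?y = foldr word_cons (path_to u @ (a # w) @ word_inverse (path_to v)) []"
    unfolding loop_through_def mult_free_group prod.case
    by (subst foldr_word_cons_reduce) (auto simp: reduced_foldr foldr_word_cons_inverse)
  ultimately show ?case by simp
qed

lemma loops_eq_generate: "loops = generate free_group (loop_through ` arcs)"
proof
  show "loops \<subseteq> generate free_group (loop_through ` arcs)"
  proof
    fix w assume "w \<in> loops"
    then have "freely_reduced w" "walk E v0 w v0" by (auto simp: loops_def)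
    then show "w \<in> generate free_group (loop_through ` arcs)"
      using walk_in_generate[of v0 w v0] v0 by (simp add: path_to_def foldr_word_cons_Nil)
  qed
  have "loop_through ` arcs \<subseteq> loops"
  proof clarify
    fix u a v assume "(u, a, v) \<in> arcs"
    then have st: "step E u a v" by (simp add: arcs_def)
    then have "walk E v0 (path_to u @ [a] @ word_inverse (path_to v)) v0"
      using path_to[of u] path_to[of v] step_in_V[OF st] walk_word_inverse[of E v0 "path_to v" v]
      by (auto simp: walk_append)
    from walk_mult[OF this, of "[]" v0] have "walk E v0 (loop_through (u, a, v)) v0"
      by (simp add: loop_through_def)
    moreover have "freely_reduced (loop_through (u, a, v))"
      unfolding loop_through_def prod.case by (rule reduced_foldr) simp
    ultimately show "loop_through (u, a, v) \<in> loops" by (simp add: loops_def)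
  qed
  then show "generate free_group (loop_through ` arcs) \<subseteq> loops"
    by (rule free.generate_subgroup_incl[OF _ subgroup_loops])
qed

lemma finitely_generated_loops: "finitely_generated_subgroup free_group loops"
  unfolding finitely_generated_subgroup_def
proof (intro conjI exI[of _ "loop_through ` arcs"] subgroup_loops)
  show "loop_through ` arcs \<subseteq> carrier free_group"
    by (auto simp: loop_through_def reduced_foldr simp del: foldr_append)
qed (use finite_arcs loops_eq_generate in auto)

lemma limit_set_subset_ray_set:
  assumes "\<And>h. h \<in> H \<Longrightarrow> \<exists>u. walk E v0 h u"
  shows "limit_set H \<subseteq> ray_set E v0"
proof
  fix \<xi> assume \<xi>: "\<xi> \<in> limit_set H"
  have "\<exists>u. walk E v0 (stake n (ray \<xi>)) u" for n
  proof -
    obtain h where "h \<in> H" "take n h = stake n (ray \<xi>)" using \<xi> unfolding limit_set_iff by blast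
    then show ?thesis using assms walk_take[of E v0 h _ n] by metis
  qed
  then show "\<xi> \<in> ray_set E v0" by (simp add: ray_set_def)
qed

text \<open>Every reduced word that can be read at the base point is the beginning of a reduced loop.\<close>

lemma limit_set_loops: "limit_set loops = ray_set E v0"
proof
  show "limit_set loops \<subseteq> ray_set E v0"
    by (rule limit_set_subset_ray_set) (auto simp: loops_def)
  show "ray_set E v0 \<subseteq> limit_set loops"
  proof
    fix \<xi> assume \<xi>: "\<xi> \<in> ray_set E v0"
    show "\<xi> \<in> limit_set loops"
      unfolding limit_set_iff
    proof
      fix n
      show "\<exists>h\<in>loops. take n h = stake n (ray \<xi>)"
      proof (cases n)
        case 0
        then show ?thesis using subgroup.one_closed[OF subgroup_loops] by auto
      next
        case (Suc k)
        obtain u where u: "walk E v0 (stake n (ray \<xi>)) u" using \<xi> unfolding ray_set_def by blast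
        obtain m where "freely_reduced (stake n (ray \<xi>) @ m)" "walk E v0 (stake n (ray \<xi>) @ m) v0"
          using reduced_walk_extends_to_loop[OF reduced_stake _ u] Suc by auto
        then show ?thesis by (intro bexI[of _ "stake n (ray \<xi>) @ m"]) (auto simp: loops_def)
      qed
    qed
  qed
qed

lemma loops_nontrivial: "loops \<noteq> {[]}"
proof
  assume triv: "loops = {[]}"
  obtain \<xi> where "\<xi> \<in> limit_set loops"
    unfolding limit_set_loops using ray_set_branches[OF v0] by blast
  then have "\<exists>h\<in>loops. take 1 h = stake 1 (ray \<xi>)" unfolding limit_set_iff ..
  then show False by (simp add: triv)
qed

definition hull_stabilizer :: "'n letter list set" where
  "hull_stabilizer = {g. freely_reduced g \<and> boundary_act g ` ray_set E v0 = ray_set E v0}"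

lemma subgroup_hull_stabilizer: "subgroup hull_stabilizer free_group"
proof (rule free.subgroupI)
  show "hull_stabilizer \<noteq> {}"
    by (auto simp: hull_stabilizer_def intro!: exI[of _ "[]"])
  show "inv\<^bsub>free_group\<^esub> a \<in> hull_stabilizer" if "a \<in> hull_stabilizer" for a
  proof -
    have a: "freely_reduced a" "boundary_act a ` ray_set E v0 = ray_set E v0"
      using that by (simp_all add: hull_stabilizer_def)
    then have "boundary_act (word_inverse a) ` ray_set E v0 = ray_set E v0"
      using boundary_act_image_inverse(1)[of a "ray_set E v0"] by simp
    with a show ?thesis by (simp add: hull_stabilizer_def inv_free_group reduced_word_inverse)
  qed
  show "a \<otimes>\<^bsub>free_group\<^esub> b \<in> hull_stabilizer" if "a \<in> hull_stabilizer" "b \<in> hull_stabilizer" for a b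
    using that by (auto simp: hull_stabilizer_def reduced_foldr boundary_act_mult_image)
qed (auto simp: hull_stabilizer_def)

lemma loops_subset_hull_stabilizer: "loops \<subseteq> hull_stabilizer"
proof
  fix w assume "w \<in> loops"
  then have "freely_reduced w" "walk E v0 w v0" by (simp_all add: loops_def)
  then show "w \<in> hull_stabilizer"
    using boundary_act_ray_set by (simp add: hull_stabilizer_def)
qed

lemma act_inverse_path_to: "v \<in> V \<Longrightarrow> boundary_act (word_inverse (path_to v)) ` ray_set E v0 = ray_set E v"
  using boundary_act_ray_set[OF path_to(2)] boundary_act_image_inverse(1) by metis

text \<open>The vertices with a given ray set correspond to the cosets of the fundamental group of the graph
  in the stabilizer of its limit set: two reduced paths to vertices with equal ray sets differ by an
  element of the stabilizer, and the end point of a path determines it up to loops.\<close>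

lemma card_same_ray_set:
  assumes v: "v \<in> V"
  shows "card {u \<in> V. ray_set E u = ray_set E v} = card (cosets_in free_group hull_stabilizer loops)"
    and "finite (cosets_in free_group hull_stabilizer loops)"
proof -
  let ?d = "\<lambda>u. foldr word_cons (path_to u) (word_inverse (path_to v))"
  let ?f = "\<lambda>u. loops #>\<^bsub>free_group\<^esub> ?d u"
  let ?A = "{u \<in> V. ray_set E u = ray_set E v}"
  have red: "freely_reduced (?d u)" for u
    using path_to[OF v] by (simp add: reduced_foldr reduced_word_inverse)
  have undo: "foldr word_cons (?d u) (path_to v) = path_to u" if "u \<in> V" for u
  proof -
    have "foldr word_cons (word_inverse (path_to v)) (path_to v) = []"
      using free.l_inv[of "path_to v"] path_to[OF v] by (simp add: inv_free_group)
    then show ?thesis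
      using path_to[OF v] path_to[OF that]
      by (simp add: foldr_word_cons_assoc reduced_word_inverse foldr_word_cons_Nil)
  qed
  have stab: "?d u \<in> hull_stabilizer" if u: "u \<in> ?A" for u
  proof -
    have "boundary_act (path_to u) ` ray_set E u = ray_set E v0"
      using u path_to(2)[of u] boundary_act_ray_set by blast
    then have "boundary_act (?d u) ` ray_set E v0 = ray_set E v0"
      using u act_inverse_path_to[OF v] by (simp add: boundary_act_mult_image)
    then show ?thesis using red by (simp add: hull_stabilizer_def)
  qed
  have bij: "bij_betw ?f ?A (cosets_in free_group hull_stabilizer loops)"
    unfolding bij_betw_def
  proof
    show "inj_on ?f ?A"
    proof (rule inj_onI)
      fix u z assume uz: "u \<in> ?A" "z \<in> ?A" "?f u = ?f z"
      have "?d u \<in> ?f u"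
        unfolding mem_r_coset_free_group using subgroup.one_closed[OF subgroup_loops]
        by (intro bexI[of _ "[]"]) auto
      then obtain h where h: "h \<in> loops" "?d u = foldr word_cons h (?d z)"
        unfolding uz(3) mem_r_coset_free_group by blast
      have "path_to u = foldr word_cons h (path_to z)"
        using undo[of u] undo[of z] uz(1,2) h(2) path_to[OF v] red
        by (metis (no_types, lifting) foldr_word_cons_assoc mem_Collect_eq)
      then have "walk E v0 (path_to u) z"
        using h(1) path_to(2)[of z] uz(2) by (auto simp: loops_def intro: walk_mult)
      then show "u = z" using path_to(2)[of u] uz(1) walk_det by blast
    qed
    show "?f ` ?A = cosets_in free_group hull_stabilizer loops"
      unfolding cosets_in_eq
    proof
      show "?f ` ?A \<subseteq> (\<lambda>a. loops #>\<^bsub>free_group\<^esub> a) ` hull_stabilizer" using stab by blast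
      show "(\<lambda>a. loops #>\<^bsub>free_group\<^esub> a) ` hull_stabilizer \<subseteq> ?f ` ?A"
      proof clarify
        fix c assume c: "c \<in> hull_stabilizer"
        then have cr: "freely_reduced c" and cs: "boundary_act c ` ray_set E v0 = ray_set E v0"
          by (auto simp: hull_stabilizer_def)
        let ?w = "foldr word_cons c (path_to v)"
        have wr: "freely_reduced ?w" using path_to[OF v] by (simp add: reduced_foldr)
        have "boundary_act ?w ` ray_set E v = ray_set E v0"
          using cs boundary_act_ray_set[OF path_to(2)[OF v]] by (simp add: boundary_act_mult_image)
        then have act: "boundary_act (word_inverse ?w) ` ray_set E v0 = ray_set E v"
          using boundary_act_image_inverse(1) by metis
        then obtain u where u: "walk E v0 ?w u"
          using readable_if_branching[OF v0 wr, of "ray_space E v"] points_ray_space[OF v]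
            ray_space_branching[OF v] by metis
        have uV: "u \<in> V" using walk_in_V[OF u v0] .
        have "boundary_act (word_inverse ?w) ` ray_set E v0 = ray_set E u"
          using boundary_act_ray_set[OF u] boundary_act_image_inverse(1) by metis
        then have uA: "u \<in> ?A" using act uV by simp
        let ?l = "foldr word_cons ?w (word_inverse (path_to u))"
        have ru: "freely_reduced (word_inverse (path_to u))" "freely_reduced (word_inverse (path_to v))"
          using path_to[OF uV] path_to[OF v] by (auto intro: reduced_word_inverse)
        have "?l \<in> loops"
          using walk_mult[OF u walk_word_inverse[OF path_to(2)[OF uV]]] ru(1)
          unfolding loops_def by (intro CollectI conjI reduced_foldr)
        moreover have "foldr word_cons ?l (?d u) = c"
        proof -
          have "foldr word_cons ?l (?d u)
              = foldr word_cons ?w (foldr word_cons (word_inverse (path_to u)) (?d u))"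
            by (rule foldr_word_cons_assoc[OF ru(1) red])
          also have "\<dots> = foldr word_cons ?w (word_inverse (path_to v))"
            using foldr_word_cons_inverse[OF ru(2)] by simp
          also have "\<dots> = foldr word_cons c (foldr word_cons (path_to v) (word_inverse (path_to v)))"
            using path_to(1)[OF v] ru(2) by (rule foldr_word_cons_assoc)
          also have "\<dots> = c" using cr path_to(1)[OF v] by (simp add: foldr_word_cons_right_inverse foldr_word_cons_Nil)
          finally show ?thesis .
        qed
        ultimately have "c \<in> loops #>\<^bsub>free_group\<^esub> ?d u"
          unfolding mem_r_coset_free_group by metis
        moreover have "?d u \<in> carrier free_group" using red by simp
        ultimately have "loops #>\<^bsub>free_group\<^esub> ?d u = loops #>\<^bsub>free_group\<^esub> c"
          by (rule free.repr_independence[OF _ _ subgroup_loops])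
        then have "loops #>\<^bsub>free_group\<^esub> c = ?f u" by (rule sym)
        then show "loops #>\<^bsub>free_group\<^esub> c \<in> ?f ` ?A" using uA by (rule image_eqI)
      qed
    qed
  qed
  show "card ?A = card (cosets_in free_group hull_stabilizer loops)"
    using bij by (rule bij_betw_same_card)
  show "finite (cosets_in free_group hull_stabilizer loops)"
    using bij_betw_finite[OF bij] finite_V by simp
qed

lemma limit_set_hull_stabilizer: "limit_set hull_stabilizer = ray_set E v0"
proof
  have "\<exists>u. walk E v0 g u" if "g \<in> hull_stabilizer" for g
  proof -
    have g: "freely_reduced g" "boundary_act g ` ray_set E v0 = ray_set E v0"
      using that by (auto simp: hull_stabilizer_def)
    then have "boundary_act (word_inverse g) ` ray_set E v0 = points (ray_space E v0)"
      using boundary_act_image_inverse(1)[of g "ray_set E v0"] points_ray_space[OF v0] by simp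
    then show ?thesis using readable_if_branching[OF v0 g(1)] ray_space_branching[OF v0] by blast
  qed
  then show "limit_set hull_stabilizer \<subseteq> ray_set E v0"
    by (rule limit_set_subset_ray_set)
  show "ray_set E v0 \<subseteq> limit_set hull_stabilizer"
    using limit_set_mono[OF loops_subset_hull_stabilizer] limit_set_loops by simp
qed

text \<open>Elements of the commensurator preserve the limit set because passing to a subgroup of finite
  index does not change it; conversely the loops have finite index in the stabilizer.\<close>

lemma commensurator_loops: "commensurator free_group loops = hull_stabilizer"
proof (rule subset_antisym; rule subsetI)
  fix g assume g: "g \<in> commensurator free_group loops"
  let ?K = "conj_subgroup free_group g loops"
  have red: "freely_reduced g"
    and fin: "finite (cosets_in free_group loops (loops \<inter> ?K))" "finite (cosets_in free_group ?K (loops \<inter> ?K))"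
    using g by (auto simp: commensurator_def)
  have K: "subgroup ?K free_group" by (rule subgroup_conj_free_group[OF subgroup_loops red])
  have J: "subgroup (loops \<inter> ?K) free_group" by (rule free.subgroups_Inter_pair[OF subgroup_loops K])
  have "limit_set loops = limit_set (loops \<inter> ?K)"
    using limit_set_finite_index[OF _ J fin(1)] limit_set_mono[of "loops \<inter> ?K" loops]
      subgroup.subset[OF subgroup_loops] by auto
  also have "\<dots> = limit_set ?K"
    using limit_set_finite_index[OF _ J fin(2)] limit_set_mono[of "loops \<inter> ?K" ?K]
      subgroup.subset[OF K] by auto
  also have "\<dots> = boundary_act g ` limit_set loops" by (rule limit_set_conj[OF subgroup_loops red])
  finally show "g \<in> hull_stabilizer" using red by (simp add: hull_stabilizer_def limit_set_loops)
next
  fix g assume g: "g \<in> hull_stabilizer"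
  let ?K = "conj_subgroup free_group g loops"
  have red: "freely_reduced g" using g by (simp add: hull_stabilizer_def)
  have sub: "hull_stabilizer \<subseteq> carrier free_group" by (auto simp: hull_stabilizer_def)
  have K: "subgroup ?K free_group" by (rule subgroup_conj_free_group[OF subgroup_loops red])
  have fin: "finite (cosets_in free_group hull_stabilizer loops)"
    by (rule card_same_ray_set(2)[OF v0])
  have "?K \<subseteq> hull_stabilizer"
    unfolding conj_subgroup_free_group[OF red]
    using subgroup.m_closed[OF subgroup_hull_stabilizer] subgroup.m_inv_closed[OF subgroup_hull_stabilizer g]
      g loops_subset_hull_stabilizer by (auto simp: inv_free_group red)
  then have "finite (cosets_in free_group ?K (?K \<inter> loops))"
    by (rule free.finite_index_inter[OF K subgroup_loops _ sub fin])
  moreover have "finite (cosets_in free_group loops (loops \<inter> ?K))"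
    by (rule free.finite_index_inter[OF subgroup_loops K loops_subset_hull_stabilizer sub
        free.finite_index_conj[OF subgroup_loops subgroup_hull_stabilizer g K fin]])
  ultimately show "g \<in> commensurator free_group loops"
    using red by (simp add: commensurator_def Int_commute)
qed

end

context connected_folded_graph
begin

definition hull_orbit :: "'n cspace set" where
  "hull_orbit = (\<lambda>g. translate g (ray_space E v0)) ` {g. freely_reduced g}"

lemma conj_hull_stabilizer_eq:
  assumes g: "freely_reduced g"
  shows "conj_subgroup free_group g hull_stabilizer =
    {x. freely_reduced x \<and> translate x (translate g (ray_space E v0)) = translate g (ray_space E v0)}"
    (is "_ = ?X")
proof (rule subset_antisym; rule subsetI)
  have eq: "translate x (translate g (ray_space E v0)) = translate g (ray_space E v0) \<longleftrightarrow>
      boundary_act x ` boundary_act g ` ray_set E v0 = boundary_act g ` ray_set E v0" for x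
    by (simp add: points_translate points_ray_space[OF v0] flip: points_inject)
  have gi: "freely_reduced (word_inverse g)" using g by (rule reduced_word_inverse)
  {
    fix x assume "x \<in> conj_subgroup free_group g hull_stabilizer"
    then obtain h where h: "freely_reduced h" "boundary_act h ` ray_set E v0 = ray_set E v0"
      "x = foldr word_cons (foldr word_cons g h) (word_inverse g)"
      by (auto simp: conj_subgroup_free_group[OF g] hull_stabilizer_def)
    then show "x \<in> ?X"
      using gi by (simp add: eq reduced_foldr boundary_act_mult_image)
  next
    fix x assume "x \<in> ?X"
    then have x: "freely_reduced x"
      "boundary_act x ` boundary_act g ` ray_set E v0 = boundary_act g ` ray_set E v0"
      by (simp_all add: eq)
    let ?h = "foldr word_cons (word_inverse g) (foldr word_cons x g)"
    have "?h \<in> hull_stabilizer"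
      using x g by (simp add: hull_stabilizer_def reduced_foldr boundary_act_mult_image)
    moreover have "x = foldr word_cons (foldr word_cons g ?h) (word_inverse g)"
    proof -
      have "foldr word_cons g ?h = foldr word_cons x g"
        using foldr_word_cons_inverse[of "foldr word_cons x g" "word_inverse g"] g
        by (simp only: word_inverse_twice reduced_foldr)
      moreover have "foldr word_cons (foldr word_cons x g) (word_inverse g) = x"
        using g gi x(1) by (simp add: foldr_word_cons_assoc foldr_word_cons_right_inverse foldr_word_cons_Nil)
      ultimately show ?thesis by simp
    qed
    ultimately show "x \<in> conj_subgroup free_group g hull_stabilizer"
      unfolding conj_subgroup_free_group[OF g] by blast
  }
qed

text \<open>A conjugate of the stabilizer is the stabilizer of its own limit set, so summing over the
  conjugacy class amounts to counting points of the orbit of the limit set.\<close>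

lemma emeasure_dirac_sum_hull_stabilizer:
  assumes A: "A \<in> sets borel"
  shows "emeasure (dirac_sum hull_stabilizer) A = emeasure (count_space UNIV) (A \<inter> hull_orbit)"
proof -
  let ?C = "conj_class free_group hull_stabilizer"
  let ?F = "\<lambda>H. Abs_cspace (limit_set H)"
  have F: "?F (conj_subgroup free_group g hull_stabilizer) = translate g (ray_space E v0)"
    if "freely_reduced g" for g
  proof -
    have "limit_set (conj_subgroup free_group g hull_stabilizer) = points (translate g (ray_space E v0))"
      by (simp add: limit_set_conj[OF subgroup_hull_stabilizer that] limit_set_hull_stabilizer
          points_translate points_ray_space[OF v0])
    then show ?thesis by (simp add: points_inverse)
  qed
  have inj: "inj_on ?F ?C"
  proof (rule inj_on_inverseI)
    fix H assume "H \<in> ?C"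
    then obtain g where g: "freely_reduced g" "H = conj_subgroup free_group g hull_stabilizer"
      by (auto simp: conj_class_def)
    show "{x. freely_reduced x \<and> translate x (?F H) = ?F H} = H"
      unfolding g(2) F[OF g(1)] unfolding conj_hull_stabilizer_eq[OF g(1)] by (rule refl)
  qed
  have orbit: "hull_orbit = ?F ` ?C"
    unfolding hull_orbit_def conj_class_def image_image by (intro image_cong) (auto simp: F)
  let ?X = "{H \<in> ?C. ?F H \<in> A}"
  have "emeasure (dirac_sum hull_stabilizer) A = (\<integral>\<^sup>+ H. indicator ?X H \<partial>count_space ?C)"
    unfolding emeasure_dirac_sum[OF A]
    by (intro nn_integral_cong) (use A in \<open>auto simp: indicator_def\<close>)
  also have "\<dots> = emeasure (count_space ?C) ?X" by (intro nn_integral_indicator) auto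
  also have "\<dots> = emeasure (count_space UNIV) (?F ` ?X)"
  proof -
    have injX: "inj_on ?F ?X" using inj by (rule inj_on_subset) auto
    then show ?thesis
      using card_image[OF injX] finite_image_iff[OF injX] by (simp add: emeasure_count_space)
  qed
  also have "?F ` ?X = A \<inter> hull_orbit" unfolding orbit by auto
  finally show ?thesis .
qed

lemma emeasure_counting_current:
  assumes "A \<in> sets borel"
  shows "emeasure (counting_current loops) A =
    of_nat (card (cosets_in free_group hull_stabilizer loops)) * emeasure (count_space UNIV) (A \<inter> hull_orbit)"
  by (simp add: counting_current_def Let_def commensurator_loops emeasure_dirac_sum_hull_stabilizer[OF assms])

lemma sets_counting_current: "sets (counting_current H) = sets borel"
  by (simp add: counting_current_def Let_def)

lemma branching_hull_orbit: "branching \<inter> hull_orbit = ray_space E ` V"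
proof (rule subset_antisym; rule subsetI)
  fix S assume S: "S \<in> branching \<inter> hull_orbit"
  then obtain g where g: "freely_reduced g" "S = translate g (ray_space E v0)"
    by (auto simp: hull_orbit_def)
  have "boundary_act (word_inverse (word_inverse g)) ` ray_set E v0 = points S"
    by (simp only: g(2) points_translate points_ray_space[OF v0] word_inverse_twice)
  then obtain u where u: "walk E v0 (word_inverse g) u"
    using readable_if_branching[OF v0 reduced_word_inverse[OF g(1)]] S by blast
  have "points S = boundary_act g ` ray_set E v0" using g by (simp add: points_translate points_ray_space v0)
  also have "\<dots> = boundary_act g ` boundary_act (word_inverse g) ` ray_set E u"
    by (simp only: boundary_act_ray_set[OF u])
  also have "\<dots> = points (ray_space E u)" using walk_in_V[OF u v0] by (simp add: points_ray_space)
  finally show "S \<in> ray_space E ` V" using walk_in_V[OF u v0] by (auto simp: points_inject)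
next
  fix S assume "S \<in> ray_space E ` V"
  then obtain u where u: "u \<in> V" "S = ray_space E u" by blast
  have "points S = points (translate (word_inverse (path_to u)) (ray_space E v0))"
    using u by (simp add: points_translate points_ray_space v0 act_inverse_path_to)
  then have "S = translate (word_inverse (path_to u)) (ray_space E v0)" by (simp add: points_inject)
  then have "S \<in> hull_orbit"
    unfolding hull_orbit_def using path_to(1)[OF u(1)] reduced_word_inverse by blast
  then show "S \<in> branching \<inter> hull_orbit" using u ray_space_branching by simp
qed

text \<open>On sets of hulls through the identity the counting current counts vertices of the graph.  The
  multiplicity \<open>[Comm(H) : H]\<close> is the number of vertices sharing one ray set.\<close>

lemma emeasure_counting_current_branching:
  assumes "B \<in> sets borel" "B \<subseteq> branching"
  shows "emeasure (counting_current loops) B = of_nat (card {v \<in> V. ray_space E v \<in> B})"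
proof -
  let ?m = "card (cosets_in free_group hull_stabilizer loops)"
  let ?S = "{v \<in> V. ray_space E v \<in> B}"
  have "B \<inter> hull_orbit = B \<inter> (branching \<inter> hull_orbit)" using assms(2) by blast
  also have "\<dots> = ray_space E ` ?S" unfolding branching_hull_orbit by auto
  finally have eq: "B \<inter> hull_orbit = ray_space E ` ?S" .
  have finS: "finite ?S" using finite_V by simp
  have "card ?S = (\<Sum>y\<in>ray_space E ` ?S. card {v \<in> ?S. ray_space E v = y})"
    using sum.image_gen[OF finS, of "\<lambda>_. 1 :: nat" "ray_space E"] by simp
  also have "\<dots> = (\<Sum>y\<in>ray_space E ` ?S. ?m)"
  proof (intro sum.cong refl)
    fix y assume "y \<in> ray_space E ` ?S"
    then obtain v where v: "v \<in> V" "y = ray_space E v" "y \<in> B" by blast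
    have "ray_space E u = ray_space E v \<longleftrightarrow> ray_set E u = ray_set E v" if "u \<in> V" for u
      using points_ray_space[OF that] points_ray_space[OF v(1)] by metis
    then have "{u \<in> ?S. ray_space E u = y} = {u \<in> V. ray_set E u = ray_set E v}"
      using v by auto
    then show "card {u \<in> ?S. ray_space E u = y} = ?m" using card_same_ray_set(1)[OF v(1)] by simp
  qed
  also have "\<dots> = ?m * card (ray_space E ` ?S)" by simp
  finally have "card ?S = ?m * card (ray_space E ` ?S)" .
  then show ?thesis
    using finS unfolding emeasure_counting_current[OF assms(1)] eq
    by (simp add: emeasure_count_space)
qed

lemma translate_hull_orbit:
  assumes "freely_reduced g"
  shows "translate g ` hull_orbit = hull_orbit"
proof -
  have sub: "translate g ` hull_orbit \<subseteq> hull_orbit" if "freely_reduced g" for g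
  proof clarify
    fix S assume "S \<in> hull_orbit"
    then obtain k where k: "freely_reduced k" "S = translate k (ray_space E v0)"
      by (auto simp: hull_orbit_def)
    have "translate g S = translate (foldr word_cons g k) (ray_space E v0)"
      by (simp add: k points_translate boundary_act_mult_image flip: points_inject)
    then show "translate g S \<in> hull_orbit"
      using k(1) unfolding hull_orbit_def by (auto intro: reduced_foldr)
  qed
  show ?thesis
  proof
    show "hull_orbit \<subseteq> translate g ` hull_orbit"
    proof
      fix S assume "S \<in> hull_orbit"
      then have "translate (word_inverse g) S \<in> hull_orbit"
        using sub[OF reduced_word_inverse[OF assms]] by blast
      then show "S \<in> translate g ` hull_orbit" by (metis imageI translate_word_inverse(2))
    qed
  qed (rule sub[OF assms])
qed

lemma inj_translate: "inj (translate g)"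
  by (rule inj_on_inverseI[of _ "translate (word_inverse g)"]) simp

lemma translate_image_sets_borel: "A \<in> sets borel \<Longrightarrow> translate g ` A \<in> sets borel"
  unfolding translate_image_eq_vimage
  using measurable_sets[OF measurable_translate[of "word_inverse g"]] by simp

lemma counting_current_in_subset_currents: "counting_current loops \<in> subset_currents"
  unfolding subset_currents_def
proof (intro CollectI conjI ballI allI impI)
  have inv: "emeasure (counting_current loops) (translate g ` A) = emeasure (counting_current loops) A"
    if g: "freely_reduced g" and A: "A \<in> sets borel" for g A
  proof -
    have "translate g ` A \<inter> hull_orbit = translate g ` (A \<inter> hull_orbit)"
      using translate_hull_orbit[OF g] inj_translate image_Int by metis
    moreover have "inj_on (translate g) (A \<inter> hull_orbit)" using inj_translate by (rule inj_on_subset) simp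
    ultimately have "emeasure (count_space UNIV) (translate g ` A \<inter> hull_orbit)
        = emeasure (count_space UNIV) (A \<inter> hull_orbit)"
      by (simp add: emeasure_count_space finite_image_iff card_image)
    then show ?thesis
      using A by (simp add: emeasure_counting_current translate_image_sets_borel)
  qed
  then show "emeasure (counting_current loops) (translate g ` A) = emeasure (counting_current loops) A"
    if "g \<in> carrier free_group" "A \<in> sets borel" for g A using that by simp
  show "sets (counting_current loops) = sets borel" by (rule sets_counting_current)
  fix K :: "'n cspace set" assume "compact K"
  from compact_translate_branching_cover[OF this] obtain G where
    G: "finite G" "\<And>g. g \<in> G \<Longrightarrow> freely_reduced g" "K \<subseteq> (\<Union>g\<in>G. translate g ` branching)"
    by blast
  have br: "(branching :: 'n cspace set) \<in> sets borel" by (rule borel_open[OF open_branching])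
  have meas: "translate g ` branching \<in> sets (counting_current loops)" for g
    unfolding sets_counting_current by (rule translate_image_sets_borel[OF br])
  have "emeasure (counting_current loops) K \<le> emeasure (counting_current loops) (\<Union>g\<in>G. translate g ` branching)"
    by (intro emeasure_mono G sets.finite_UN) (use meas G in auto)
  also have "\<dots> \<le> (\<Sum>g\<in>G. emeasure (counting_current loops) (translate g ` branching))"
    by (rule emeasure_subadditive_finite) (use G meas in auto)
  also have "\<dots> = (\<Sum>g\<in>G. of_nat (card {v \<in> V. ray_space E v \<in> branching}))"
    by (intro sum.cong refl) (simp add: inv G br emeasure_counting_current_branching)
  also have "\<dots> < \<infinity>" by (simp add: ennreal_of_nat_eq_real_of_nat flip: ennreal_mult'')
  finally show "emeasure (counting_current loops) K < \<infinity>" .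
qed

lemma rational_current_of_graph:
  assumes "0 \<le> c"
  obtains \<nu> where "\<nu> \<in> rational_subset_currents"
    "\<And>B. B \<in> sets borel \<Longrightarrow> B \<subseteq> branching \<Longrightarrow>
      measure \<nu> B = c * real (card {v \<in> V. ray_space E v \<in> B})"
proof
  let ?\<nu> = "scale_measure (ennreal c) (counting_current loops)"
  have "?\<nu> \<in> subset_currents"
    using counting_current_in_subset_currents
    by (auto simp: subset_currents_def ennreal_mult_less_top)
  then show "?\<nu> \<in> rational_subset_currents"
    unfolding rational_subset_currents_def
    using assms finitely_generated_loops loops_nontrivial
    by (intro CollectI conjI exI[of _ c] exI[of _ loops]) simp_all
  show "measure ?\<nu> B = c * real (card {v \<in> V. ray_space E v \<in> B})"
    if "B \<in> sets borel" "B \<subseteq> branching" for B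
  proof -
    have "emeasure ?\<nu> B = ennreal (c * real (card {v \<in> V. ray_space E v \<in> B}))"
      using assms that
      by (simp add: emeasure_counting_current_branching ennreal_of_nat_eq_real_of_nat ennreal_mult)
    then show ?thesis using assms by (simp add: measure_def)
  qed
qed

end

section \<open>Realizing the local statistics of a current by a finite graph\<close>

text \<open>A nonnegative real solution of homogeneous linear equations with coefficients \<open>0\<close> and \<open>\<plusminus>1\<close> is
  approximated by a rational one with common denominator \<open>q\<close>.  Dirichlet's simultaneous
  approximation makes \<open>q x\<close> so close to an integer vector \<open>p\<close> that each equation holds for \<open>p\<close> up to
  an error less than \<open>1\<close>; then it holds exactly.\<close>

lemma simultaneous_integer_approximation:
  fixes x :: "'a \<Rightarrow> real"
  assumes I: "finite I" and x: "\<And>i. i \<in> I \<Longrightarrow> 0 \<le> x i" and "0 < \<epsilon>"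
  obtains q :: nat and p :: "'a \<Rightarrow> nat" where "0 < q"
    "\<And>i. i \<in> I \<Longrightarrow> \<bar>x i - real (p i) / real q\<bar> < \<epsilon>"
    "\<And>A B. A \<subseteq> I \<Longrightarrow> B \<subseteq> I \<Longrightarrow> (\<Sum>i\<in>A. x i) = (\<Sum>i\<in>B. x i) \<Longrightarrow> (\<Sum>i\<in>A. p i) = (\<Sum>i\<in>B. p i)"
proof -
  obtain f n where f: "bij_betw f {..<n :: nat} I"
    using I by (metis bij_betw_from_nat_into_finite lessThan_atLeast0 ex_bij_betw_nat_finite)
  obtain N0 :: nat where N0: "1 / \<epsilon> < real N0" using reals_Archimedean2 by blast
  \<comment> \<open>Each coordinate is off by less than \<open>1 / N\<close>: less than \<open>\<epsilon>\<close> by the choice of \<open>N0\<close>, and so little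
    that a sum over a subset of \<open>I\<close> is off by less than \<open>1 / 2\<close>.\<close>
  define N where "N = N0 + 2 * card I + 1"
  have N: "0 < N" by (simp add: N_def)
  have N\<epsilon>: "1 / real N < \<epsilon>"
  proof -
    have "1 / \<epsilon> < real N" using N0 by (simp add: N_def)
    then show ?thesis using \<open>0 < \<epsilon>\<close> N by (simp add: field_simps)
  qed
  obtain q :: int and p where q: "0 < q" and p: "\<And>i. i < n \<Longrightarrow> \<bar>of_int q * x (f i) - of_int (p i)\<bar> < 1 / N"
    by (rule Dirichlet_approx_simult[OF N, of n "\<lambda>i. x (f i)"]) (use that in blast)
  define p' where "p' i = p (inv_into {..<n} f i)" for i
  have p': "\<bar>of_int q * x i - of_int (p' i)\<bar> < 1 / real N" if "i \<in> I" for i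
  proof -
    have "inv_into {..<n} f i < n" "f (inv_into {..<n} f i) = i"
      using that f inv_into_into[of i f "{..<n}"] by (auto simp: bij_betw_def intro: f_inv_into_f)
    then show ?thesis using p[of "inv_into {..<n} f i"] by (simp add: p'_def)
  qed
  have p'0: "0 \<le> p' i" if "i \<in> I" for i
  proof -
    have "0 \<le> of_int q * x i" using q x[OF that] by simp
    moreover have "1 / real N \<le> 1" using N by simp
    ultimately have "- 1 < real_of_int (p' i)" using p'[OF that] by linarith
    then show ?thesis by linarith
  qed
  have nat_p': "real (nat (p' i)) = of_int (p' i)" if "i \<in> I" for i using p'0[OF that] by simp
  show thesis
  proof (rule that[of "nat q" "\<lambda>i. nat (p' i)"])
    show "0 < nat q" using q by simp
    show "\<bar>x i - real (nat (p' i)) / real (nat q)\<bar> < \<epsilon>" if i: "i \<in> I" for i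
    proof -
      have "x i - real (nat (p' i)) / real (nat q) = (of_int q * x i - of_int (p' i)) / of_int q"
        using q nat_p'[OF i] by (simp add: field_simps)
      then have "\<bar>x i - real (nat (p' i)) / real (nat q)\<bar> = \<bar>of_int q * x i - of_int (p' i)\<bar> / of_int q"
        using q by simp
      also have "\<dots> \<le> \<bar>of_int q * x i - of_int (p' i)\<bar>"
        using q by (intro divide_le_eq[THEN iffD2]) (auto simp: mult_le_cancel_left1)
      also have "\<dots> < \<epsilon>" using p'[OF i] N\<epsilon> by linarith
      finally show ?thesis .
    qed
    fix A B assume AB: "A \<subseteq> I" "B \<subseteq> I" "(\<Sum>i\<in>A. x i) = (\<Sum>i\<in>B. x i)"
    \<comment> \<open>Two integers that differ from the same real number by less than \<open>1 / 2\<close> are equal.\<close>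
    have close: "\<bar>of_int q * (\<Sum>i\<in>A. x i) - of_int (\<Sum>i\<in>A. p' i)\<bar> < 1 / 2" if "A \<subseteq> I" for A
    proof -
      have "\<bar>of_int q * (\<Sum>i\<in>A. x i) - of_int (\<Sum>i\<in>A. p' i)\<bar> = \<bar>\<Sum>i\<in>A. of_int q * x i - of_int (p' i)\<bar>"
        by (simp add: sum_distrib_left sum_subtractf)
      also have "\<dots> \<le> (\<Sum>i\<in>A. \<bar>of_int q * x i - of_int (p' i)\<bar>)" by (rule sum_abs)
      also have "\<dots> \<le> (\<Sum>i\<in>A. 1 / real N)" using p' that by (intro sum_mono) (auto intro: less_imp_le)
      also have "\<dots> = real (card A) / real N" by simp
      also have "\<dots> < 1 / 2"
      proof -
        have "2 * card A < N" using card_mono[OF I that] by (simp add: N_def)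
        then show ?thesis using N by (simp add: field_simps)
      qed
      finally show ?thesis .
    qed
    have "\<bar>real_of_int (\<Sum>i\<in>A. p' i) - of_int (\<Sum>i\<in>B. p' i)\<bar> < 1"
      using close[OF AB(1), unfolded AB(3)] close[OF AB(2)] by linarith
    then have "(\<Sum>i\<in>A. p' i) = (\<Sum>i\<in>B. p' i)" by linarith
    moreover have "int (\<Sum>i\<in>A. nat (p' i)) = (\<Sum>i\<in>A. p' i)" if "A \<subseteq> I" for A
      using that p'0 by (simp add: subset_iff)
    ultimately have "int (\<Sum>i\<in>A. nat (p' i)) = int (\<Sum>i\<in>B. nat (p' i))" using AB by simp
    then show "(\<Sum>i\<in>A. nat (p' i)) = (\<Sum>i\<in>B. nat (p' i))" by (simp only: of_nat_eq_iff)
  qed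
qed

lemma label_preserving_bijection:
  assumes "finite A" "finite B" "\<And>y. card {a \<in> A. f a = y} = card {b \<in> B. g b = y}"
  obtains \<phi> where "bij_betw \<phi> A B" "\<And>a. a \<in> A \<Longrightarrow> g (\<phi> a) = f a"
proof -
  have "\<exists>h. bij_betw h {a \<in> A. f a = y} {b \<in> B. g b = y}" for y
    using assms by (intro finite_same_card_bij) auto
  then obtain h where h: "\<And>y. bij_betw (h y) {a \<in> A. f a = y} {b \<in> B. g b = y}" by metis
  have hB: "h (f a) a \<in> B \<and> g (h (f a) a) = f a" if "a \<in> A" for a
    using bij_betwE[OF h[of "f a"]] that by blast
  have "bij_betw (\<lambda>a. h (f a) a) A B"
    unfolding bij_betw_def
  proof
    show "inj_on (\<lambda>a. h (f a) a) A"
    proof (rule inj_onI)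
      fix a a' assume a: "a \<in> A" "a' \<in> A" "h (f a) a = h (f a') a'"
      then have "f a = f a'" using hB[OF a(1)] hB[OF a(2)] by simp
      then show "a = a'" using a bij_betw_imp_inj_on[OF h[of "f a"]] by (simp add: inj_on_def)
    qed
    show "(\<lambda>a. h (f a) a) ` A = B"
    proof
      show "(\<lambda>a. h (f a) a) ` A \<subseteq> B" using hB by blast
      show "B \<subseteq> (\<lambda>a. h (f a) a) ` A"
      proof
        fix b assume "b \<in> B"
        then have "b \<in> h (g b) ` {a \<in> A. f a = g b}"
          using bij_betw_imp_surj_on[OF h[of "g b"]] by blast
        then obtain a where "a \<in> A" "f a = g b" "b = h (g b) a" by blast
        then show "b \<in> (\<lambda>a. h (f a) a) ` A" by (intro image_eqI[of _ _ a]) simp_all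
      qed
    qed
  qed
  then show thesis using that hB by blast
qed

subsection \<open>Matching along an edge\<close>

text \<open>The part of the \<open>r\<close>-ball around the identity that is also visible from the neighbour \<open>a\<close> consists
  of the branch behind \<open>a\<close>, seen from \<open>a\<close>, and of the rest, cut off at radius \<open>r - 1\<close>.\<close>

definition branch_at :: "'n letter \<Rightarrow> 'n letter list set \<Rightarrow> 'n letter list set" where
  "branch_at a T = tl ` {w \<in> T. hd w = a}"

definition branches_off :: "'n letter \<Rightarrow> 'n letter list set \<Rightarrow> 'n letter list set" where
  "branches_off a T = butlast ` {w \<in> T. hd w \<noteq> a}"

text \<open>The possible \<open>r\<close>-balls around the identity in hulls passing through it.\<close>

definition vertex_types :: "nat \<Rightarrow> 'n letter list set set" where
  "vertex_types r = (\<lambda>S. initial_words r (points S)) ` branching"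

lemma finite_vertex_types: "finite (vertex_types r :: ('n :: finite) letter list set set)"
  by (rule finite_subset[OF _ finite_word_sets[of r]])
     (use initial_words_in_finite in \<open>auto simp: vertex_types_def\<close>)

lemma butlast_stake: "butlast (stake (Suc k) s) = stake k s"
  by (simp add: butlast_conv_take take_stake del: stake.simps)

text \<open>Moving the base point across the edge \<open>a\<close> exchanges the two sides of that edge.\<close>

lemma branch_at_translate:
  assumes "1 \<le> r"
  shows "branch_at (inv_letter a) (initial_words r (letter_act (inv_letter a) ` S)) =
    branches_off a (initial_words r S)"
proof -
  obtain k where r: "r = Suc k" using assms by (cases r) auto
  have sh: "shd (ray (letter_act (inv_letter a) \<xi>)) = inv_letter a \<longleftrightarrow> shd (ray \<xi>) \<noteq> a" for \<xi>
    using ray_Suc_neq[of \<xi> 0] by (auto simp: letter_act.rep_eq ray_cons_def)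
  have st: "stl (ray (letter_act (inv_letter a) \<xi>)) = ray \<xi>" if "shd (ray \<xi>) \<noteq> a" for \<xi>
    using that by (simp add: letter_act.rep_eq ray_cons_def)
  have "branch_at (inv_letter a) (initial_words r (letter_act (inv_letter a) ` S))
      = (\<lambda>\<xi>. stake k (stl (ray (letter_act (inv_letter a) \<xi>)))) ` {\<xi> \<in> S. shd (ray (letter_act (inv_letter a) \<xi>)) = inv_letter a}"
    unfolding branch_at_def initial_words_def r by (force simp: image_iff)
  also have "\<dots> = (\<lambda>\<xi>. stake k (ray \<xi>)) ` {\<xi> \<in> S. shd (ray \<xi>) \<noteq> a}"
    unfolding sh by (intro image_cong refl) (simp add: st)
  also have "\<dots> = (\<lambda>\<xi>. butlast (stake r (ray \<xi>))) ` {\<xi> \<in> S. hd (stake r (ray \<xi>)) \<noteq> a}"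
    unfolding r butlast_stake by simp
  also have "\<dots> = branches_off a (initial_words r S)"
    unfolding branches_off_def initial_words_def by (auto simp del: stake.simps)
  finally show ?thesis .
qed

lemma branches_off_translate:
  assumes "1 \<le> r"
  shows "branches_off (inv_letter a) (initial_words r (letter_act (inv_letter a) ` S)) =
    branch_at a (initial_words r S)"
  using branch_at_translate[OF assms, of "inv_letter a" "letter_act (inv_letter a) ` S"]
  by (simp add: image_image)

definition edge_event :: "nat \<Rightarrow> 'n letter \<Rightarrow> 'n letter list set \<Rightarrow> 'n letter list set \<Rightarrow> 'n cspace set" where
  "edge_event r a X Y = {S. branch_at a (initial_words r (points S)) = X \<and>
     branches_off a (initial_words r (points S)) = Y}"

lemma translate_edge_event:
  assumes "1 \<le> r"
  shows "translate [inv_letter a] ` edge_event r a X Y = edge_event r (inv_letter a) Y X"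
proof -
  have pts: "points (translate [b] S) = letter_act b ` points S" for b and S :: "'a cspace"
    by (simp add: points_translate letter_act_word)
  have sub: "translate [inv_letter a] S \<in> edge_event r (inv_letter a) Y X"
    if "S \<in> edge_event r a X Y" for a X Y and S :: "'a cspace"
    using that by (simp add: edge_event_def pts branch_at_translate[OF assms] branches_off_translate[OF assms])
  show ?thesis
  proof (rule subset_antisym)
    show "translate [inv_letter a] ` edge_event r a X Y \<subseteq> edge_event r (inv_letter a) Y X"
      using sub by blast
    show "edge_event r (inv_letter a) Y X \<subseteq> translate [inv_letter a] ` edge_event r a X Y"
    proof
      fix S :: "'a cspace" assume "S \<in> edge_event r (inv_letter a) Y X"
      then have "translate [a] S \<in> edge_event r a X Y" using sub[of S "inv_letter a"] by simp
      moreover have "translate [inv_letter a] (translate [a] S) = S"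
        using translate_word_inverse(1)[of "[a]" S] by simp
      ultimately show "S \<in> translate [inv_letter a] ` edge_event r a X Y" by (metis imageI)
    qed
  qed
qed

lemma two_first_letters:
  assumes "1 \<le> r" "T \<in> vertex_types r"
  obtains u w where "u \<in> T" "w \<in> T" "hd u \<noteq> hd w"
proof -
  obtain k where r: "r = Suc k" using assms(1) by (cases r) auto
  obtain S where "S \<in> branching" "T = initial_words r (points S)" using assms(2) by (auto simp: vertex_types_def)
  then obtain \<xi> \<zeta> where "\<xi> \<in> points S" "\<zeta> \<in> points S" "shd (ray \<xi>) \<noteq> shd (ray \<zeta>)"
    "T = initial_words r (points S)" by (auto simp: branching_def)
  then show thesis
    using that[of "stake r (ray \<xi>)" "stake r (ray \<zeta>)"] by (auto simp: initial_words_def r)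
qed

lemma branches_off_nonempty:
  assumes "1 \<le> r" "T \<in> vertex_types r"
  shows "branches_off a T \<noteq> {}"
proof -
  obtain u w where "u \<in> T" "w \<in> T" "hd u \<noteq> hd w" using two_first_letters[OF assms] .
  then have "\<exists>v\<in>T. hd v \<noteq> a" by metis
  then show ?thesis by (auto simp: branches_off_def)
qed

lemma vertex_types_word:
  "T \<in> vertex_types r \<Longrightarrow> w \<in> T \<Longrightarrow> length w = r \<and> freely_reduced w"
  by (auto simp: vertex_types_def initial_words_length initial_words_reduced)

lemma vertex_type_if_branches:
  assumes "1 \<le> r" "branch_at a (initial_words r (points S)) \<noteq> {}" "branches_off a (initial_words r (points S)) \<noteq> {}"
  shows "S \<in> branching"
proof -
  obtain k where r: "r = Suc k" using assms(1) by (cases r) auto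
  obtain u w where "u \<in> initial_words r (points S)" "hd u = a" "w \<in> initial_words r (points S)" "hd w \<noteq> a"
    using assms(2,3) by (auto simp: branch_at_def branches_off_def)
  then show ?thesis unfolding branching_def initial_words_def r by fastforce
qed

lemma measure_edge_event:
  fixes \<mu> :: "('n :: finite) cspace measure"
  assumes \<mu>: "\<mu> \<in> subset_currents" and r: "1 \<le> r" and ne: "X \<noteq> {}" "Y \<noteq> {}"
  shows "measure \<mu> (edge_event r a X Y) =
    (\<Sum>T\<in>{T \<in> vertex_types r. branch_at a T = X \<and> branches_off a T = Y}. measure \<mu> (cylinder r T))"
proof -
  let ?I = "{T \<in> vertex_types r. branch_at a T = X \<and> branches_off a T = Y}"
  have sets: "sets \<mu> = sets borel" and fin: "emeasure \<mu> branching < \<infinity>"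
    using \<mu> compact_branching by (auto simp: subset_currents_def)
  have eq: "edge_event r a X Y = (\<Union>T\<in>?I. cylinder r T)"
    using vertex_type_if_branches[OF r, of a] ne
    by (auto simp: edge_event_def cylinder_def vertex_types_def)
  have "cylinder r T \<subseteq> branching" if "T \<in> vertex_types r" for T
    using that branching_cong[OF _ r] by (auto simp: vertex_types_def cylinder_def)
  moreover have "branching \<in> sets \<mu>" unfolding sets by (rule borel_open[OF open_branching])
  ultimately have "emeasure \<mu> (cylinder r T) \<le> emeasure \<mu> branching" if "T \<in> ?I" for T
    using that by (intro emeasure_mono) auto
  then have lt: "emeasure \<mu> (cylinder r T) < \<infinity>" if "T \<in> ?I" for T
    by (rule order.strict_trans1[OF _ fin]) (rule that)
  have "emeasure \<mu> (cylinder r T) \<noteq> \<infinity>" if "T \<in> ?I" for T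
    using lt[OF that] by simp
  moreover have "cylinder r ` ?I \<subseteq> sets \<mu>"
    unfolding sets by (auto intro: borel_open open_cylinder)
  moreover have "disjoint_family_on (cylinder r) ?I"
    by (auto simp: disjoint_family_on_def cylinder_def)
  moreover have "finite ?I" by (simp add: finite_vertex_types)
  ultimately show ?thesis
    unfolding eq by (intro measure_finite_Union) auto
qed

lemma measure_translate:
  assumes "\<mu> \<in> subset_currents" "freely_reduced g" "A \<in> sets borel"
  shows "measure \<mu> (translate g ` A) = measure \<mu> A"
  using assms by (simp add: subset_currents_def measure_def)

text \<open>Invariance under \<open>a\<close> balances the edges leaving along \<open>a\<close> against the edges arriving
  along \<open>a\<close>.\<close>

lemma edge_balance:
  fixes \<mu> :: "('n :: finite) cspace measure"
  assumes "\<mu> \<in> subset_currents" "1 \<le> r" "X \<noteq> {}" "Y \<noteq> {}"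
  shows "(\<Sum>T\<in>{T \<in> vertex_types r. branch_at a T = X \<and> branches_off a T = Y}. measure \<mu> (cylinder r T)) =
    (\<Sum>T\<in>{T \<in> vertex_types r. branch_at (inv_letter a) T = Y \<and> branches_off (inv_letter a) T = X}.
      measure \<mu> (cylinder r T))"
proof -
  have "open (edge_event r a X Y)"
    by (rule open_if_finite_level[of _ r]) (auto simp: edge_event_def)
  then have "measure \<mu> (edge_event r (inv_letter a) Y X) = measure \<mu> (edge_event r a X Y)"
    unfolding translate_edge_event[OF assms(2), symmetric]
    using assms(1) by (intro measure_translate) (auto simp: reduced_Cons)
  then show ?thesis
    using measure_edge_event[OF assms(1,2)] assms(3,4) by simp
qed

subsection \<open>The matched graph\<close>

text \<open>Take \<open>p T\<close> vertices of type \<open>T\<close> and match, for every basis element \<open>x\<close>, the vertices with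
  a branch at \<open>x\<close> with those with a branch at \<open>x\<inverse>\<close> so that both ends of an edge agree on what they
  see of each other.\<close>

locale balanced_weights =
  fixes r :: nat and p :: "('n :: finite) letter list set \<Rightarrow> nat"
  assumes r: "1 \<le> r"
    and balance: "\<And>a X Y. X \<noteq> {} \<Longrightarrow> Y \<noteq> {} \<Longrightarrow>
      (\<Sum>T\<in>{T \<in> vertex_types r. branch_at a T = X \<and> branches_off a T = Y}. p T) =
      (\<Sum>T\<in>{T \<in> vertex_types r. branch_at (inv_letter a) T = Y \<and> branches_off (inv_letter a) T = X}. p T)"
begin

definition verts :: "('n letter list set \<times> nat) set" where
  "verts = (SIGMA T : vertex_types r. {..<p T})"

definition verts_with :: "'n letter \<Rightarrow> ('n letter list set \<times> nat) set" where
  "verts_with a = {v \<in> verts. branch_at a (fst v) \<noteq> {}}"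

lemma finite_verts: "finite verts"
  by (auto simp: verts_def finite_vertex_types)

lemma card_verts: "card {v \<in> verts. Q (fst v)} = (\<Sum>T\<in>{T \<in> vertex_types r. Q T}. p T)"
proof -
  have "{v \<in> verts. Q (fst v)} = (SIGMA T : {T \<in> vertex_types r. Q T}. {..<p T})"
    by (auto simp: verts_def)
  then show ?thesis by (simp add: finite_vertex_types)
qed

lemma ex_matching:
  "\<exists>\<phi>. bij_betw \<phi> (verts_with a) (verts_with (inv_letter a)) \<and>
    (\<forall>v\<in>verts_with a. branches_off (inv_letter a) (fst (\<phi> v)) = branch_at a (fst v) \<and>
       branch_at (inv_letter a) (fst (\<phi> v)) = branches_off a (fst v))"
proof -
  let ?f = "\<lambda>v. (branch_at a (fst v), branches_off a (fst v))"
  let ?g = "\<lambda>v. (branches_off (inv_letter a) (fst v), branch_at (inv_letter a) (fst v))"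
  have card: "card {v \<in> verts_with a. ?f v = y} = card {v \<in> verts_with (inv_letter a). ?g v = y}" for y
  proof -
    obtain X Y where y: "y = (X, Y)" by (cases y)
    show ?thesis
    proof (cases "X = {} \<or> Y = {}")
      case True
      have "{v \<in> verts_with a. ?f v = y} = {}" "{v \<in> verts_with (inv_letter a). ?g v = y} = {}"
        using True branches_off_nonempty[OF r, of _ a] branches_off_nonempty[OF r, of _ "inv_letter a"]
        by (auto simp: y verts_with_def verts_def)
      then show ?thesis by (simp only: card.empty)
    next
      case False
      have "{v \<in> verts_with a. ?f v = y} =
          {v \<in> verts. branch_at a (fst v) = X \<and> branches_off a (fst v) = Y}"
        using False by (auto simp: y verts_with_def)
      moreover have "{v \<in> verts_with (inv_letter a). ?g v = y} =
          {v \<in> verts. branch_at (inv_letter a) (fst v) = Y \<and> branches_off (inv_letter a) (fst v) = X}"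
        using False by (auto simp: y verts_with_def)
      ultimately show ?thesis
        using False balance[of X Y a] card_verts[of "\<lambda>T. branch_at a T = X \<and> branches_off a T = Y"]
          card_verts[of "\<lambda>T. branch_at (inv_letter a) T = Y \<and> branches_off (inv_letter a) T = X"] by simp
    qed
  qed
  have "finite (verts_with b)" for b using finite_verts by (simp add: verts_with_def)
  from label_preserving_bijection[of "verts_with a" "verts_with (inv_letter a)" ?f ?g, OF this this card]
  obtain \<phi> where "bij_betw \<phi> (verts_with a) (verts_with (inv_letter a))"
    "\<And>v. v \<in> verts_with a \<Longrightarrow> ?g (\<phi> v) = ?f v" by blast
  then show ?thesis by (intro exI[of _ \<phi>]) simp
qed

definition matching :: "'n \<Rightarrow> 'n letter list set \<times> nat \<Rightarrow> 'n letter list set \<times> nat" where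
  "matching x = (SOME \<phi>. bij_betw \<phi> (verts_with (x, True)) (verts_with (inv_letter (x, True))) \<and>
    (\<forall>v\<in>verts_with (x, True).
       branches_off (inv_letter (x, True)) (fst (\<phi> v)) = branch_at (x, True) (fst v) \<and>
       branch_at (inv_letter (x, True)) (fst (\<phi> v)) = branches_off (x, True) (fst v)))"

lemma matching:
  "bij_betw (matching x) (verts_with (x, True)) (verts_with (x, False))"
  "v \<in> verts_with (x, True) \<Longrightarrow> branches_off (x, False) (fst (matching x v)) = branch_at (x, True) (fst v)"
  "v \<in> verts_with (x, True) \<Longrightarrow> branch_at (x, False) (fst (matching x v)) = branches_off (x, True) (fst v)"
  using someI_ex[OF ex_matching[of "(x, True)"], folded matching_def]
  by (auto simp: inv_letter_def)

definition matched_edges :: "(('n letter list set \<times> nat) \<times> 'n \<times> ('n letter list set \<times> nat)) set" where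
  "matched_edges = {(v, x, matching x v) | v x. v \<in> verts_with (x, True)}"

lemma step_matched:
  assumes "step matched_edges u a v"
  shows "u \<in> verts_with a" "v \<in> verts"
    "branches_off (inv_letter a) (fst v) = branch_at a (fst u)"
    "branch_at (inv_letter a) (fst v) = branches_off a (fst u)"
proof -
  obtain x b where a: "a = (x, b)" by (cases a)
  have "u \<in> verts_with a \<and> v \<in> verts \<and>
    branches_off (inv_letter a) (fst v) = branch_at a (fst u) \<and>
    branch_at (inv_letter a) (fst v) = branches_off a (fst u)"
  proof (cases b)
    case True
    then have "u \<in> verts_with (x, True)" "v = matching x u"
      using assms by (auto simp: step_def a matched_edges_def)
    then show ?thesis
      using True matching(2,3)[of u x] bij_betwE[OF matching(1)[of x]]
      by (auto simp: a inv_letter_def verts_with_def)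
  next
    case False
    then have "v \<in> verts_with (x, True)" "u = matching x v"
      using assms by (auto simp: step_def a matched_edges_def)
    then show ?thesis
      using False matching(2,3)[of v x] bij_betwE[OF matching(1)[of x]]
      by (auto simp: a inv_letter_def verts_with_def)
  qed
  then show "u \<in> verts_with a" "v \<in> verts"
    "branches_off (inv_letter a) (fst v) = branch_at a (fst u)"
    "branch_at (inv_letter a) (fst v) = branches_off a (fst u)" by blast+
qed

lemma ex_step_matched:
  assumes "v \<in> verts_with a"
  shows "\<exists>u. step matched_edges v a u"
proof -
  obtain x b where a: "a = (x, b)" by (cases a)
  show ?thesis
  proof (cases b)
    case True
    then show ?thesis using assms by (auto simp: step_def a matched_edges_def)
  next
    case False
    then have "v \<in> matching x ` verts_with (x, True)"
      using assms bij_betw_imp_surj_on[OF matching(1)[of x]] by (simp add: a)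
    then show ?thesis using False by (auto simp: step_def a matched_edges_def)
  qed
qed

sublocale matched: folded_graph verts matched_edges
proof
  show "finite verts" by (rule finite_verts)
  show "matched_edges \<subseteq> verts \<times> UNIV \<times> verts"
  proof
    fix e assume e: "e \<in> matched_edges"
    obtain u x v where uxv: "e = (u, x, v)" by (cases e)
    then have "step matched_edges u (x, True) v" using e by (simp add: step_def)
    from step_matched(1,2)[OF this] show "e \<in> verts \<times> UNIV \<times> verts"
      by (simp add: uxv verts_with_def)
  qed
  show "v = v'" if "(u, x, v) \<in> matched_edges" "(u, x, v') \<in> matched_edges" for u x v v'
    using that by (auto simp: matched_edges_def)
  show "u = u'" if "(u, x, v) \<in> matched_edges" "(u', x, v) \<in> matched_edges" for u x v u'
    using that bij_betw_imp_inj_on[OF matching(1)[of x]] by (auto simp: matched_edges_def inj_on_def)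
  show "\<exists>a b u u'. a \<noteq> b \<and> step matched_edges v a u \<and> step matched_edges v b u'" if v: "v \<in> verts" for v
  proof -
    have "fst v \<in> vertex_types r" using v by (auto simp: verts_def)
    then obtain u w where uw: "u \<in> fst v" "w \<in> fst v" "hd u \<noteq> hd w" by (rule two_first_letters[OF r])
    then have "v \<in> verts_with (hd u)" "v \<in> verts_with (hd w)"
      using v by (auto simp: verts_with_def branch_at_def)
    then obtain z z' where "step matched_edges v (hd u) z" "step matched_edges v (hd w) z'"
      using ex_step_matched by metis
    with uw(3) show ?thesis by blast
  qed
qed

text \<open>Agreement along single edges propagates to the whole ball: by induction on \<open>k\<close>, the words of
  length \<open>k\<close> that can be read at a vertex are those prescribed by its type.\<close>

lemma readable_words_matched:
  assumes "k \<le> r" "v \<in> verts"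
  shows "{w. length w = k \<and> freely_reduced w \<and> (\<exists>u. walk matched_edges v w u)} = take k ` fst v"
  using assms
proof (induction k arbitrary: v)
  case 0
  then have "fst v \<in> vertex_types r" by (auto simp: verts_def)
  then have "fst v \<noteq> {}" using two_first_letters[OF r] by blast
  then show ?case by auto
next
  case (Suc k)
  have type: "fst u \<in> vertex_types r" if "u \<in> verts" for u using that by (auto simp: verts_def)
  have word: "length w = r" "freely_reduced w" "w \<noteq> []" if "u \<in> verts" "w \<in> fst u" for u w
    using vertex_types_word[OF type[OF that(1)] that(2)] r by auto
  have IH: "{w. length w = k \<and> freely_reduced w \<and> (\<exists>z. walk matched_edges u w z)} = take k ` fst u"
    if "u \<in> verts" for u using Suc that by simp
  show ?case
  proof (rule subset_antisym; rule subsetI)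
    fix w assume "w \<in> {w. length w = Suc k \<and> freely_reduced w \<and> (\<exists>u. walk matched_edges v w u)}"
    then obtain a w' z where w: "w = a # w'" "length w' = k" "freely_reduced (a # w')" "walk matched_edges v w z"
      by (cases w) auto
    then obtain v' where v': "step matched_edges v a v'" "walk matched_edges v' w' z" by auto
    note st = step_matched[OF v'(1)]
    have "w' \<in> take k ` fst v'"
      unfolding IH[OF st(2), symmetric] using w v'(2) by (auto simp: reduced_Cons)
    then obtain u' where u': "u' \<in> fst v'" "w' = take k u'" by blast
    show "w \<in> take (Suc k) ` fst v"
    proof (cases k)
      case 0
      obtain u where "u \<in> fst v" "hd u = a"
        using st(1) by (auto simp: verts_with_def branch_at_def)
      then have "w = take (Suc k) u" using w word(3)[OF Suc.prems(2)] 0 by (cases u) auto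
      then show ?thesis using \<open>u \<in> fst v\<close> by blast
    next
      case (Suc j)
      then have "hd u' = hd w'" "w' \<noteq> []" using u' w(2) word[OF st(2) u'(1)] by (cases u'; auto)+
      then have "hd u' \<noteq> inv_letter a" using w(3) by (simp add: reduced_Cons)
      then have "butlast u' \<in> branch_at a (fst v)"
        using u'(1) unfolding st(3)[symmetric] by (auto simp: branches_off_def)
      then obtain u where u: "u \<in> fst v" "hd u = a" "tl u = butlast u'" by (auto simp: branch_at_def)
      have "take k (butlast u') = take k u'"
        using word(1)[OF st(2) u'(1)] Suc.prems(1) by (simp add: take_butlast)
      then have "take (Suc k) u = a # w'"
        using u u'(2) word(3)[OF Suc.prems(2) u(1)] by (cases u) auto
      then show ?thesis using u(1) w(1) by (metis imageI)
    qed
  next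
    fix w assume "w \<in> take (Suc k) ` fst v"
    then obtain u where u: "u \<in> fst v" "w = take (Suc k) u" by blast
    have w: "w = hd u # take k (tl u)" using u word(3)[OF Suc.prems(2) u(1)] by (cases u) auto
    have tl: "tl u \<in> branch_at (hd u) (fst v)" using u(1) by (auto simp: branch_at_def)
    then have "v \<in> verts_with (hd u)" using Suc.prems(2) by (auto simp: verts_with_def)
    then obtain v' where v': "step matched_edges v (hd u) v'" using ex_step_matched by blast
    note st = step_matched[OF v']
    obtain u' where u': "u' \<in> fst v'" "tl u = butlast u'"
      using tl unfolding st(3)[symmetric] by (auto simp: branches_off_def)
    have "take k (tl u) = take k u'"
      using word(1)[OF st(2) u'(1)] Suc.prems(1) by (simp add: u'(2) take_butlast)
    then have "take k (tl u) \<in> take k ` fst v'" using u'(1) by blast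
    then obtain z where "walk matched_edges v' (take k (tl u)) z"
      unfolding IH[OF st(2), symmetric] by blast
    then have "walk matched_edges v w z" using v' w by auto
    moreover have "freely_reduced w" "length w = Suc k"
      using u(2) word[OF Suc.prems(2) u(1)] Suc.prems(1) by (simp_all add: reduced_take)
    ultimately show "w \<in> {w. length w = Suc k \<and> freely_reduced w \<and> (\<exists>u. walk matched_edges v w u)}" by blast
  qed
qed

lemma initial_words_matched:
  assumes "v \<in> verts"
  shows "initial_words r (ray_set matched_edges v) = fst v"
proof -
  have "fst v \<in> vertex_types r" using assms by (auto simp: verts_def)
  then have "take r ` fst v = (\<lambda>w. w) ` fst v"
    by (intro image_cong refl) (simp add: vertex_types_word)
  then show ?thesis
    unfolding matched.initial_words_ray_set[OF assms] readable_words_matched[OF order_refl assms] by simp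
qed

lemma card_matched:
  assumes "T \<in> vertex_types r"
  shows "card {v \<in> verts. initial_words r (ray_set matched_edges v) = T} = p T"
proof -
  have "{v \<in> verts. initial_words r (ray_set matched_edges v) = T} = {v \<in> verts. fst v = T}"
    using initial_words_matched by auto
  also have "card \<dots> = (\<Sum>T\<in>{T' \<in> vertex_types r. T' = T}. p T)" by (rule card_verts)
  also have "{T' \<in> vertex_types r. T' = T} = {T}" using assms by auto
  finally show ?thesis by simp
qed

end

text \<open>The weights come from integers near a common multiple of the measures of the cylinders, which
  satisfy the balance equations by invariance.\<close>

lemma graph_approximating_current:
  fixes \<mu> :: "('n :: finite) cspace measure"
  assumes \<mu>: "\<mu> \<in> subset_currents" and r: "1 \<le> r" and "0 < \<epsilon>"
  obtains V and E :: "(('n letter list set \<times> nat) \<times> 'n \<times> ('n letter list set \<times> nat)) set" and c :: real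
  where "folded_graph V E" "0 \<le> c"
    "\<And>T. T \<in> vertex_types r \<Longrightarrow>
      \<bar>measure \<mu> (cylinder r T) - c * real (card {v \<in> V. initial_words r (ray_set E v) = T})\<bar> < \<epsilon>"
proof -
  obtain q p where qp: "0 < q"
    "\<And>T. T \<in> vertex_types r \<Longrightarrow> \<bar>measure \<mu> (cylinder r T) - real (p T) / real q\<bar> < \<epsilon>"
    "\<And>A B. A \<subseteq> vertex_types r \<Longrightarrow> B \<subseteq> vertex_types r \<Longrightarrow>
       (\<Sum>T\<in>A. measure \<mu> (cylinder r T)) = (\<Sum>T\<in>B. measure \<mu> (cylinder r T)) \<Longrightarrow> (\<Sum>T\<in>A. p T) = (\<Sum>T\<in>B. p T)"
    by (rule simultaneous_integer_approximation[OF finite_vertex_types[of r] _ \<open>0 < \<epsilon>\<close>,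
          of "\<lambda>T. measure \<mu> (cylinder r T)"]) (use that in auto)
  interpret balanced_weights r p
  proof
    show "(\<Sum>T\<in>{T \<in> vertex_types r. branch_at a T = X \<and> branches_off a T = Y}. p T) =
      (\<Sum>T\<in>{T \<in> vertex_types r. branch_at (inv_letter a) T = Y \<and> branches_off (inv_letter a) T = X}. p T)"
      if "X \<noteq> {}" "Y \<noteq> {}" for a X Y
      by (rule qp(3)) (use edge_balance[OF \<mu> r that] in auto)
  qed (rule r)
  show thesis
  proof (rule that[of verts matched_edges "1 / real q"])
    show "folded_graph verts matched_edges" by (rule matched.folded_graph_axioms)
    fix T :: "'n letter list set" assume "T \<in> vertex_types r"
    then show "\<bar>measure \<mu> (cylinder r T)
        - 1 / real q * real (card {v \<in> verts. initial_words r (ray_set matched_edges v) = T})\<bar> < \<epsilon>"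
      using qp(2)[of T] by (simp add: card_matched)
  qed simp
qed

section \<open>Connecting the components\<close>

lemma step_mono: "E \<subseteq> F \<Longrightarrow> step E u a v \<Longrightarrow> step F u a v"
  by (auto simp: step_def split: if_splits)

lemma walk_avoiding:
  assumes "walk E u w v" "\<And>s a t. \<exists>w. walk E u w s \<Longrightarrow> step E s a t \<Longrightarrow> step F s a t"
  shows "walk F u w v"
  using assms
proof (induction w arbitrary: u)
  case (Cons a w)
  then obtain z where z: "step E u a z" "walk E z w v" by auto
  have "walk F z w v"
  proof (rule Cons.IH[OF z(2)])
    fix s b t assume "\<exists>w. walk E z w s" "step E s b t"
    then obtain w' where "walk E z w' s" by blast
    then have "walk E u (a # w') s" using z(1) by auto
    then show "step F s b t" using Cons.prems(2) \<open>step E s b t\<close> by blast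
  qed
  moreover have "step F u a z" using Cons.prems(2)[of u a z] z(1) by (metis walk.simps(1))
  ultimately show ?case by auto
qed simp

lemma walk_not_avoiding:
  assumes "walk E u w v" "\<not> walk F u w v"
  obtains x b y s t where "w = x @ b # y" "walk E u x s" "step E s b t" "\<not> step F s b t"
proof -
  have "\<exists>x b y s t. w = x @ b # y \<and> walk E u x s \<and> step E s b t \<and> \<not> step F s b t"
    using assms
  proof (induction w arbitrary: u)
    case (Cons a w)
    then obtain z where z: "step E u a z" "walk E z w v" by auto
    show ?case
    proof (cases "step F u a z")
      case True
      then have "\<not> walk F z w v" using Cons.prems by auto
      then obtain x b y s t where "w = x @ b # y" "walk E z x s" "step E s b t" "\<not> step F s b t"
        using Cons.IH[OF z(2)] by blast
      then show ?thesis using z(1)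
        by (intro exI[of _ "a # x"] exI[of _ b] exI[of _ y] exI[of _ s] exI[of _ t]) auto
    next
      case False
      then show ?thesis using z
        by (intro exI[of _ "[]"] exI[of _ a] exI[of _ w] exI[of _ u] exI[of _ z]) auto
    qed
  qed simp
  then show thesis using that by blast
qed

definition linked :: "('v \<times> 'n \<times> 'v) set \<Rightarrow> 'v \<Rightarrow> 'v \<Rightarrow> bool" where
  "linked E u v \<longleftrightarrow> (\<exists>w. walk E u w v)"

lemma linked_refl: "linked E u u"
  unfolding linked_def by (metis walk.simps(1))

lemma linked_sym: "linked E u v \<Longrightarrow> linked E v u"
  unfolding linked_def using walk_word_inverse by metis

lemma linked_trans: "linked E u v \<Longrightarrow> linked E v z \<Longrightarrow> linked E u z"
  unfolding linked_def using walk_append by metis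

lemma linked_step: "step E u a v \<Longrightarrow> linked E u v"
  unfolding linked_def by (metis walk.simps)

lemma linked_edge: "(u, x, v) \<in> E \<Longrightarrow> linked E u v"
  by (rule linked_step[of _ _ "(x, True)"]) (simp add: step_def)

lemma linked_mono_if_steps:
  assumes "linked E u v" "\<And>s a t. step E s a t \<Longrightarrow> linked F s t"
  shows "linked F u v"
proof -
  obtain w where "walk E u w v" using assms(1) by (auto simp: linked_def)
  then show ?thesis
  proof (induction w arbitrary: u)
    case Nil
    then show ?case by (simp add: linked_refl)
  next
    case (Cons a w)
    then obtain z where "step E u a z" "walk E z w v" by auto
    then show ?case using Cons.IH assms(2) linked_trans by metis
  qed
qed

text \<open>A shortest reduced loop does not use its first edge a second time: a second traversal in the same
  direction closes up a shorter loop after the first edge, one in the opposite direction before the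
  second traversal.  Hence the first edge is not a bridge.\<close>

lemma (in folded_graph) ex_nonbridge:
  assumes "v \<in> V"
  shows "\<exists>s x t. (s, x, t) \<in> E \<and> linked E v s \<and> linked (E - {(s, x, t)}) t s"
proof -
  define P where "P w \<longleftrightarrow> freely_reduced w \<and> w \<noteq> [] \<and> (\<exists>u. linked E v u \<and> walk E u w u)" for w
  have "\<exists>w. P w"
  proof -
    obtain a u where "step E v a u" using no_leaf[OF assms] by blast
    then have "freely_reduced [a]" "walk E v [a] u" by (auto simp: reduced_Cons)
    then obtain m where "freely_reduced ([a] @ m)" "walk E v ([a] @ m) v"
      using reduced_walk_extends_to_loop[of "[a]" v u] by blast
    then have "P (a # m)" unfolding P_def using linked_refl[of E v] by (intro conjI exI[of _ v]) simp_all
    then show ?thesis by blast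
  qed
  then obtain w where w: "P w" and min: "\<And>w'. P w' \<Longrightarrow> length w \<le> length w'"
    using exists_least_lemma[of "\<lambda>n. \<exists>w. P w \<and> length w = n"] by (metis not_le leI ex_has_least_nat)
  obtain u where u: "linked E v u" "walk E u w u" and red: "freely_reduced w" and "w \<noteq> []"
    using w by (auto simp: P_def)
  then obtain a w' where aw: "w = a # w'" by (cases w) auto
  then obtain z where z: "step E u a z" "walk E z w' u" using u by auto
  define e where "e = (if snd a then (u, fst a, z) else (z, fst a, u))"
  have eE: "e \<in> E" using z(1) by (auto simp: e_def step_def)
  have lz: "linked E v z" using u(1) linked_step[OF z(1)] linked_trans by metis
  have "walk (E - {e}) z w' u"
  proof (rule ccontr)
    assume "\<not> walk (E - {e}) z w' u"
    then obtain x b y s t where d: "w' = x @ b # y" "walk E z x s" "step E s b t" "\<not> step (E - {e}) s b t"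
      by (rule walk_not_avoiding[OF z(2)])
    then have "(s, b, t) = (u, a, z) \<or> (s, b, t) = (z, inv_letter a, u)"
      by (cases a; cases b) (auto simp: step_def e_def inv_letter_def split: if_splits)
    then show False
    proof
      assume "(s, b, t) = (u, a, z)"
      then have "walk E u (a # x) u" using d z by auto
      moreover have "freely_reduced (a # x)"
        using red reduced_append[of "a # x" "b # y"] by (simp add: aw d)
      ultimately have "P (a # x)" unfolding P_def using u(1) by auto
      from min[OF this] show False by (simp add: aw d)
    next
      assume eq: "(s, b, t) = (z, inv_letter a, u)"
      have "x \<noteq> []" using red eq by (auto simp: aw d reduced_Cons)
      moreover have "freely_reduced x"
        using red unfolding aw d reduced_Cons[of a] reduced_append by blast
      ultimately have "P x" unfolding P_def using d(2) eq lz by blast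
      from min[OF this] show False by (simp add: aw d)
    qed
  qed
  then have "linked (E - {e}) z u" by (auto simp: linked_def)
  then show ?thesis
    using eE u(1) lz linked_sym[of "E - {e}" z u] unfolding e_def by (cases "snd a") auto
qed

text \<open>One edge which is not a bridge is chosen in every component.  The components do not interfere, so
  all these edges can be deleted at once.\<close>

lemma (in folded_graph) ex_cut_edges:
  obtains D where "D \<subseteq> E" "\<And>s x t. (s, x, t) \<in> D \<Longrightarrow> linked (E - D) t s"
    "\<And>v. v \<in> V \<Longrightarrow> \<exists>s x t. (s, x, t) \<in> D \<and> linked (E - D) v s"
proof -
  define C where "C v = {u. linked E v u}" for v
  have C_eq: "C u = C v \<longleftrightarrow> linked E u v" for u v
    unfolding C_def using linked_refl linked_sym linked_trans by (metis (no_types, lifting) Collect_cong mem_Collect_eq)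
  define good where "good K e \<longleftrightarrow> e \<in> E \<and> C (fst e) = K \<and> linked (E - {e}) (snd (snd e)) (fst e)" for K e
  define ec where "ec K = (SOME e. good K e)" for K
  have ec: "good (C v) (ec (C v))" if v: "v \<in> V" for v
  proof -
    obtain s x t where sxt: "(s, x, t) \<in> E" "linked E v s" "linked (E - {(s, x, t)}) t s"
      using ex_nonbridge[OF v] by blast
    then have "good (C v) (s, x, t)" unfolding good_def using iffD2[OF C_eq linked_sym[OF sxt(2)]] by simp
    then show ?thesis unfolding ec_def by (rule someI)
  qed
  define D where "D = ec ` C ` V"
  have D_good: "good (C (fst d)) d" if "d \<in> D" for d
    using that ec by (auto simp: D_def good_def)
  have D_unique: "d = d'" if dd: "d \<in> D" "d' \<in> D" "linked E (fst d) (fst d')" for d d'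
  proof -
    obtain v v' where v: "v \<in> V" "d = ec (C v)" "v' \<in> V" "d' = ec (C v')"
      using dd(1,2) unfolding D_def by blast
    have "C v = C (fst d)" "C v' = C (fst d')" using ec v by (auto simp: good_def)
    moreover have "C (fst d) = C (fst d')" using iffD2[OF C_eq dd(3)] .
    ultimately show ?thesis using v by simp
  qed
  have sub: "D \<subseteq> E" using D_good by (auto simp: good_def)
  have cut: "linked (E - D) t s" if d: "(s, x, t) \<in> D" for s x t
  proof -
    let ?d = "(s, x, t)"
    obtain w where w: "walk (E - {?d}) t w s"
      using D_good[OF d] by (auto simp: good_def linked_def)
    have "walk (E - D) t w s"
    proof (rule walk_avoiding[OF w])
      fix p a q assume pq: "\<exists>w. walk (E - {?d}) t w p" "step (E - {?d}) p a q"
      have mono: "step E i b j" if "step (E - {?d}) i b j" for i b j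
        by (rule step_mono[OF _ that]) blast
      have "linked (E - {?d}) t p" using pq(1) by (simp add: linked_def)
      then have lp: "linked E t p" by (rule linked_mono_if_steps) (rule linked_step[OF mono])
      have lq: "linked E p q" using linked_step[OF mono[OF pq(2)]] .
      have ls: "linked E s t" by (rule linked_edge[OF subsetD[OF sub d]])
      define e where "e = (if snd a then (p, fst a, q) else (q, fst a, p))"
      have "e \<in> E - {?d}" using pq(2) by (auto simp: e_def step_def)
      moreover have "e \<notin> D"
      proof
        assume "e \<in> D"
        have "linked E s p" using ls lp by (rule linked_trans)
        moreover have "linked E s q" using calculation lq by (rule linked_trans)
        ultimately have "linked E (fst ?d) (fst e)" by (simp add: e_def)
        then have "?d = e" by (rule D_unique[OF d \<open>e \<in> D\<close>])
        with \<open>e \<in> E - {?d}\<close> show False by blast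
      qed
      ultimately have "e \<in> E - D" by blast
      then show "step (E - D) p a q" unfolding step_def e_def by (auto split: if_splits)
    qed
    then show ?thesis by (auto simp: linked_def)
  qed
  have steps: "linked (E - D) s t" if "step E s a t" for s a t
  proof (cases "step (E - D) s a t")
    case True
    then show ?thesis by (rule linked_step)
  next
    case False
    then have "(s, fst a, t) \<in> D \<or> (t, fst a, s) \<in> D"
      using that by (auto simp: step_def split: if_splits)
    then show ?thesis using cut linked_sym by metis
  qed
  have "\<exists>s x t. (s, x, t) \<in> D \<and> linked (E - D) v s" if v: "v \<in> V" for v
  proof -
    obtain s x t where d: "ec (C v) = (s, x, t)" by (cases "ec (C v)")
    then have "(s, x, t) \<in> D" using v unfolding D_def by (metis imageI)
    moreover have "linked E v s" using ec[OF v] C_eq[of s v] linked_sym by (auto simp: good_def d)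
    then have "linked (E - D) v s" by (rule linked_mono_if_steps) (rule steps)
    ultimately show ?thesis by blast
  qed
  then show thesis by (intro that[OF sub]) (use cut in auto)
qed

text \<open>The cyclic order in which the components will be joined to a ring.\<close>

lemma ex_cyclic_permutation:
  assumes "finite D" "D \<noteq> {}"
  obtains \<nu> where "bij_betw \<nu> D D" "\<And>d d'. d \<in> D \<Longrightarrow> d' \<in> D \<Longrightarrow> \<exists>n. (\<nu> ^^ n) d = d'"
proof -
  define k where "k = card D"
  have k: "0 < k" using assms by (simp add: k_def card_gt_0_iff)
  obtain h where h: "bij_betw h {..<k} D"
    using ex_bij_betw_nat_finite[OF assms(1)] by (auto simp: k_def lessThan_atLeast0)
  define g where "g = inv_into {..<k} h"
  have gh: "g (h i) = i" if "i < k" for i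
    using that h by (simp add: g_def bij_betw_inv_into_left)
  have hg: "h (g d) = d" "g d < k" if "d \<in> D" for d
    using that h bij_betwE[OF bij_betw_inv_into[OF h]] by (auto simp: g_def bij_betw_inv_into_right)
  have hD: "h i \<in> D" if "i < k" for i using that bij_betwE[OF h] by simp
  define \<nu> where "\<nu> d = h (Suc (g d) mod k)" for d
  have pow: "(\<nu> ^^ n) (h i) = h ((i + n) mod k)" if "i < k" for n i
    using that k by (induction n) (auto simp: \<nu>_def gh mod_Suc_eq)
  have reach: "\<exists>n. (\<nu> ^^ n) d = d'" if "d \<in> D" "d' \<in> D" for d d'
  proof -
    have "(\<nu> ^^ (k - g d + g d')) (h (g d)) = h ((g d + (k - g d + g d')) mod k)"
      using hg that by (intro pow) auto
    also have "g d + (k - g d + g d') = k + g d'" using hg(2)[OF that(1)] by simp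
    also have "h ((k + g d') mod k) = d'" using hg[OF that(2)] by simp
    finally show ?thesis using hg(1)[OF that(1)] by metis
  qed
  have \<nu>D: "\<nu> ` D \<subseteq> D" using hD k by (auto simp: \<nu>_def)
  have "D \<subseteq> \<nu> ` D"
  proof
    fix d assume d: "d \<in> D"
    have "(\<nu> ^^ n) d' \<in> D" if "d' \<in> D" for n d' using that \<nu>D by (induction n) auto
    moreover obtain n where "(\<nu> ^^ n) (\<nu> d) = d" using reach[of "\<nu> d" d] d \<nu>D by blast
    then have "\<nu> ((\<nu> ^^ n) d) = d" by (simp add: funpow_swap1)
    ultimately show "d \<in> \<nu> ` D" using d by (metis imageI)
  qed
  then have surj: "\<nu> ` D = D" using \<nu>D by blast
  then have "bij_betw \<nu> D D"
    using assms(1) by (simp add: bij_betw_def eq_card_imp_inj_on)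
  then show thesis using that reach by blast
qed

text \<open>\<open>M\<close> copies of the graph, in which every cut edge leads from each copy to the next one.  The last
  copy of a cut edge is joined to the first copy of the next cut edge, in a cyclic order \<open>\<nu>\<close>,
  through an additional vertex.  Both edges at that vertex are traversed in the positive direction,
  so their labels may coincide.\<close>

definition ring_verts :: "'v set \<Rightarrow> ('v \<times> 'n \<times> 'v) set \<Rightarrow> nat \<Rightarrow> ('v \<times> nat + 'v \<times> 'n \<times> 'v) set" where
  "ring_verts V D M = Inl ` (V \<times> {..<M}) \<union> Inr ` D"

fun ring_edge ::
  "('v \<times> 'n \<times> 'v) set \<Rightarrow> ('v \<times> 'n \<times> 'v) set \<Rightarrow> ('v \<times> 'n \<times> 'v \<Rightarrow> 'v \<times> 'n \<times> 'v) \<Rightarrow> nat \<Rightarrow>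
    'v \<times> nat + 'v \<times> 'n \<times> 'v \<Rightarrow> 'n \<Rightarrow> 'v \<times> nat + 'v \<times> 'n \<times> 'v \<Rightarrow> bool" where
  "ring_edge E D \<nu> M (Inl (u, i)) x (Inl (v, j)) \<longleftrightarrow>
     (u, x, v) \<in> E \<and> i < M \<and> j < M \<and> j = (if (u, x, v) \<in> D then Suc i else i)"
| "ring_edge E D \<nu> M (Inl (u, i)) x (Inr d) \<longleftrightarrow> d \<in> D \<and> Suc i = M \<and> (\<exists>v. d = (u, x, v))"
| "ring_edge E D \<nu> M (Inr d) x (Inl (v, j)) \<longleftrightarrow> d \<in> D \<and> j = 0 \<and> (\<exists>u. \<nu> d = (u, x, v))"
| "ring_edge E D \<nu> M (Inr d) x (Inr d') \<longleftrightarrow> False"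

definition ring_edges ::
  "('v \<times> 'n \<times> 'v) set \<Rightarrow> ('v \<times> 'n \<times> 'v) set \<Rightarrow> ('v \<times> 'n \<times> 'v \<Rightarrow> 'v \<times> 'n \<times> 'v) \<Rightarrow> nat \<Rightarrow>
    (('v \<times> nat + 'v \<times> 'n \<times> 'v) \<times> 'n \<times> ('v \<times> nat + 'v \<times> 'n \<times> 'v)) set" where
  "ring_edges E D \<nu> M = {(y, x, z). ring_edge E D \<nu> M y x z}"

locale ring_graph = folded_graph V E for V :: "'v set" and E :: "('v \<times> 'n :: finite \<times> 'v) set" +
  fixes D :: "('v \<times> 'n \<times> 'v) set" and \<nu> :: "'v \<times> 'n \<times> 'v \<Rightarrow> 'v \<times> 'n \<times> 'v" and M :: nat
  assumes DE: "D \<subseteq> E" and M: "0 < M" and D_nonempty: "D \<noteq> {}"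
    and cut: "(s, x, t) \<in> D \<Longrightarrow> linked (E - D) t s"
    and meet: "v \<in> V \<Longrightarrow> \<exists>s x t. (s, x, t) \<in> D \<and> linked (E - D) v s"
    and perm: "bij_betw \<nu> D D" and cyclic: "d \<in> D \<Longrightarrow> d' \<in> D \<Longrightarrow> \<exists>n. (\<nu> ^^ n) d = d'"
begin

abbreviation "W \<equiv> ring_verts V D M"
abbreviation "F \<equiv> ring_edges E D \<nu> M"

lemma finite_D: "finite D"
proof (rule finite_subset)
  show "D \<subseteq> V \<times> UNIV \<times> V" using DE edges by blast
qed (use finite_V in simp)

lemma perm_in: "d \<in> D \<Longrightarrow> \<nu> d \<in> D"
  using bij_betwE[OF perm] by blast

lemma ring_edges_iff: "(y, x, z) \<in> F \<longleftrightarrow> ring_edge E D \<nu> M y x z"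
  by (simp add: ring_edges_def)

lemma ring_vertex_cases:
  fixes z :: "'v \<times> nat + 'v \<times> 'n \<times> 'v"
  obtains v i where "z = Inl (v, i)" | d where "z = Inr d"
  by (cases z) auto

lemma perm_edge: "d \<in> D \<Longrightarrow> \<nu> d = (u, x, v) \<Longrightarrow> (u, x, v) \<in> D \<and> (u, x, v) \<in> E"
  using perm_in[of d] DE by auto

lemma ring_edges_in_verts: "F \<subseteq> W \<times> UNIV \<times> W"
proof
  fix e assume "e \<in> F"
  moreover obtain y x z where e: "e = (y, x, z)" by (cases e)
  ultimately have yz: "ring_edge E D \<nu> M y x z" by (simp add: ring_edges_iff)
  have ends: "u \<in> V \<and> v \<in> V" if "(u, x, v) \<in> E" for u v using that edges by blast
  have "y \<in> W \<and> z \<in> W"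
  proof (cases rule: ring_vertex_cases[of y])
    case y: (1 u i)
    show ?thesis
      by (cases rule: ring_vertex_cases[of z])
         (use yz y ends M DE in \<open>auto simp: ring_verts_def\<close>)
  next
    case y: (2 d)
    show ?thesis
      by (cases rule: ring_vertex_cases[of z])
         (use yz y ends M perm_edge[of d] in \<open>auto simp: ring_verts_def\<close>)
  qed
  then show "e \<in> W \<times> UNIV \<times> W" by (simp add: e)
qed

lemma ring_edges_det:
  assumes "(z, x, y) \<in> F" "(z, x, y') \<in> F"
  shows "y = y'"
proof (cases rule: ring_vertex_cases[of z])
  case z: (1 u i)
  have mixed: False if m: "ring_edge E D \<nu> M z x (Inl (v, j))" "ring_edge E D \<nu> M z x (Inr d)" for v j d
  proof -
    obtain v' where "d = (u, x, v')" "d \<in> D" "Suc i = M" using m(2) z by auto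
    moreover have "(u, x, v) \<in> E" using m(1) z by simp
    ultimately have "(u, x, v) \<in> D" "Suc i = M" using det DE by blast+
    then show False using m(1) z by auto
  qed
  show ?thesis
  proof (cases rule: ring_vertex_cases[of y]; cases rule: ring_vertex_cases[of y'])
    fix v j v' j' assume "y = Inl (v, j)" "y' = Inl (v', j')"
    moreover from this have "v = v'" using assms z det by (auto simp: ring_edges_iff)
    ultimately show ?thesis using assms z by (auto simp: ring_edges_iff)
  next
    fix d d' assume "y = Inr d" "y' = Inr d'"
    moreover from this obtain v v' where "d = (u, x, v)" "d \<in> D" "d' = (u, x, v')" "d' \<in> D"
      using assms z by (auto simp: ring_edges_iff)
    moreover from this have "v = v'" using det DE by blast
    ultimately show ?thesis by simp
  qed (use assms mixed in \<open>auto simp: ring_edges_iff\<close>)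
next
  case z: (2 d)
  then show ?thesis
    using assms by (cases rule: ring_vertex_cases[of y]; cases rule: ring_vertex_cases[of y'])
      (auto simp: ring_edges_iff)
qed

lemma ring_edges_codet:
  assumes "(y, x, z) \<in> F" "(y', x, z) \<in> F"
  shows "y = y'"
proof (cases rule: ring_vertex_cases[of z])
  case z: (1 v j)
  have mixed: False if m: "ring_edge E D \<nu> M (Inl (u, i)) x z" "ring_edge E D \<nu> M (Inr d) x z" for u i d
  proof -
    obtain u' where "\<nu> d = (u', x, v)" "d \<in> D" "j = 0" using m(2) z by auto
    then have "(u', x, v) \<in> D" "(u', x, v) \<in> E" "j = 0" using perm_edge by blast+
    moreover have "(u, x, v) \<in> E" using m(1) z by simp
    ultimately have "(u, x, v) \<in> D" "j = 0" using codet by blast+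
    then show False using m(1) z by auto
  qed
  show ?thesis
  proof (cases rule: ring_vertex_cases[of y]; cases rule: ring_vertex_cases[of y'])
    fix u i u' i' assume "y = Inl (u, i)" "y' = Inl (u', i')"
    moreover from this have "u = u'" using assms z codet by (auto simp: ring_edges_iff)
    ultimately show ?thesis using assms z by (auto simp: ring_edges_iff split: if_splits)
  next
    fix d d' assume y: "y = Inr d" "y' = Inr d'"
    then obtain u u' where "\<nu> d = (u, x, v)" "d \<in> D" "\<nu> d' = (u', x, v)" "d' \<in> D"
      using assms z by (auto simp: ring_edges_iff)
    moreover from this have "u = u'" using codet perm_edge by blast
    ultimately show ?thesis using bij_betw_imp_inj_on[OF perm] y by (simp add: inj_on_def)
  qed (use assms mixed in \<open>auto simp: ring_edges_iff\<close>)
next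
  case z: (2 d)
  then show ?thesis
    using assms by (cases rule: ring_vertex_cases[of y]; cases rule: ring_vertex_cases[of y'])
      (auto simp: ring_edges_iff)
qed

lemma ring_same: "(u, x, v) \<in> E - D \<Longrightarrow> i < M \<Longrightarrow> (Inl (u, i), x, Inl (v, i)) \<in> F"
  and ring_up: "(u, x, v) \<in> D \<Longrightarrow> Suc i < M \<Longrightarrow> (Inl (u, i), x, Inl (v, Suc i)) \<in> F"
  and ring_leave: "(u, x, v) \<in> D \<Longrightarrow> Suc i = M \<Longrightarrow> (Inl (u, i), x, Inr (u, x, v)) \<in> F"
  and ring_enter: "d \<in> D \<Longrightarrow> \<nu> d = (u, x, v) \<Longrightarrow> (Inr d, x, Inl (v, 0)) \<in> F"
  using DE by (auto simp: ring_edges_iff)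

lemma step_lift:
  assumes "step E v a u" "i < M"
  shows "\<exists>z. step F (Inl (v, i)) a z"
proof (cases "snd a")
  case True
  then have e: "(v, fst a, u) \<in> E" using assms by (simp add: step_def)
  have "\<exists>z. (Inl (v, i), fst a, z) \<in> F"
  proof (cases "(v, fst a, u) \<in> D")
    case D: True
    show ?thesis
    proof (cases "Suc i < M")
      case True
      then show ?thesis using ring_up[OF D] by blast
    next
      case False
      then have "Suc i = M" using assms(2) by simp
      then show ?thesis using ring_leave[OF D] by blast
    qed
  next
    case False
    then have "(v, fst a, u) \<in> E - D" using e by blast
    from ring_same[OF this assms(2)] show ?thesis by blast
  qed
  then show ?thesis using True by (simp add: step_def)
next
  case False
  then have e: "(u, fst a, v) \<in> E" using assms by (simp add: step_def)
  have "\<exists>z. (z, fst a, Inl (v, i)) \<in> F"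
  proof (cases "(u, fst a, v) \<in> D")
    case D: True
    show ?thesis
    proof (cases i)
      case 0
      obtain d where "d \<in> D" "\<nu> d = (u, fst a, v)"
        using D bij_betw_imp_surj_on[OF perm] by (metis imageE)
      from ring_enter[OF this] show ?thesis using 0 by blast
    next
      case (Suc j)
      then show ?thesis using ring_up[OF D, of j] assms(2) by blast
    qed
  next
    case False
    then have "(u, fst a, v) \<in> E - D" using e by blast
    from ring_same[OF this assms(2)] show ?thesis by blast
  qed
  then show ?thesis using False by (simp add: step_def)
qed

sublocale ring: folded_graph W F
proof
  show "finite W" using finite_V finite_D by (simp add: ring_verts_def)
  show "F \<subseteq> W \<times> UNIV \<times> W" by (rule ring_edges_in_verts)
  show "y = y'" if "(z, x, y) \<in> F" "(z, x, y') \<in> F" for z x y y' using that by (rule ring_edges_det)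
  show "y = y'" if "(y, x, z) \<in> F" "(y', x, z) \<in> F" for z x y y' using that by (rule ring_edges_codet)
  show "\<exists>a b u u'. a \<noteq> b \<and> step F z a u \<and> step F z b u'" if zW: "z \<in> W" for z
  proof -
    consider v i where "z = Inl (v, i)" "v \<in> V" "i < M" | d where "z = Inr d" "d \<in> D"
      using zW by (auto simp: ring_verts_def)
    then show ?thesis
    proof cases
      case 1
      obtain a b u u' where ab: "a \<noteq> b" "step E v a u" "step E v b u'" using no_leaf[OF 1(2)] by blast
      obtain y y' where "step F z a y" "step F z b y'"
        using step_lift[OF ab(2) 1(3)] step_lift[OF ab(3) 1(3)] unfolding 1(1) by blast
      then show ?thesis using ab(1) by blast
    next
      case 2
      obtain s x t where d: "d = (s, x, t)" by (cases d)
      obtain s' x' t' where d': "\<nu> d = (s', x', t')" by (cases "\<nu> d")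
      have "(Inl (s, M - 1), x, Inr d) \<in> F"
        using ring_leave[of s x t "M - 1"] 2 M unfolding d by simp
      then have "step F z (x, False) (Inl (s, M - 1))" using 2 by (simp add: step_def)
      moreover have "step F z (x', True) (Inl (t', 0))"
        using ring_enter[OF 2(2) d'] 2 by (simp add: step_def)
      ultimately show ?thesis by blast
    qed
  qed
qed

lemma linked_copy: "linked (E - D) u v \<Longrightarrow> i < M \<Longrightarrow> linked F (Inl (u, i)) (Inl (v, i))"
proof -
  assume "linked (E - D) u v" and i: "i < M"
  then obtain w where "walk (E - D) u w v" by (auto simp: linked_def)
  then show ?thesis
  proof (induction w arbitrary: u)
    case (Cons a w)
    then obtain z where z: "step (E - D) u a z" "walk (E - D) z w v" by auto
    then have "step F (Inl (u, i)) a (Inl (z, i))"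
      using ring_same[OF _ i] by (auto simp: step_def split: if_splits)
    from linked_trans[OF linked_step[OF this] Cons.IH[OF z(2)]] show ?case .
  qed (simp add: linked_refl)
qed

lemma linked_along_line:
  assumes "(s, x, t) \<in> D" "i < M"
  shows "linked F (Inl (s, 0)) (Inl (s, i))"
  using assms(2)
proof (induction i)
  case (Suc i)
  have "linked F (Inl (s, i)) (Inl (t, Suc i))"
    using ring_up[OF assms(1) Suc.prems] by (rule linked_edge)
  moreover have "linked F (Inl (t, Suc i)) (Inl (s, Suc i))"
    using linked_copy[OF cut[OF assms(1)] Suc.prems] .
  ultimately have "linked F (Inl (s, i)) (Inl (s, Suc i))" by (rule linked_trans)
  with Suc.IH[OF Suc_lessD[OF Suc.prems]] show ?case by (rule linked_trans)
qed (rule linked_refl)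

lemma linked_to_link:
  assumes "(s, x, t) \<in> D"
  shows "linked F (Inl (s, 0)) (Inr (s, x, t))"
proof -
  have "linked F (Inl (s, 0)) (Inl (s, M - 1))" using linked_along_line[OF assms] M by simp
  moreover have "linked F (Inl (s, M - 1)) (Inr (s, x, t))"
    by (rule linked_edge[OF ring_leave[OF assms]]) (use M in simp)
  ultimately show ?thesis by (rule linked_trans)
qed

lemma linked_links:
  assumes "d \<in> D" "d' \<in> D"
  shows "linked F (Inr d) (Inr d')"
proof -
  have nxt: "linked F (Inr d) (Inr (\<nu> d))" if d: "d \<in> D" for d
  proof -
    obtain s x t where sxt: "\<nu> d = (s, x, t)" by (cases "\<nu> d")
    then have D: "(s, x, t) \<in> D" using perm_in[OF d] by simp
    have "linked F (Inr d) (Inl (t, 0))" using ring_enter[OF d sxt] by (rule linked_edge)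
    moreover have "linked F (Inl (t, 0)) (Inl (s, 0))" using linked_copy[OF cut[OF D] M] .
    ultimately show ?thesis using linked_to_link[OF D] sxt linked_trans by metis
  qed
  have "(\<nu> ^^ n) d \<in> D \<and> linked F (Inr d) (Inr ((\<nu> ^^ n) d))" for n
  proof (induction n)
    case 0
    then show ?case using assms by (simp add: linked_refl)
  next
    case (Suc n)
    then show ?case using nxt perm_in linked_trans by (metis comp_apply funpow.simps(2))
  qed
  then show ?thesis using cyclic[OF assms] by metis
qed

lemma linked_link:
  assumes "z \<in> W" "d \<in> D"
  shows "linked F z (Inr d)"
proof -
  consider v i where "z = Inl (v, i)" "v \<in> V" "i < M" | d' where "z = Inr d'" "d' \<in> D"
    using assms(1) by (auto simp: ring_verts_def)
  then show ?thesis
  proof cases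
    case 1
    obtain s x t where D: "(s, x, t) \<in> D" "linked (E - D) v s" using meet[OF 1(2)] by blast
    have "linked F z (Inl (s, i))" unfolding 1(1) using linked_copy[OF D(2) 1(3)] .
    moreover have "linked F (Inl (s, i)) (Inl (s, 0))"
      using linked_sym[OF linked_along_line[OF D(1) 1(3)]] .
    ultimately have "linked F z (Inl (s, 0))" by (rule linked_trans)
    from linked_trans[OF this linked_trans[OF linked_to_link[OF D(1)] linked_links[OF D(1) assms(2)]]]
    show ?thesis .
  qed (use linked_links assms in blast)
qed

lemma connected_ring: "d \<in> D \<Longrightarrow> connected_folded_graph W F (Inr d)"
proof (intro connected_folded_graph.intro connected_folded_graph_axioms.intro ring.folded_graph_axioms)
  assume d: "d \<in> D"
  then show "Inr d \<in> W" by (simp add: ring_verts_def)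
  show "\<exists>w. walk F (Inr d) w v" if "v \<in> W" for v
    using linked_sym[OF linked_link[OF that d]] by (simp add: linked_def)
qed

subsection \<open>Balls away from the ends\<close>

lemma step_inside:
  assumes "0 < i" "Suc i < M"
  shows "step F (Inl (v, i)) a z \<Longrightarrow> \<exists>u j. z = Inl (u, j) \<and> step E v a u \<and> i \<le> Suc j \<and> j \<le> Suc i"
    and "step E v a u \<Longrightarrow> \<exists>j. step F (Inl (v, i)) a (Inl (u, j)) \<and> i \<le> Suc j \<and> j \<le> Suc i"
proof -
  have *: "\<exists>u j. z = Inl (u, j) \<and> step E v a u \<and> i \<le> Suc j \<and> j \<le> Suc i"
    if "step F (Inl (v, i)) a z" for z
  proof (cases "snd a")
    case True
    then have "ring_edge E D \<nu> M (Inl (v, i)) (fst a) z" using that by (simp add: step_def ring_edges_iff)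
    then show ?thesis
      by (cases rule: ring_vertex_cases[of z])
         (use assms True in \<open>auto simp: step_def split: if_splits\<close>)
  next
    case False
    then have "ring_edge E D \<nu> M z (fst a) (Inl (v, i))" using that by (simp add: step_def ring_edges_iff)
    then show ?thesis
      by (cases rule: ring_vertex_cases[of z])
         (use assms False in \<open>auto simp: step_def split: if_splits\<close>)
  qed
  show "step F (Inl (v, i)) a z \<Longrightarrow> \<exists>u j. z = Inl (u, j) \<and> step E v a u \<and> i \<le> Suc j \<and> j \<le> Suc i"
    by (rule *)
  show "\<exists>j. step F (Inl (v, i)) a (Inl (u, j)) \<and> i \<le> Suc j \<and> j \<le> Suc i" if st: "step E v a u"
  proof -
    obtain z where z: "step F (Inl (v, i)) a z" using step_lift[OF st, of i] assms by auto
    obtain u' j where "z = Inl (u', j)" "step E v a u'" "i \<le> Suc j" "j \<le> Suc i" using *[OF z] by blast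
    then show ?thesis using z step_det[OF st] by blast
  qed
qed

text \<open>A step changes the number of the copy by at most one, so a walk of length \<open>n\<close> that starts at least
  \<open>n\<close> copies away from both ends cannot notice them.\<close>

lemma readable_inside:
  assumes "length w \<le> i" "i + length w < M"
  shows "(\<exists>z. walk F (Inl (v, i)) w z) \<longleftrightarrow> (\<exists>u. walk E v w u)"
  using assms
proof (induction w arbitrary: v i)
  case (Cons a w)
  have i: "0 < i" "Suc i < M" using Cons.prems by auto
  have IH: "(\<exists>z. walk F (Inl (u, j)) w z) \<longleftrightarrow> (\<exists>u'. walk E u w u')" if "i \<le> Suc j" "j \<le> Suc i" for u j
    using that Cons.prems by (intro Cons.IH) auto
  show ?case
  proof
    assume "\<exists>z. walk F (Inl (v, i)) (a # w) z"
    then obtain y z where "step F (Inl (v, i)) a y" "walk F y w z" by auto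
    moreover from this obtain u j where "y = Inl (u, j)" "step E v a u" "i \<le> Suc j" "j \<le> Suc i"
      using step_inside(1)[OF i] by blast
    moreover from calculation obtain u' where "walk E u w u'" using IH[of j u] by blast
    ultimately show "\<exists>u. walk E v (a # w) u" by auto
  next
    assume "\<exists>u. walk E v (a # w) u"
    then obtain u u' where "step E v a u" "walk E u w u'" by auto
    moreover from this obtain j where "step F (Inl (v, i)) a (Inl (u, j))" "i \<le> Suc j" "j \<le> Suc i"
      using step_inside(2)[OF i] by blast
    moreover from calculation obtain z where "walk F (Inl (u, j)) w z" using IH[of j u] by blast
    ultimately show "\<exists>z. walk F (Inl (v, i)) (a # w) z" by auto
  qed
qed auto

lemma initial_words_inside:
  assumes "v \<in> V" "r \<le> i" "i + r < M"
  shows "initial_words r (ray_set F (Inl (v, i))) = initial_words r (ray_set E v)"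
proof -
  have W: "Inl (v, i) \<in> W" using assms by (auto simp: ring_verts_def)
  show ?thesis
    unfolding ring.initial_words_ray_set[OF W] initial_words_ray_set[OF assms(1)]
    by (intro Collect_cong conj_cong refl readable_inside) (use assms in auto)
qed

text \<open>Only the vertices in the first and last \<open>r\<close> copies and the additional vertices can have new
  balls; their number is independent of \<open>M\<close>.\<close>

lemma card_ring_close:
  assumes "2 * r \<le> M"
  shows "\<bar>real (card {z \<in> W. initial_words r (ray_set F z) = T})
    - real M * real (card {v \<in> V. initial_words r (ray_set E v) = T})\<bar> \<le> real (2 * r * card V + card D)"
proof -
  let ?A = "{v \<in> V. initial_words r (ray_set E v) = T}"
  let ?B = "{z \<in> W. initial_words r (ray_set F z) = T}"
  let ?G = "Inl ` (?A \<times> {r..<M - r}) :: ('v \<times> nat + 'v \<times> 'n \<times> 'v) set"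
  let ?R = "Inl ` (V \<times> ({..<r} \<union> {M - r..<M})) \<union> Inr ` D"
  have finA: "finite ?A" and finB: "finite ?B" using finite_V ring.finite_V by auto
  have cardG: "card ?G = card ?A * (M - 2 * r)"
    by (subst card_image) (auto simp: card_cartesian_product inj_on_def)
  have cardR: "card ?R \<le> 2 * r * card V + card D"
  proof -
    have "card ?R \<le> card (Inl ` (V \<times> ({..<r} \<union> {M - r..<M})) :: ('v \<times> nat + 'v \<times> 'n \<times> 'v) set)
        + card (Inr ` D :: ('v \<times> nat + 'v \<times> 'n \<times> 'v) set)" by (rule card_Un_le)
    also have "\<dots> \<le> card (V \<times> ({..<r} \<union> {M - r..<M})) + card D"
      using finite_V finite_D by (intro add_mono card_image_le) auto
    also have "card (V \<times> ({..<r} \<union> {M - r..<M})) \<le> card V * (2 * r)"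
      using card_Un_le[of "{..<r}" "{M - r..<M}"] assms by (simp add: card_cartesian_product)
    finally show ?thesis by (simp add: mult.commute)
  qed
  have GB: "?G \<subseteq> ?B"
    using initial_words_inside[of _ r] by (auto simp: ring_verts_def)
  have BGR: "?B \<subseteq> ?G \<union> ?R"
    using initial_words_inside[of _ r] by (auto simp: ring_verts_def not_less image_iff)
  have lower: "card ?A * (M - 2 * r) \<le> card ?B" using card_mono[OF finB GB] cardG by simp
  have "card ?B \<le> card (?G \<union> ?R)" using finA finite_V finite_D BGR by (intro card_mono) auto
  also have "\<dots> \<le> card ?G + card ?R" by (rule card_Un_le)
  finally have upper: "card ?B \<le> card ?A * (M - 2 * r) + (2 * r * card V + card D)"
    using cardG cardR by simp
  have A: "card ?A \<le> card V" using finite_V by (intro card_mono) auto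
  have eq: "real (card ?A * (M - 2 * r)) = real M * real (card ?A) - 2 * real r * real (card ?A)"
    using assms by (simp add: of_nat_diff algebra_simps)
  have "2 * real r * real (card ?A) \<le> 2 * real r * real (card V)"
    using A by (intro mult_left_mono) auto
  moreover have "0 \<le> 2 * real r * real (card ?A)" "0 \<le> real (card D)" by simp_all
  moreover have "real M * real (card ?A) - 2 * real r * real (card ?A) \<le> real (card ?B)"
    using of_nat_mono[OF lower, where 'a = real] by (simp only: eq)
  moreover have "real (card ?B) \<le>
      real M * real (card ?A) - 2 * real r * real (card ?A) + (2 * real r * real (card V) + real (card D))"
    using of_nat_mono[OF upper, where 'a = real]
    by (simp only: eq of_nat_add of_nat_mult[of "2 * r"] of_nat_mult[of 2] of_nat_numeral)
  ultimately show ?thesis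
    by (simp only: of_nat_add of_nat_mult[of "2 * r"] of_nat_mult[of 2] of_nat_numeral abs_le_iff) linarith
qed

end

lemma connected_graph_approximating_graph:
  fixes E :: "('v \<times> 'n :: finite \<times> 'v) set"
  assumes "folded_graph V E" "V \<noteq> {}" "0 \<le> c" "0 < \<epsilon>"
  obtains V' and E' :: "(('v \<times> nat + 'v \<times> 'n \<times> 'v) \<times> 'n \<times> ('v \<times> nat + 'v \<times> 'n \<times> 'v)) set" and v0 and c' :: real
  where "connected_folded_graph V' E' v0" "0 \<le> c'"
    "\<And>T. \<bar>c' * real (card {v \<in> V'. initial_words r (ray_set E' v) = T})
       - c * real (card {v \<in> V. initial_words r (ray_set E v) = T})\<bar> < \<epsilon>"
proof -
  interpret folded_graph V E by (rule assms(1))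
  obtain D where D: "D \<subseteq> E" "\<And>s x t. (s, x, t) \<in> D \<Longrightarrow> linked (E - D) t s"
    "\<And>v. v \<in> V \<Longrightarrow> \<exists>s x t. (s, x, t) \<in> D \<and> linked (E - D) v s"
    by (rule ex_cut_edges) blast
  have "D \<noteq> {}" using D(3) assms(2) by blast
  have "finite D"
  proof (rule finite_subset)
    show "D \<subseteq> V \<times> UNIV \<times> V" using D(1) edges by (rule subset_trans)
  qed (use finite_V in simp)
  obtain \<nu> where \<nu>: "bij_betw \<nu> D D" "\<And>d d'. d \<in> D \<Longrightarrow> d' \<in> D \<Longrightarrow> \<exists>n. (\<nu> ^^ n) d = d'"
    using ex_cyclic_permutation[OF \<open>finite D\<close> \<open>D \<noteq> {}\<close>] by blast
  let ?K = "real (2 * r * card V + card D)"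
  obtain M0 :: nat where M0: "c * ?K / \<epsilon> < real M0" using reals_Archimedean2 by blast
  \<comment> \<open>\<open>M0\<close> makes the error \<open>c * ?K / M\<close> smaller than \<open>\<epsilon>\<close>; the rest ensures \<open>2 * r \<le> M\<close> and \<open>0 < M\<close>.\<close>
  define M where "M = M0 + 2 * r + 1"
  interpret ring_graph V E D \<nu> M
    by unfold_locales (use D \<nu> \<open>D \<noteq> {}\<close> in \<open>auto simp: M_def\<close>)
  obtain d where d: "d \<in> D" using \<open>D \<noteq> {}\<close> by blast
  show thesis
  proof (rule that[OF connected_ring[OF d], of "c / real M"])
    show "0 \<le> c / real M" using assms(3) by simp
    fix T
    let ?N' = "real (card {z \<in> W. initial_words r (ray_set F z) = T})"
    let ?N = "real (card {v \<in> V. initial_words r (ray_set E v) = T})"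
    have "c / real M * ?N' - c * ?N = c / real M * (?N' - real M * ?N)"
      using M by (simp add: field_simps)
    then have "\<bar>c / real M * ?N' - c * ?N\<bar> = c / real M * \<bar>?N' - real M * ?N\<bar>"
      using assms(3) by (simp add: abs_mult)
    also have "\<dots> \<le> c / real M * ?K"
      using assms(3) by (intro mult_left_mono card_ring_close) (auto simp: M_def)
    also have "\<dots> < \<epsilon>"
    proof -
      have "c * ?K < real M0 * \<epsilon>" using M0 assms(4) by (simp add: field_simps)
      also have "\<dots> \<le> real M * \<epsilon>" using assms(4) by (intro mult_right_mono) (auto simp: M_def)
      finally show ?thesis using M by (simp add: field_simps)
    qed
    finally show "\<bar>c / real M * ?N' - c * ?N\<bar> < \<epsilon>" .
  qed
qed

section \<open>Approximation of local statistics by rational currents\<close>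

lemma cylinder_vertex_type:
  assumes "1 \<le> r" "T \<in> vertex_types r"
  shows "cylinder r T \<subseteq> branching"
  using assms branching_cong[OF _ assms(1)] by (auto simp: vertex_types_def cylinder_def)

lemma sets_cylinder: "cylinder r T \<in> sets borel"
  by (rule borel_open[OF open_cylinder])

lemma (in connected_folded_graph) rational_current_counting_types:
  assumes "0 \<le> c" "1 \<le> r"
  obtains \<nu> where "\<nu> \<in> rational_subset_currents"
    "\<And>T. T \<in> vertex_types r \<Longrightarrow>
      measure \<nu> (cylinder r T) = c * real (card {v \<in> V. initial_words r (ray_set E v) = T})"
proof -
  obtain \<nu> where \<nu>: "\<nu> \<in> rational_subset_currents"
    "\<And>B. B \<in> sets borel \<Longrightarrow> B \<subseteq> branching \<Longrightarrow> measure \<nu> B = c * real (card {v \<in> V. ray_space E v \<in> B})"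
    using rational_current_of_graph[OF assms(1)] by blast
  have "{v \<in> V. ray_space E v \<in> cylinder r T} = {v \<in> V. initial_words r (ray_set E v) = T}" for T
    by (auto simp: cylinder_def points_ray_space)
  then show thesis
    using \<nu>(2)[OF sets_cylinder cylinder_vertex_type[OF assms(2)]] by (intro that[OF \<nu>(1)]) simp
qed

text \<open>If a current gives little mass to every type, the approximating graph may be empty; then any graph
  with weight zero serves, for example the rose.\<close>

lemma connected_folded_rose:
  "connected_folded_graph {()} (UNIV :: (unit \<times> 'n :: finite \<times> unit) set) ()"
proof
  fix v :: unit and x :: 'n
  show "\<exists>a b u u'. a \<noteq> b \<and> step (UNIV :: (unit \<times> 'n \<times> unit) set) v a u \<and> step UNIV v b u'"
    by (intro exI[of _ "(x, True)"] exI[of _ "(x, False)"] exI[of _ "()"]) (simp add: step_def)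
  show "\<exists>w. walk (UNIV :: (unit \<times> 'n \<times> unit) set) () w v"
    by (intro exI[of _ "[]"]) simp
qed auto

lemma rational_current_close:
  fixes \<mu> :: "('n :: finite) cspace measure"
  assumes \<mu>: "\<mu> \<in> subset_currents" and r: "1 \<le> r" and "0 < \<epsilon>"
  obtains \<nu> where "\<nu> \<in> rational_subset_currents"
    "\<And>T. T \<in> vertex_types r \<Longrightarrow> \<bar>measure \<nu> (cylinder r T) - measure \<mu> (cylinder r T)\<bar> < \<epsilon>"
proof -
  obtain V and E :: "(('n letter list set \<times> nat) \<times> 'n \<times> ('n letter list set \<times> nat)) set" and c :: real
    where E: "folded_graph V E" "0 \<le> c" and close: "\<And>T. T \<in> vertex_types r \<Longrightarrow>
      \<bar>measure \<mu> (cylinder r T) - c * real (card {v \<in> V. initial_words r (ray_set E v) = T})\<bar> < \<epsilon> / 2"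
    using graph_approximating_current[OF \<mu> r, of "\<epsilon> / 2"] \<open>0 < \<epsilon>\<close> by auto
  show thesis
  proof (cases "V = {}")
    case True
    interpret rose: connected_folded_graph "{()}" "UNIV :: (unit \<times> 'n \<times> unit) set" "()"
      by (rule connected_folded_rose)
    obtain \<nu> where \<nu>: "\<nu> \<in> rational_subset_currents"
      "\<And>T. T \<in> vertex_types r \<Longrightarrow> measure \<nu> (cylinder r T)
        = 0 * real (card {v \<in> {()}. initial_words r (ray_set (UNIV :: (unit \<times> 'n \<times> unit) set) v) = T})"
      using rose.rational_current_counting_types[OF order_refl r] by blast
    show thesis
    proof (rule that[OF \<nu>(1)])
      fix T :: "'n letter list set" assume T: "T \<in> vertex_types r"
      show "\<bar>measure \<nu> (cylinder r T) - measure \<mu> (cylinder r T)\<bar> < \<epsilon>"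
        using \<nu>(2)[OF T] close[OF T] True \<open>0 < \<epsilon>\<close> by simp
    qed
  next
    case False
    have half: "0 < \<epsilon> / 2" using \<open>0 < \<epsilon>\<close> by simp
    obtain V' v0 c' and E' :: "((('n letter list set \<times> nat) \<times> nat
          + ('n letter list set \<times> nat) \<times> 'n \<times> ('n letter list set \<times> nat)) \<times> 'n
        \<times> (('n letter list set \<times> nat) \<times> nat
          + ('n letter list set \<times> nat) \<times> 'n \<times> ('n letter list set \<times> nat))) set"
      where E': "connected_folded_graph V' E' v0" "0 \<le> c'"
      "\<And>T. \<bar>c' * real (card {v \<in> V'. initial_words r (ray_set E' v) = T})
         - c * real (card {v \<in> V. initial_words r (ray_set E v) = T})\<bar> < \<epsilon> / 2"
      by (rule connected_graph_approximating_graph[OF E(1) False E(2) half]) (use that in blast)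
    interpret connected_folded_graph V' E' v0 by (rule E'(1))
    obtain \<nu> where \<nu>: "\<nu> \<in> rational_subset_currents"
      "\<And>T. T \<in> vertex_types r \<Longrightarrow> measure \<nu> (cylinder r T)
        = c' * real (card {v \<in> V'. initial_words r (ray_set E' v) = T})"
      using rational_current_counting_types[OF E'(2) r] by blast
    show thesis
    proof (rule that[OF \<nu>(1)])
      fix T :: "'n letter list set" assume T: "T \<in> vertex_types r"
      show "\<bar>measure \<nu> (cylinder r T) - measure \<mu> (cylinder r T)\<bar> < \<epsilon>"
        using \<nu>(2)[OF T] close[OF T] E'(3)[of T] by linarith
    qed
  qed
qed

section \<open>Local statistics determine the weak topology\<close>

lemma sets_subset_current: "\<mu> \<in> subset_currents \<Longrightarrow> sets \<mu> = sets borel"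
  by (simp add: subset_currents_def)

lemma emeasure_compact_finite:
  "\<mu> \<in> subset_currents \<Longrightarrow> compact K \<Longrightarrow> emeasure \<mu> K < \<infinity>"
  by (simp add: subset_currents_def)

lemma borel_measurable_subset_current:
  "\<mu> \<in> subset_currents \<Longrightarrow> continuous_on UNIV f \<Longrightarrow> f \<in> borel_measurable \<mu>"
  for f :: "'n cspace \<Rightarrow> real"
  using measurable_cong_sets[OF sets_subset_current refl] borel_measurable_continuous_onI by blast

lemma integrable_subset_current:
  fixes f :: "'n cspace \<Rightarrow> real"
  assumes \<mu>: "\<mu> \<in> subset_currents" and f: "continuous_on UNIV f"
    and K: "compact K" "\<And>S. S \<notin> K \<Longrightarrow> f S = 0"
  shows "integrable \<mu> f"
proof -
  have "compact (f ` K)"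
    by (rule compact_continuous_image[OF continuous_on_subset[OF f subset_UNIV] K(1)])
  from compact_imp_bounded[OF this] obtain B where B: "\<And>S. S \<in> K \<Longrightarrow> norm (f S) \<le> B"
    unfolding bounded_iff by blast
  show ?thesis
  proof (rule integrableI_bounded_set[where A = K and B = B])
    show "K \<in> sets \<mu>" using \<mu> K(1) by (simp add: sets_subset_current compact_imp_closed)
    show "emeasure \<mu> K < \<infinity>" by (rule emeasure_compact_finite[OF \<mu> K(1)])
    show "f \<in> borel_measurable \<mu>" by (rule borel_measurable_subset_current[OF \<mu> f])
  qed (use B K(2) in auto)
qed

lemma integral_translate:
  fixes f :: "'n cspace \<Rightarrow> real"
  assumes \<mu>: "\<mu> \<in> subset_currents" and g: "freely_reduced g" and f: "continuous_on UNIV f"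
  shows "(\<integral>S. f (translate g S) \<partial>\<mu>) = (\<integral>S. f S \<partial>\<mu>)"
proof -
  have meas: "translate g \<in> measurable \<mu> borel"
    using measurable_translate measurable_cong_sets[OF sets_subset_current[OF \<mu>] refl] by blast
  have "distr \<mu> borel (translate g) = \<mu>"
  proof (rule measure_eqI)
    fix A :: "'n cspace set" assume "A \<in> sets (distr \<mu> borel (translate g))"
    then have A: "A \<in> sets borel" by simp
    have "space \<mu> = UNIV" using sets_eq_imp_space_eq[OF sets_subset_current[OF \<mu>]] by simp
    moreover have "translate g -` A = translate (word_inverse g) ` A"
      by (simp only: translate_image_eq_vimage word_inverse_twice)
    ultimately have "emeasure (distr \<mu> borel (translate g)) A = emeasure \<mu> (translate (word_inverse g) ` A)"
      using A meas by (simp add: emeasure_distr)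
    also have "\<dots> = emeasure \<mu> A"
      using \<mu> A reduced_word_inverse[OF g] by (simp add: subset_currents_def)
    finally show "emeasure (distr \<mu> borel (translate g)) A = emeasure \<mu> A" .
  qed (simp add: sets_subset_current[OF \<mu>])
  then show ?thesis
    using integral_distr[OF meas borel_measurable_continuous_onI[OF f]] by simp
qed

lemma measure_branching_eq_sum:
  fixes \<nu> :: "('n :: finite) cspace measure"
  assumes \<nu>: "\<nu> \<in> subset_currents" and r: "1 \<le> r"
  shows "measure \<nu> branching = (\<Sum>T\<in>vertex_types r. measure \<nu> (cylinder r T))"
    and "\<And>T. T \<in> vertex_types r \<Longrightarrow> emeasure \<nu> (cylinder r T) < \<infinity>"
proof -
  note fin = emeasure_compact_finite[OF \<nu> compact_branching]
  have br: "branching \<in> sets \<nu>"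
    unfolding sets_subset_current[OF \<nu>] by (rule borel_open[OF open_branching])
  have lt: "emeasure \<nu> (cylinder r T) < \<infinity>" if "T \<in> vertex_types r" for T
    by (rule order.strict_trans1[OF emeasure_mono[OF cylinder_vertex_type[OF r that] br] fin])
  have eq: "branching = (\<Union>T\<in>vertex_types r. cylinder r T)"
    using cylinder_vertex_type[OF r] by (auto simp: vertex_types_def cylinder_def)
  show "measure \<nu> branching = (\<Sum>T\<in>vertex_types r. measure \<nu> (cylinder r T))"
    unfolding eq
  proof (rule measure_finite_Union[OF finite_vertex_types])
    show "cylinder r ` vertex_types r \<subseteq> sets \<nu>"
      unfolding sets_subset_current[OF \<nu>] by (auto intro: sets_cylinder)
    show "disjoint_family_on (cylinder r) (vertex_types r)"
      by (auto simp: disjoint_family_on_def cylinder_def)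
    show "emeasure \<nu> (cylinder r T) \<noteq> \<infinity>" if "T \<in> vertex_types r" for T
      using lt[OF that] by simp
  qed
  show "emeasure \<nu> (cylinder r T) < \<infinity>" if "T \<in> vertex_types r" for T by (rule lt[OF that])
qed

text \<open>Statistics at a larger radius determine those at a smaller one, so a single sequence
  converges at all radii.\<close>

lemma measure_cylinder_refine:
  fixes \<nu> :: "('n :: finite) cspace measure"
  assumes \<nu>: "\<nu> \<in> subset_currents" and r: "1 \<le> r" "r \<le> n" and T: "T \<in> vertex_types r"
  shows "measure \<nu> (cylinder r T) =
    (\<Sum>T'\<in>{T' \<in> vertex_types n. take r ` T' = T}. measure \<nu> (cylinder n T'))"
proof -
  let ?I = "{T' \<in> vertex_types n. take r ` T' = T}"
  have "cylinder r T = (\<Union>T'\<in>?I. cylinder n T')"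
  proof (rule subset_antisym; rule subsetI)
    fix S assume S: "S \<in> cylinder r T"
    then have "initial_words n (points S) \<in> ?I"
      using subsetD[OF cylinder_vertex_type[OF r(1) T] S]
      by (simp add: vertex_types_def take_initial_words[OF r(2)]) (simp add: cylinder_def)
    then show "S \<in> (\<Union>T'\<in>?I. cylinder n T')" by (rule UN_I) (simp add: cylinder_def)
  next
    fix S assume "S \<in> (\<Union>T'\<in>?I. cylinder n T')"
    then show "S \<in> cylinder r T" using take_initial_words[OF r(2), of "points S"]
      by (auto simp: cylinder_def)
  qed
  also have "measure \<nu> \<dots> = (\<Sum>T'\<in>?I. measure \<nu> (cylinder n T'))"
  proof (rule measure_finite_Union)
    show "finite ?I" by (simp add: finite_vertex_types)
    show "cylinder n ` ?I \<subseteq> sets \<nu>"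
      unfolding sets_subset_current[OF \<nu>] by (auto intro: sets_cylinder)
    show "disjoint_family_on (cylinder n) ?I"
      by (auto simp: disjoint_family_on_def cylinder_def)
    show "emeasure \<nu> (cylinder n T') \<noteq> \<infinity>" if "T' \<in> ?I" for T'
      using measure_branching_eq_sum(2)[OF \<nu>, of n T'] r that by simp
  qed
  finally show ?thesis .
qed

text \<open>At stage \<open>n\<close> the tolerance is divided by the number of types at radius \<open>n + 1\<close>, because a
  cylinder at a smaller radius is a union of possibly all of them.\<close>

lemma ex_rational_sequence:
  fixes \<mu> :: "('n :: finite) cspace measure"
  assumes \<mu>: "\<mu> \<in> subset_currents"
  obtains \<nu> where "\<And>n. \<nu> n \<in> rational_subset_currents"
    "\<And>r T. 1 \<le> r \<Longrightarrow> T \<in> vertex_types r \<Longrightarrow>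
      (\<lambda>n. measure (\<nu> n) (cylinder r T)) \<longlonglongrightarrow> measure \<mu> (cylinder r T)"
proof -
  let ?k = "\<lambda>n. real (card (vertex_types n :: 'n letter list set set)) + 1"
  have "\<exists>\<nu>\<in>rational_subset_currents. \<forall>T\<in>vertex_types (Suc n).
      \<bar>measure \<nu> (cylinder (Suc n) T) - measure \<mu> (cylinder (Suc n) T)\<bar> < inverse (Suc n) / ?k (Suc n)" for n
    by (rule rational_current_close[OF \<mu>, of "Suc n" "inverse (Suc n) / ?k (Suc n)"])
       (simp_all add: add_nonneg_pos, blast)
  then obtain \<nu> where \<nu>: "\<And>n. \<nu> n \<in> rational_subset_currents"
    and close: "\<And>n T. T \<in> vertex_types (Suc n) \<Longrightarrow>
      \<bar>measure (\<nu> n) (cylinder (Suc n) T) - measure \<mu> (cylinder (Suc n) T)\<bar> < inverse (Suc n) / ?k (Suc n)"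
    by metis
  show thesis
  proof (rule that[OF \<nu>])
    fix r and T :: "'n letter list set" assume r: "1 \<le> r" and T: "T \<in> vertex_types r"
    have bound: "norm (measure (\<nu> n) (cylinder r T) - measure \<mu> (cylinder r T)) \<le> inverse (Suc n)"
      if "r \<le> n" for n
    proof -
      let ?I = "{T' \<in> vertex_types (Suc n). take r ` T' = T}"
      have \<nu>c: "\<nu> n \<in> subset_currents" using \<nu> by (simp add: rational_subset_currents_def)
      have "r \<le> Suc n" using that by simp
      note refine = measure_cylinder_refine[OF _ r this T]
      have "norm (measure (\<nu> n) (cylinder r T) - measure \<mu> (cylinder r T))
          = \<bar>\<Sum>T'\<in>?I. measure (\<nu> n) (cylinder (Suc n) T') - measure \<mu> (cylinder (Suc n) T')\<bar>"
        unfolding refine[OF \<nu>c] refine[OF \<mu>] by (simp add: sum_subtractf)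
      also have "\<dots> \<le> (\<Sum>T'\<in>?I. inverse (Suc n) / ?k (Suc n))"
        by (rule order_trans[OF sum_abs sum_mono]) (use close in \<open>auto intro: less_imp_le\<close>)
      also have "\<dots> = inverse (Suc n) * (real (card ?I) / ?k (Suc n))" by simp
      also have "\<dots> \<le> inverse (Suc n) * 1"
      proof (rule mult_left_mono)
        have "card ?I \<le> card (vertex_types (Suc n) :: 'n letter list set set)"
          by (rule card_mono) (auto simp: finite_vertex_types)
        then show "real (card ?I) / ?k (Suc n) \<le> 1" by simp
      qed simp
      finally show ?thesis by simp
    qed
    have "(\<lambda>n. measure (\<nu> n) (cylinder r T) - measure \<mu> (cylinder r T)) \<longlonglongrightarrow> 0"
      by (rule Lim_null_comparison[OF eventually_sequentiallyI[of r, OF bound] LIMSEQ_inverse_real_of_nat])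
    then show "(\<lambda>n. measure (\<nu> n) (cylinder r T)) \<longlonglongrightarrow> measure \<mu> (cylinder r T)"
      by (simp add: LIM_zero_iff)
  qed
qed

lemma integral_close_to_type_sum:
  fixes h :: "('n :: finite) cspace \<Rightarrow> real"
  assumes \<nu>: "\<nu> \<in> subset_currents" and r: "1 \<le> r" and h: "continuous_on UNIV h"
    and supp: "\<And>S. S \<notin> branching \<Longrightarrow> h S = 0" and "0 \<le> \<eta>"
    and osc: "\<And>S. S \<in> branching \<Longrightarrow> \<bar>h S - y (initial_words r (points S))\<bar> \<le> \<eta>"
  shows "\<bar>(\<integral>S. h S \<partial>\<nu>) - (\<Sum>T\<in>vertex_types r. y T * measure \<nu> (cylinder r T))\<bar> \<le> \<eta> * measure \<nu> branching"
proof -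
  let ?g = "\<lambda>S. \<Sum>T\<in>vertex_types r. y T * indicator (cylinder r T) S"
  have cyl: "cylinder r T \<in> sets \<nu>" for T unfolding sets_subset_current[OF \<nu>] by (rule sets_cylinder)
  have ind: "integrable \<nu> (\<lambda>S. indicator (cylinder r T) S :: real)" if "T \<in> vertex_types r" for T
    using cyl measure_branching_eq_sum(2)[OF \<nu> r that] by (intro integrable_real_indicator)
  have int_h: "integrable \<nu> h"
    by (rule integrable_subset_current[OF \<nu> h compact_branching supp])
  have int_g: "integrable \<nu> ?g"
    by (intro Bochner_Integration.integrable_sum integrable_mult_right ind)
  have br: "integrable \<nu> (\<lambda>S. \<eta> * indicator branching S)"
  proof (intro integrable_mult_right integrable_real_indicator)
    show "branching \<in> sets \<nu>"
      unfolding sets_subset_current[OF \<nu>] by (rule borel_open[OF open_branching])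
    show "emeasure \<nu> branching < \<infinity>" by (rule emeasure_compact_finite[OF \<nu> compact_branching])
  qed
  have "(\<integral>S. ?g S \<partial>\<nu>) = (\<Sum>T\<in>vertex_types r. \<integral>S. y T * indicator (cylinder r T) S \<partial>\<nu>)"
    by (rule Bochner_Integration.integral_sum) (intro integrable_mult_right ind)
  also have "\<dots> = (\<Sum>T\<in>vertex_types r. y T * measure \<nu> (cylinder r T))"
  proof (intro sum.cong refl)
    have "space \<nu> = UNIV" using sets_eq_imp_space_eq[OF sets_subset_current[OF \<nu>]] by simp
    then show "(\<integral>S. y T * indicator (cylinder r T) S \<partial>\<nu>) = y T * measure \<nu> (cylinder r T)" for T
      by simp
  qed
  finally have g: "(\<integral>S. ?g S \<partial>\<nu>) = (\<Sum>T\<in>vertex_types r. y T * measure \<nu> (cylinder r T))" .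
  have pointwise: "norm (h S - ?g S) \<le> \<eta> * indicator branching S" for S
  proof (cases "S \<in> branching")
    case True
    let ?T = "initial_words r (points S)"
    have "?T \<in> vertex_types r" using True by (auto simp: vertex_types_def)
    then have "?g S = (\<Sum>T\<in>{?T}. y T * indicator (cylinder r T) S)"
      by (intro sum.mono_neutral_right finite_vertex_types) (auto simp: cylinder_def indicator_def)
    also have "\<dots> = y ?T" by (simp add: cylinder_def)
    finally show ?thesis using osc[OF True] True by simp
  next
    case False
    then have "?g S = 0"
      using cylinder_vertex_type[OF r] by (intro sum.neutral) (auto simp: indicator_def)
    then show ?thesis using False supp by simp
  qed
  have int_d: "integrable \<nu> (\<lambda>S. h S - ?g S)" using int_h int_g by (rule Bochner_Integration.integrable_diff)
  have "\<bar>(\<integral>S. h S \<partial>\<nu>) - (\<integral>S. ?g S \<partial>\<nu>)\<bar> = norm (\<integral>S. h S - ?g S \<partial>\<nu>)"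
    unfolding Bochner_Integration.integral_diff[OF int_h int_g] by simp
  also have "\<dots> \<le> (\<integral>S. norm (h S - ?g S) \<partial>\<nu>)" by (rule integral_norm_bound)
  also have "\<dots> \<le> (\<integral>S. \<eta> * indicator branching S \<partial>\<nu>)"
    using integrable_norm[OF int_d] br pointwise by (rule integral_mono)
  also have "\<dots> = \<eta> * measure \<nu> branching"
    using sets_eq_imp_space_eq[OF sets_subset_current[OF \<nu>]] by simp
  finally show ?thesis by (simp add: g)
qed

locale converging_statistics =
  fixes \<mu> :: "('n :: finite) cspace measure" and \<nu> :: "nat \<Rightarrow> 'n cspace measure"
  assumes \<mu>: "\<mu> \<in> subset_currents" and \<nu>: "\<And>n. \<nu> n \<in> subset_currents"
    and statistics: "\<And>r T. 1 \<le> r \<Longrightarrow> T \<in> vertex_types r \<Longrightarrow>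
      (\<lambda>n. measure (\<nu> n) (cylinder r T)) \<longlonglongrightarrow> measure \<mu> (cylinder r T)"
begin

text \<open>A continuous function on the compact set of hulls through the identity is uniformly close to a
  function of the type at a large radius.\<close>

lemma converges_if_supported_in_branching:
  fixes h :: "'n cspace \<Rightarrow> real"
  assumes h: "continuous_on UNIV h" and supp: "\<And>S. S \<notin> branching \<Longrightarrow> h S = 0"
  shows "(\<lambda>n. \<integral>S. h S \<partial>\<nu> n) \<longlonglongrightarrow> (\<integral>S. h S \<partial>\<mu>)"
proof (rule LIMSEQ_I)
  fix \<epsilon> :: real assume "0 < \<epsilon>"
  define m where "m = measure \<mu> branching"
  define k where "k = 2 * m + 1"
  have k: "0 < k" by (simp add: k_def m_def add_nonneg_pos)
  \<comment> \<open>Replacing \<open>h\<close> by a function of the type costs \<open>\<eta> * (m + 1)\<close> for \<open>\<nu> n\<close> with \<open>n\<close> large and \<open>\<eta> * m\<close>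
    for \<open>\<mu>\<close>, together \<open>\<epsilon> / 2\<close>.\<close>
  define \<eta> where "\<eta> = \<epsilon> / (2 * k)"
  have \<eta>: "0 < \<eta>" using k \<open>0 < \<epsilon>\<close> by (simp add: \<eta>_def)
  have "uniformly_continuous_on branching h"
    using compact_uniformly_continuous[OF continuous_on_subset[OF h subset_UNIV] compact_branching] .
  then obtain d where d: "0 < d" "\<And>S S'. S \<in> branching \<Longrightarrow> S' \<in> branching \<Longrightarrow> dist S' S < d \<Longrightarrow> dist (h S') (h S) < \<eta>"
    using \<eta> unfolding uniformly_continuous_on_def by blast
  obtain n where n: "(1 / 2 :: real) ^ n < d" using eventually_close_pow[OF d(1)] by blast
  define r where "r = Suc n"
  have r: "1 \<le> r" by (simp add: r_def)
  define y where "y T = h (SOME S. S \<in> branching \<and> initial_words r (points S) = T)" for T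
  have osc: "\<bar>h S - y (initial_words r (points S))\<bar> \<le> \<eta>" if S: "S \<in> branching" for S
  proof -
    let ?S = "SOME S'. S' \<in> branching \<and> initial_words r (points S') = initial_words r (points S)"
    have "?S \<in> branching \<and> initial_words r (points ?S) = initial_words r (points S)"
      by (rule someI[of _ S]) (use S in simp)
    moreover from this have "dist S ?S \<le> (1 / 2) ^ r" by (simp add: dist_cspace_le_iff)
    moreover have "(1 / 2 :: real) ^ r \<le> (1 / 2) ^ n" by (intro power_decreasing) (auto simp: r_def)
    ultimately have "dist (h S) (h ?S) < \<eta>" using d(2)[of ?S S] S n by linarith
    then show ?thesis by (simp add: y_def dist_real_def)
  qed
  let ?s = "\<lambda>\<nu>. \<Sum>T\<in>vertex_types r. y T * measure \<nu> (cylinder r T)"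
  have approx: "\<bar>(\<integral>S. h S \<partial>\<kappa>) - ?s \<kappa>\<bar> \<le> \<eta> * measure \<kappa> branching" if "\<kappa> \<in> subset_currents" for \<kappa>
    by (rule integral_close_to_type_sum[OF that r h supp less_imp_le[OF \<eta>] osc])
  have "(\<lambda>n. measure (\<nu> n) branching) \<longlonglongrightarrow> m"
    unfolding m_def measure_branching_eq_sum(1)[OF \<nu> r] measure_branching_eq_sum(1)[OF \<mu> r]
    by (intro tendsto_sum statistics[OF r])
  then have "\<forall>\<^sub>F n in sequentially. measure (\<nu> n) branching < m + 1"
    by (rule order_tendstoD) simp
  moreover have "(\<lambda>n. ?s (\<nu> n)) \<longlonglongrightarrow> ?s \<mu>"
    by (intro tendsto_sum tendsto_mult tendsto_const statistics[OF r])
  then have "\<forall>\<^sub>F n in sequentially. dist (?s (\<nu> n)) (?s \<mu>) < \<epsilon> / 2"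
    by (rule tendstoD) (use \<open>0 < \<epsilon>\<close> in simp)
  ultimately have "\<forall>\<^sub>F n in sequentially. norm ((\<integral>S. h S \<partial>\<nu> n) - (\<integral>S. h S \<partial>\<mu>)) < \<epsilon>"
  proof eventually_elim
    case (elim n)
    have "\<eta> * measure (\<nu> n) branching \<le> \<eta> * (m + 1)" using elim(1) \<eta> by (intro mult_left_mono) auto
    moreover have "\<eta> * (m + 1) + \<eta> * m = \<eta> * k" by (simp add: k_def algebra_simps)
    moreover have "\<eta> * k = \<epsilon> / 2" using k by (simp add: \<eta>_def)
    ultimately show ?case
      using approx[OF \<nu>[of n]] approx[OF \<mu>, folded m_def] elim(2) unfolding dist_real_def real_norm_def
      by linarith
  qed
  then show "\<exists>no. \<forall>n\<ge>no. norm ((\<integral>S. h S \<partial>\<nu> n) - (\<integral>S. h S \<partial>\<mu>)) < \<epsilon>"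
    by (simp add: eventually_sequentially)
qed

text \<open>Cut the function into pieces living on translates of the set of hulls through the identity; since
  these sets are open and closed, the pieces are continuous.\<close>

lemma converges_if_covered:
  fixes f :: "'n cspace \<Rightarrow> real"
  assumes "finite G" "\<And>g. g \<in> G \<Longrightarrow> freely_reduced g"
    and "continuous_on UNIV f" "\<And>S. f S \<noteq> 0 \<Longrightarrow> S \<in> (\<Union>g\<in>G. translate g ` branching)"
  shows "(\<lambda>n. \<integral>S. f S \<partial>\<nu> n) \<longlonglongrightarrow> (\<integral>S. f S \<partial>\<mu>)"
  using assms
proof (induction G arbitrary: f rule: finite_induct)
  case empty
  then have "f = (\<lambda>_. 0)" by auto
  then show ?case by simp
next
  case (insert g G)
  have g: "freely_reduced g" using insert.prems(1) by simp
  let ?U = "translate g ` branching :: 'n cspace set"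
  let ?f1 = "\<lambda>S. if S \<in> ?U then f S else 0" and ?f2 = "\<lambda>S. if S \<in> ?U then 0 else f S"
  have U: "closed ?U" "closed (- ?U)"
    using closed_translate_image[OF closed_branching] open_translate_image[OF open_branching]
    by (auto simp: closed_Compl)
  have cont: "continuous_on UNIV ?f1" "continuous_on UNIV ?f2"
    using continuous_on_cases[OF U, of f "\<lambda>_. 0" "\<lambda>S. S \<in> ?U"]
      continuous_on_cases[OF U, of "\<lambda>_. 0" f "\<lambda>S. S \<in> ?U"]
      continuous_on_subset[OF insert.prems(2)] by auto
  have cpt: "compact (translate h ` branching :: 'n cspace set)" for h :: "'n letter list"
    by (rule compact_continuous_image[OF continuous_on_translate compact_branching])
  have "(\<lambda>n. \<integral>S. ?f1 (translate g S) \<partial>\<nu> n) \<longlonglongrightarrow> (\<integral>S. ?f1 (translate g S) \<partial>\<mu>)"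
  proof (rule converges_if_supported_in_branching)
    show "continuous_on UNIV (\<lambda>S. ?f1 (translate g S))"
      by (rule continuous_on_compose2[OF cont(1) continuous_on_translate]) simp
    show "?f1 (translate g S) = 0" if "S \<notin> branching" for S
    proof -
      have "translate g S \<notin> ?U"
        using that injD[OF inj_on_inverseI[of UNIV "translate (word_inverse g)" "translate g"]] by auto
      then show ?thesis by simp
    qed
  qed
  then have "(\<lambda>n. \<integral>S. ?f1 S \<partial>\<nu> n) \<longlonglongrightarrow> (\<integral>S. ?f1 S \<partial>\<mu>)"
    by (simp only: integral_translate[OF \<nu> g cont(1)] integral_translate[OF \<mu> g cont(1)])
  moreover have "(\<lambda>n. \<integral>S. ?f2 S \<partial>\<nu> n) \<longlonglongrightarrow> (\<integral>S. ?f2 S \<partial>\<mu>)"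
  proof (rule insert.IH[OF _ cont(2)])
    show "freely_reduced h" if "h \<in> G" for h using that insert.prems(1) by simp
    show "S \<in> (\<Union>g\<in>G. translate g ` branching)" if "?f2 S \<noteq> 0" for S
      using that insert.prems(3)[of S] by (auto split: if_splits)
  qed
  ultimately have lim: "(\<lambda>n. (\<integral>S. ?f1 S \<partial>\<nu> n) + (\<integral>S. ?f2 S \<partial>\<nu> n)) \<longlonglongrightarrow> (\<integral>S. ?f1 S \<partial>\<mu>) + (\<integral>S. ?f2 S \<partial>\<mu>)"
    by (rule tendsto_add)
  have split: "(\<integral>S. f S \<partial>\<kappa>) = (\<integral>S. ?f1 S \<partial>\<kappa>) + (\<integral>S. ?f2 S \<partial>\<kappa>)" if \<kappa>: "\<kappa> \<in> subset_currents" for \<kappa>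
  proof -
    have "integrable \<kappa> ?f1" by (rule integrable_subset_current[OF \<kappa> cont(1) cpt[of g]]) simp
    moreover have "integrable \<kappa> ?f2"
    proof (rule integrable_subset_current[OF \<kappa> cont(2)])
      show "compact (\<Union>h\<in>insert g G. translate h ` branching :: 'n cspace set)"
        using insert.hyps(1) cpt by (intro compact_UN) auto
      show "?f2 S = 0" if "S \<notin> (\<Union>h\<in>insert g G. translate h ` branching)" for S
        using that insert.prems(3)[of S] by auto
    qed
    ultimately have "(\<integral>S. ?f1 S + ?f2 S \<partial>\<kappa>) = (\<integral>S. ?f1 S \<partial>\<kappa>) + (\<integral>S. ?f2 S \<partial>\<kappa>)"
      by (rule Bochner_Integration.integral_add)
    moreover have "(\<lambda>S. ?f1 S + ?f2 S) = f" by auto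
    ultimately show ?thesis by simp
  qed
  show ?case unfolding split[OF \<nu>] split[OF \<mu>] by (rule lim)
qed

lemma converges_if_compactly_supported:
  assumes "f \<in> compactly_supported"
  shows "(\<lambda>n. integral\<^sup>L (\<nu> n) f) \<longlonglongrightarrow> integral\<^sup>L \<mu> f"
proof -
  have f: "continuous_on UNIV f" "compact (closure {S. f S \<noteq> 0})"
    using assms by (auto simp: compactly_supported_def)
  from compact_translate_branching_cover[OF f(2)] obtain G where
    G: "finite G" "\<And>g. g \<in> G \<Longrightarrow> freely_reduced g" "closure {S. f S \<noteq> 0} \<subseteq> (\<Union>g\<in>G. translate g ` branching)"
    by blast
  show ?thesis
  proof (rule converges_if_covered[OF G(1,2) f(1)])
    show "S \<in> (\<Union>g\<in>G. translate g ` branching)" if "f S \<noteq> 0" for S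
    proof -
      have "S \<in> closure {S. f S \<noteq> 0}" by (rule subsetD[OF closure_subset]) (use that in simp)
      then show ?thesis by (rule subsetD[OF G(3)])
    qed
  qed
qed

text \<open>An open set in the weak topology constrains only finitely many integrals.\<close>

lemma eventually_in_open:
  assumes "openin subset_current_topology U" "\<mu> \<in> U"
  shows "\<forall>\<^sub>F n in sequentially. \<nu> n \<in> U"
proof -
  let ?I = "\<lambda>\<mu> :: 'n cspace measure. \<lambda>f\<in>compactly_supported. integral\<^sup>L \<mu> f"
  obtain Q where Q: "openin (product_topology (\<lambda>_. euclideanreal) compactly_supported) Q"
    "U = ?I -` Q \<inter> subset_currents"
    using assms(1) unfolding subset_current_topology_def openin_pullback_topology by blast
  then have "?I \<mu> \<in> Q" using \<open>\<mu> \<in> U\<close> by blast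
  then obtain X where X: "finite {f \<in> compactly_supported. X f \<noteq> (UNIV :: real set)}"
    "\<And>f. f \<in> compactly_supported \<Longrightarrow> open (X f)"
    "?I \<mu> \<in> Pi\<^sub>E compactly_supported X" "Pi\<^sub>E compactly_supported X \<subseteq> Q"
    using Q(1) unfolding openin_product_topology_alt by fastforce
  let ?J = "{f \<in> compactly_supported. X f \<noteq> (UNIV :: real set)}"
  have "\<forall>\<^sub>F n in sequentially. integral\<^sup>L (\<nu> n) f \<in> X f" if "f \<in> ?J" for f
    by (rule topological_tendstoD[OF converges_if_compactly_supported X(2)])
       (use that X(3) in \<open>auto simp: PiE_iff\<close>)
  then have "\<forall>\<^sub>F n in sequentially. \<forall>f\<in>?J. integral\<^sup>L (\<nu> n) f \<in> X f"
    using X(1) by (intro eventually_ball_finite) auto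
  then show ?thesis
  proof eventually_elim
    case (elim n)
    have "integral\<^sup>L (\<nu> n) f \<in> X f" if "f \<in> compactly_supported" for f
      using elim that by (cases "f \<in> ?J") auto
    then have "?I (\<nu> n) \<in> Pi\<^sub>E compactly_supported X" by (simp add: PiE_iff)
    then show "\<nu> n \<in> U" using X(4) Q(2) \<nu> by blast
  qed
qed

end

theorem theorem2:
  assumes "CARD('n :: finite) \<ge> 2"
  shows "subset_current_topology closure_of rational_subset_currents =
    (subset_currents :: 'n cspace measure set)"
proof
  show "subset_current_topology closure_of rational_subset_currents \<subseteq> (subset_currents :: 'n cspace measure set)"
    using closure_of_subset_topspace[of subset_current_topology] by simp
  show "(subset_currents :: 'n cspace measure set) \<subseteq> subset_current_topology closure_of rational_subset_currents"
  proof
    fix \<mu> :: "'n cspace measure" assume \<mu>: "\<mu> \<in> subset_currents"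
    obtain \<nu> where rational: "\<And>n. \<nu> n \<in> rational_subset_currents"
      and statistics: "\<And>r T. 1 \<le> r \<Longrightarrow> T \<in> vertex_types r \<Longrightarrow>
        (\<lambda>n. measure (\<nu> n) (cylinder r T)) \<longlonglongrightarrow> measure \<mu> (cylinder r T)"
      by (rule ex_rational_sequence[OF \<mu>]) (rule that)
    interpret converging_statistics \<mu> \<nu>
      by unfold_locales (use \<mu> rational statistics in \<open>auto simp: rational_subset_currents_def\<close>)
    have "\<exists>\<nu>\<in>rational_subset_currents. \<nu> \<in> U" if U: "\<mu> \<in> U" "openin subset_current_topology U" for U
    proof -
      obtain n where "\<nu> n \<in> U"
        using eventually_happens'[OF sequentially_bot eventually_in_open[OF U(2,1)]] by blast
      with rational show ?thesis by blast
    qed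
    then show "\<mu> \<in> subset_current_topology closure_of rational_subset_currents"
      using \<mu> by (auto simp: in_closure_of)
  qed
qed

end
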